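(* Let $(\rho,\gamma)$ be an object on a finite-dimensional Hilbert space $\mathcal H$, let $E>0$ be the energy gap of a qubit, let $T$ be the reference temperature and let $\hat T\neq 0$ be a temperature with $1/\hat T>1/T$. The resource $(\rho,\gamma)$ can be used for cooling the qubit down from $T$ to the temperature $\hat T$ if and only if there is a decision rule $(\mathcal E_\rho,\mathcal E_\gamma)$, i.e. positive operators on $\mathcal H$ with $\mathcal E_\rho+\mathcal E_\gamma=1$, with $[\mathcal E_\gamma,\gamma]=0$, such that the error probabilities $F_1:=\mathrm{tr}(\gamma\mathcal E_\rho)$ and $F_2:=\mathrm{tr}(\rho\mathcal E_\gamma)$ are given by $$F_1=\frac{1}{1+e^{-E/(kT)}},\qquad F_2=\frac{e^{-E/(k\hat T)}}{1+e^{-E/(k\hat T)}} .$$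
   Context: $k>0$ is Boltzmann's constant and $T\in\mathbb{R}$, $T\neq0$, is a fixed reference temperature. An object is a pair $(\rho,\gamma)$ of density matrices on a finite-dimensional complex Hilbert space, where $\gamma$ (the equilibrium state) has full rank. Conversion order: $(\rho,\gamma)\ge(\tilde\rho,\tilde\gamma)$ (on $\mathcal H$, $\tilde{\mathcal H}$) means that there exist a sequence of full-rank density matrices $\hat\gamma_n$ on finite-dimensional Hilbert spaces $\mathcal K_n$ and unitaries $u_n$ on $\mathcal H\otimes\mathcal K_n\otimes\tilde{\mathcal H}$ commuting with $\gamma\otimes\hat\gamma_n\otimes\tilde\gamma$ such that $\lim_{n\to\infty}\mathrm{tr}_{12}(u_n(\rho\otimes\hat\gamma_n\otimes\tilde\gamma)u_n^* )=\tilde\rho$, where $\mathrm{tr}_{12}$ is the partial trace over the first two tensor factors. "$(\rho,\gamma)$ can be used for cooling the qubit down to the temperature $\hat T$" means $(\rho,\gamma)\ge(\mathrm{diag}(\tilde p_1,\tilde p_2),\mathrm{diag}(\tilde g_1,\tilde g_2))$ with $\tilde p_1=\frac{1}{1+e^{-E/(k\hat T)}}$, $\tilde p_2=1-\tilde p_1$, $\tilde g_1=\frac{1}{1+e^{-E/(kT)}}$, $\tilde g_2=1-\tilde g_1$. *)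

theory Defs
  imports
    Complex_Main
    "Jordan_Normal_Form.Schur_Decomposition"
    "Jordan_Normal_Form.DL_Rank"
begin

text \<open>
  A Hilbert space of finite dimension d is identified with the space of complex vectors of
  length d, and its operators with the d by d complex matrices.
\<close>

definition mat_trace :: "complex mat \<Rightarrow> complex" where
  "mat_trace A = (\<Sum>i<dim_row A. A $$ (i, i))"

text \<open>
  Over the complex numbers, non-negativity of the quadratic form already forces A to be
  Hermitian. Here \<open>\<le>\<close> is the order of \<open>HOL-Library.Complex_Order\<close>, in which
  \<open>0 \<le> z\<close> means that z is real and non-negative.
\<close>

definition positive_operator :: "nat \<Rightarrow> complex mat \<Rightarrow> bool" where
  "positive_operator d A \<longleftrightarrow>
     A \<in> carrier_mat d d \<and> (\<forall>v \<in> carrier_vec d. 0 \<le> (A *\<^sub>v v) \<bullet>c v)"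

definition density_matrix :: "nat \<Rightarrow> complex mat \<Rightarrow> bool" where
  "density_matrix d \<rho> \<longleftrightarrow> positive_operator d \<rho> \<and> mat_trace \<rho> = 1"

definition full_rank_density_matrix :: "nat \<Rightarrow> complex mat \<Rightarrow> bool" where
  "full_rank_density_matrix d \<gamma> \<longleftrightarrow> density_matrix d \<gamma> \<and> vec_space.rank d \<gamma> = d"

definition is_object :: "nat \<Rightarrow> complex mat \<times> complex mat \<Rightarrow> bool" where
  "is_object d X \<longleftrightarrow> density_matrix d (fst X) \<and> full_rank_density_matrix d (snd X)"

definition unitary_operator :: "nat \<Rightarrow> complex mat \<Rightarrow> bool" where
  "unitary_operator d u \<longleftrightarrow>
     u \<in> carrier_mat d d \<and> u * mat_adjoint u = 1\<^sub>m d \<and> mat_adjoint u * u = 1\<^sub>m d"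

text \<open>
  Tensor products use the Kronecker convention: if the second factor has dimension r, the basis
  vector with index a in the first factor and b in the second has index \<open>a * r + b\<close>.
\<close>

definition tensor_mat :: "complex mat \<Rightarrow> complex mat \<Rightarrow> complex mat" (infixl \<open>\<otimes>\<^sub>m\<close> 75) where
  "A \<otimes>\<^sub>m B =
     mat (dim_row A * dim_row B) (dim_col A * dim_col B)
       (\<lambda>(i, j). A $$ (i div dim_row B, j div dim_col B) * B $$ (i mod dim_row B, j mod dim_col B))"

text \<open>
  Partial trace over the first factor, of dimension m; the remaining factor has dimension r.
  For three factors of dimensions d, e, r, the partial trace over the first two is
  \<open>ptrace_fst (d * e) r\<close>.
\<close>

definition ptrace_fst :: "nat \<Rightarrow> nat \<Rightarrow> complex mat \<Rightarrow> complex mat" where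
  "ptrace_fst m r A = mat r r (\<lambda>(i, j). \<Sum>a<m. A $$ (a * r + i, a * r + j))"

lemma ptrace_fst_tensor_mat:
  assumes "A \<in> carrier_mat m m" and "B \<in> carrier_mat r r"
  shows "ptrace_fst m r (A \<otimes>\<^sub>m B) = mat_trace A \<cdot>\<^sub>m B"
proof (rule eq_matI)
  fix i j
  assume "i < dim_row (mat_trace A \<cdot>\<^sub>m B)" and "j < dim_col (mat_trace A \<cdot>\<^sub>m B)"
  then have ij: "i < r" "j < r" using assms by auto
  have bound: "a * r + l < m * r" if "a < m" "l < r" for a l
  proof -
    have "a * r + l < Suc a * r" using that by simp
    also have "\<dots> \<le> m * r" using that by (intro mult_le_mono1) simp
    finally show ?thesis .
  qed
  show "ptrace_fst m r (A \<otimes>\<^sub>m B) $$ (i, j) = (mat_trace A \<cdot>\<^sub>m B) $$ (i, j)"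
    using assms ij
    by (simp add: ptrace_fst_def tensor_mat_def mat_trace_def bound sum_distrib_right)
qed (use assms in \<open>simp_all add: ptrace_fst_def\<close>)

text \<open>
  In finite dimension all norms induce the same notion of convergence, namely entrywise convergence.
\<close>

definition mat_tendsto :: "nat \<Rightarrow> (nat \<Rightarrow> complex mat) \<Rightarrow> complex mat \<Rightarrow> bool" where
  "mat_tendsto d A L \<longleftrightarrow> (\<forall>i<d. \<forall>j<d. (\<lambda>n. A n $$ (i, j)) \<longlonglongrightarrow> L $$ (i, j))"

text \<open>
  \<open>converts d X r Y\<close> is the conversion order between an object X of dimension d and an
  object Y of dimension r. The dimension of the n-th auxiliary Hilbert space is \<open>e n\<close>.
\<close>

definition converts ::
  "nat \<Rightarrow> complex mat \<times> complex mat \<Rightarrow> nat \<Rightarrow> complex mat \<times> complex mat \<Rightarrow> bool" where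
  "converts d X r Y \<longleftrightarrow>
     (let \<rho> = fst X; \<gamma> = snd X; \<rho>' = fst Y; \<gamma>' = snd Y in
      \<exists>(e :: nat \<Rightarrow> nat) (g :: nat \<Rightarrow> complex mat) (u :: nat \<Rightarrow> complex mat).
        (\<forall>n. full_rank_density_matrix (e n) (g n)) \<and>
        (\<forall>n. unitary_operator (d * e n * r) (u n)) \<and>
        (\<forall>n. u n * (\<gamma> \<otimes>\<^sub>m g n \<otimes>\<^sub>m \<gamma>') = (\<gamma> \<otimes>\<^sub>m g n \<otimes>\<^sub>m \<gamma>') * u n) \<and>
        mat_tendsto r
          (\<lambda>n. ptrace_fst (d * e n) r (u n * (\<rho> \<otimes>\<^sub>m g n \<otimes>\<^sub>m \<gamma>') * mat_adjoint (u n))) \<rho>')"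

text \<open>Diagonal state of a qubit with energy gap E at temperature T; k is Boltzmann's constant.\<close>

definition qubit_thermal :: "real \<Rightarrow> real \<Rightarrow> real \<Rightarrow> complex mat" where
  "qubit_thermal k E T =
     (let p = 1 / (1 + exp (- E / (k * T)))
      in mat_diag 2 (\<lambda>i. complex_of_real (if i = 0 then p else 1 - p)))"

definition can_cool_qubit ::
  "real \<Rightarrow> real \<Rightarrow> nat \<Rightarrow> complex mat \<times> complex mat \<Rightarrow> real \<Rightarrow> real \<Rightarrow> bool" where
  "can_cool_qubit k T d X E T' \<longleftrightarrow>
     converts d X 2 (qubit_thermal k E T', qubit_thermal k E T)"

definition decision_rule :: "nat \<Rightarrow> complex mat \<Rightarrow> complex mat \<Rightarrow> bool" where
  "decision_rule d E\<^sub>\<rho> E\<^sub>\<gamma> \<longleftrightarrow>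
     positive_operator d E\<^sub>\<rho> \<and> positive_operator d E\<^sub>\<gamma> \<and> E\<^sub>\<rho> + E\<^sub>\<gamma> = 1\<^sub>m d"

end

theory Submission
  imports Defs "HOL-Library.FuncSet"
begin

text \<open>
  If a conversion exists, pulling the excited-state projection of the target back along \<open>u\<^sub>n\<close> and
  averaging over bath and target gives an effect on the input system. It commutes with \<open>\<gamma>\<close>
  because \<open>u\<^sub>n\<close> commutes with \<open>\<gamma> \<otimes> g\<^sub>n \<otimes> \<gamma>'\<close>, and its expectations in \<open>\<gamma>\<close> and \<open>\<rho>\<close> are the
  excited-state populations before and after the conversion. The effects form a compact set, so a
  subsequence converges to the required decision rule.

  Conversely, \<open>\<gamma>\<close> and \<open>E\<^sub>\<gamma>\<close> are diagonal in a common basis, with eigenvalues \<open>\<gamma>\<^sub>i\<close> and \<open>m\<^sub>i\<close>. The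
  bath has levels indexed by \<open>n \<in> {0..<L}\<^bsup>d+1\<^esup>\<close> of weight proportional to
  \<open>w\<^sub>n = \<Prod>\<^sub>i \<gamma>\<^sub>i\<^bsup>n\<^sub>i\<^esup> (g\<^sub>1/g\<^sub>0)\<^bsup>n\<^sub>d\<^esup>\<close>, each with multiplicity \<open>\<lfloor>K/w\<^sub>n\<rfloor>\<close>. A joint basis state
  \<open>(i, (n, s), j)\<close> belongs to the class \<open>c = n + e\<^sub>i + j e\<^sub>d\<close>, which determines its equilibrium weight;
  hence every permutation of a class commutes with the equilibrium state. In an interior class the
  numbers of states with given \<open>(i, j)\<close> are nearly proportional to \<open>\<gamma>\<^sub>i g\<^sub>j\<close>, so there are as many states with
  \<open>j = 1\<close> as there are in a subset containing the fraction \<open>m\<^sub>i\<close> of the states with given \<open>i\<close>. A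
  permutation mapping this subset onto the states with \<open>j = 1\<close> excites the target with probability
  \<open>\<Sum>\<^sub>i \<rho>\<^sub>i\<^sub>i m\<^sub>i\<close>, up to an error that vanishes as first \<open>K\<close> and then \<open>L\<close> tend to infinity. Coordinate
  \<open>d\<close> of the class shows that the target acquires no off-diagonal entries at all.
\<close>

subsection \<open>Counting in the lattice bath\<close>

text \<open>Equal fibre cardinalities give a bijection on each fibre; these glue because the fibres
  of \<open>f\<close> and \<open>h\<close> partition \<open>X\<close> and \<open>Y\<close>. With
  \<open>f\<close> and \<open>h\<close> recording the class and a membership bit, this yields the
  class-preserving permutation.\<close>

lemma ex_bij_betw_fibers:
  assumes "finite X" "finite Y"
    and card: "\<And>k. card {x \<in> X. f x = k} = card {y \<in> Y. h y = k}"
  shows "\<exists>\<pi>. bij_betw \<pi> X Y \<and> (\<forall>x\<in>X. h (\<pi> x) = f x)"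
proof -
  have "\<exists>\<phi>. bij_betw \<phi> {x \<in> X. f x = k} {y \<in> Y. h y = k}" for k
    using assms by (intro finite_same_card_bij) auto
  then obtain \<phi> where \<phi>: "\<And>k. bij_betw (\<phi> k) {x \<in> X. f x = k} {y \<in> Y. h y = k}"
    by metis
  have mem: "\<phi> (f x) x \<in> Y" "h (\<phi> (f x) x) = f x" if "x \<in> X" for x
    using bij_betwE[OF \<phi>[of "f x"]] that by auto
  have "bij_betw (\<lambda>x. \<phi> (f x) x) X Y"
  proof (rule bij_betw_imageI)
    show "inj_on (\<lambda>x. \<phi> (f x) x) X"
    proof (rule inj_onI)
      fix x y assume xy: "x \<in> X" "y \<in> X" "\<phi> (f x) x = \<phi> (f y) y"
      then have "f x = f y" using mem by metis
      then show "x = y"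
        using xy bij_betw_imp_inj_on[OF \<phi>[of "f x"]] by (auto dest: inj_onD)
    qed
    show "(\<lambda>x. \<phi> (f x) x) ` X = Y"
    proof (intro equalityI subsetI)
      fix y assume "y \<in> Y"
      then have "y \<in> \<phi> (h y) ` {x \<in> X. f x = h y}"
        using bij_betw_imp_surj_on[OF \<phi>[of "h y"]] by auto
      then show "y \<in> (\<lambda>x. \<phi> (f x) x) ` X" by (auto intro!: image_eqI)
    qed (use mem in auto)
  qed
  then show ?thesis using mem by blast
qed

lemma card_fibers:
  assumes "finite X" "finite I" "f ` X \<subseteq> I"
  shows "card X = (\<Sum>i\<in>I. card {x \<in> X. f x = i})"
  using sum.group[OF assms, of "\<lambda>_. 1::nat"] by simp

lemma real_card_Diff:
  assumes "finite B" "A \<subseteq> B"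
  shows "real (card (B - A)) = real (card B) - real (card A)"
  using assms by (simp add: card_Diff_subset finite_subset card_mono of_nat_diff)

text \<open>Rounding \<open>m i\<close> times the fibre size down gives a set whose size differs
  from the ideal total by at most \<open>card I\<close>. Adding or removing elements until the size
  is exactly \<open>N\<close> disturbs no fibre by more than the total correction.\<close>

lemma ex_subset_fractional_fibers:
  fixes m :: "'i \<Rightarrow> real"
  assumes X: "finite X" and I: "finite I" "f ` X \<subseteq> I"
    and m: "\<And>i. i \<in> I \<Longrightarrow> 0 \<le> m i \<and> m i \<le> 1"
    and N: "N \<le> card X"
  defines "F \<equiv> \<lambda>i. {x \<in> X. f x = i}"
  shows "\<exists>A\<subseteq>X. card A = N \<and>
    (\<forall>i\<in>I. \<bar>real (card {x \<in> A. f x = i}) - m i * real (card (F i))\<bar>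
       \<le> 1 + real (card I) + \<bar>real N - (\<Sum>i\<in>I. m i * real (card (F i)))\<bar>)"
proof -
  define t where "t i = nat \<lfloor>m i * real (card (F i))\<rfloor>" for i
  have t: "\<bar>real (t i) - m i * real (card (F i))\<bar> \<le> 1" "t i \<le> card (F i)" if "i \<in> I" for i
  proof -
    have "0 \<le> m i * real (card (F i))" using m[OF that] by simp
    then show "\<bar>real (t i) - m i * real (card (F i))\<bar> \<le> 1" unfolding t_def by linarith
    have "m i * real (card (F i)) \<le> real (card (F i))"
      using m[OF that] by (simp add: mult_left_le_one_le)
    then show "t i \<le> card (F i)" unfolding t_def
      by linarith
  qed
  have "\<exists>S. S \<subseteq> F i \<and> card S = t i" if "i \<in> I" for i
    using t(2)[OF that] by (meson obtain_subset_with_card_n)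
  then obtain S where S: "\<And>i. i \<in> I \<Longrightarrow> S i \<subseteq> F i" "\<And>i. i \<in> I \<Longrightarrow> card (S i) = t i"
    by metis
  define A0 where "A0 = (\<Union>i\<in>I. S i)"
  have A0X: "A0 \<subseteq> X" using S(1) unfolding A0_def F_def by auto
  have fib0: "{x \<in> A0. f x = i} = S i" if "i \<in> I" for i
    using S(1) that unfolding A0_def F_def by auto
  have cardA0: "card A0 = (\<Sum>i\<in>I. t i)"
    using card_fibers[of A0 I f] A0X X I fib0 S(2) by (auto simp: finite_subset)
  have gap: "\<bar>real N - real (card A0)\<bar>
      \<le> real (card I) + \<bar>real N - (\<Sum>i\<in>I. m i * real (card (F i)))\<bar>"
  proof -
    have "\<bar>real (card A0) - (\<Sum>i\<in>I. m i * real (card (F i)))\<bar>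
        = \<bar>\<Sum>i\<in>I. real (t i) - m i * real (card (F i))\<bar>"
      by (simp add: cardA0 sum_subtractf)
    also have "\<dots> \<le> (\<Sum>i\<in>I. \<bar>real (t i) - m i * real (card (F i))\<bar>)" by (rule sum_abs)
    also have "\<dots> \<le> (\<Sum>i\<in>I. 1)" by (rule sum_mono) (rule t)
    finally show ?thesis by simp
  qed
  \<comment> \<open>Comparability with \<open>A0\<close> is what matters: along an inclusion, the
    change of one fibre count cannot exceed the change of the total count.\<close>
  have "\<exists>A\<subseteq>X. card A = N \<and> (A \<subseteq> A0 \<or> A0 \<subseteq> A)"
  proof (cases "card A0 \<le> N")
    case True
    then show ?thesis using exists_subset_between[OF True N A0X X] by blast
  next
    case False
    then obtain A where "A \<subseteq> A0" "card A = N"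
      by (meson nat_le_linear obtain_subset_with_card_n)
    then show ?thesis using A0X by blast
  qed
  then obtain A where A: "A \<subseteq> X" "card A = N" "A \<subseteq> A0 \<or> A0 \<subseteq> A" by blast
  have finA: "finite A" "finite A0" using A(1) A0X X by (auto simp: finite_subset)
  have "\<bar>real (card {x \<in> A. f x = i}) - m i * real (card (F i))\<bar>
       \<le> 1 + real (card I) + \<bar>real N - (\<Sum>i\<in>I. m i * real (card (F i)))\<bar>" if i: "i \<in> I" for i
  proof -
    have "\<bar>real (card {x \<in> A. f x = i}) - real (t i)\<bar> \<le> \<bar>real N - real (card A0)\<bar>"
      using A(3)
    proof
      assume sub: "A \<subseteq> A0"
      have "real (card (S i)) - real (card {x \<in> A. f x = i}) = real (card (S i - {x \<in> A. f x = i}))"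
        using sub fib0[OF i] finA S(1)[OF i] X unfolding F_def
        by (subst real_card_Diff) (auto intro: finite_subset)
      also have "S i - {x \<in> A. f x = i} \<subseteq> A0 - A" using fib0[OF i] by auto
      then have "real (card (S i - {x \<in> A. f x = i})) \<le> real (card (A0 - A))"
        using finA by (simp add: card_mono)
      also have "\<dots> = real (card A0) - real (card A)"
        using sub finA by (simp add: real_card_Diff)
      finally have "real (card (S i)) - real (card {x \<in> A. f x = i}) \<le> real (card A0) - real N"
        using A by simp
      moreover have "card {x \<in> A. f x = i} \<le> card (S i)"
        using sub fib0[OF i] finA by (intro card_mono) (auto intro: finite_subset[of _ A0])
      ultimately show ?thesis using S(2)[OF i] by simp
    next
      assume sub: "A0 \<subseteq> A"
      have "real (card {x \<in> A. f x = i}) - real (card (S i)) = real (card ({x \<in> A. f x = i} - S i))"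
        using sub fib0[OF i] finA S(1)[OF i] X unfolding F_def
        by (subst real_card_Diff) (auto intro: finite_subset)
      also have "{x \<in> A. f x = i} - S i \<subseteq> A - A0" using fib0[OF i] by auto
      then have "real (card ({x \<in> A. f x = i} - S i)) \<le> real (card (A - A0))"
        using finA by (simp add: card_mono)
      also have "\<dots> = real (card A) - real (card A0)"
        using sub finA by (simp add: real_card_Diff)
      finally have "real (card {x \<in> A. f x = i}) - real (card (S i)) \<le> real N - real (card A0)"
        using A by simp
      moreover have "card (S i) \<le> card {x \<in> A. f x = i}"
        using sub fib0[OF i] finA by (intro card_mono) auto
      ultimately show ?thesis using S(2)[OF i] by simp
    qed
    then show ?thesis using t(1)[OF i] gap by linarith
  qed
  then show ?thesis using A by blast
qed


section \<open>Levels, multiplicities and classes of the bath\<close>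

lemma one_less_two: "(1::nat) < 2" by simp

text \<open>In a common eigenbasis of the equilibrium state and the effect,
  \<open>\<gamma> i\<close> and \<open>m i\<close> are their eigenvalues and \<open>r i\<close> is
  the diagonal of the input state; \<open>g\<close> holds the equilibrium populations of the target.
  The assumption \<open>\<gamma>_m\<close> says that the effect has expectation \<open>g 1\<close>
  in equilibrium.\<close>

locale lattice_bath =
  fixes d :: nat and \<gamma> r m g :: "nat \<Rightarrow> real"
  assumes \<gamma>_pos: "i < d \<Longrightarrow> 0 < \<gamma> i" and \<gamma>_sum: "(\<Sum>i<d. \<gamma> i) = 1"
    and r_nonneg: "i < d \<Longrightarrow> 0 \<le> r i" and r_sum: "(\<Sum>i<d. r i) = 1"
    and m_nonneg: "i < d \<Longrightarrow> 0 \<le> m i" and m_le_1: "i < d \<Longrightarrow> m i \<le> 1"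
    and g_pos: "0 < g 0" "0 < g 1" and g_sum: "g 0 + g 1 = 1"
    and \<gamma>_m: "(\<Sum>i<d. \<gamma> i * m i) = g 1"
begin

text \<open>The excitation probability to be approached, i.e. the expectation of the effect in the
  input state.\<close>

definition p :: real where "p = (\<Sum>i<d. r i * m i)"

text \<open>One unit in a coordinate \<open>i < d\<close> pays for the system level
  \<open>i\<close>, one unit in coordinate \<open>d\<close> for exciting the target. Only the ratio
  of the target populations is recorded, so \<open>g 0\<close> appears as a separate factor in class
  weights.\<close>

definition w :: "(nat \<Rightarrow> nat) \<Rightarrow> real" where
  "w n = (\<Prod>i<d. \<gamma> i ^ n i) * (g 1 / g 0) ^ n d"

definition box :: "nat \<Rightarrow> (nat \<Rightarrow> nat) set" where "box L = {..d} \<rightarrow>\<^sub>E {..<L}"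

text \<open>The lower bound 1 leaves room for subtracting one unit in any coordinate, so every bath
  label that such a class calls for lies in \<open>box L\<close>.\<close>

definition inner_box :: "nat \<Rightarrow> (nat \<Rightarrow> nat) set" where "inner_box L = {..d} \<rightarrow>\<^sub>E {1..<L}"

text \<open>Up to rounding, every bath level has the same total weight \<open>K\<close>. The bath is
  thus nearly uniform over the box, and shifting its label by one matters only near the
  boundary.\<close>

definition mult :: "real \<Rightarrow> (nat \<Rightarrow> nat) \<Rightarrow> nat" where "mult K n = nat \<lfloor>K / w n\<rfloor>"

definition bath :: "real \<Rightarrow> nat \<Rightarrow> ((nat \<Rightarrow> nat) \<times> nat) set" where
  "bath K L = Sigma (box L) (\<lambda>n. {..<mult K n})"

definition joint :: "real \<Rightarrow> nat \<Rightarrow> (nat \<times> ((nat \<Rightarrow> nat) \<times> nat) \<times> nat) set" where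
  "joint K L = {..<d} \<times> bath K L \<times> {..<2}"

definition cls :: "nat \<times> ((nat \<Rightarrow> nat) \<times> nat) \<times> nat \<Rightarrow> nat \<Rightarrow> nat" where
  "cls = (\<lambda>(i, (n, s), j). n(i := n i + 1, d := n d + j))"

text \<open>Inverse of \<open>cls\<close> in the bath label; the subtractions are exact only where \<open>c\<close> is in the interior.\<close>

definition pre :: "(nat \<Rightarrow> nat) \<Rightarrow> nat \<Rightarrow> nat \<Rightarrow> nat \<Rightarrow> nat" where
  "pre c i j = c(i := c i - 1, d := c d - j)"

definition Z :: "real \<Rightarrow> nat \<Rightarrow> real" where "Z K L = (\<Sum>n\<in>box L. real (mult K n) * w n)"

text \<open>Sum over the interior classes of the counting error before normalisation. It does not
  depend on \<open>K\<close>, so dividing by \<open>Z K L\<close> makes it vanish as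
  \<open>K\<close> grows.\<close>

definition err :: "nat \<Rightarrow> real" where
  "err L = (\<Sum>c\<in>inner_box L. g 0 * w c * (\<Sum>i<d. r i / \<gamma> i) * (4 * real d + 3))"

text \<open>Diagonal of the initial joint state: the input state, with bath and target in
  equilibrium.\<close>

definition prb :: "real \<Rightarrow> nat \<Rightarrow> nat \<times> ((nat \<Rightarrow> nat) \<times> nat) \<times> nat \<Rightarrow> real" where
  "prb K L = (\<lambda>(i, (n, s), j). r i * (w n / Z K L) * g j)"

lemma finite_box [simp]: "finite (box L)" "finite (inner_box L)"
  by (auto simp: box_def inner_box_def intro!: finite_PiE)

lemma finite_joint [simp]: "finite (bath K L)" "finite (joint K L)"
  by (auto simp: joint_def bath_def)

lemma card_box: "card (box L) = L ^ Suc d" "card (inner_box L) = (L - 1) ^ Suc d"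
  by (simp_all add: box_def inner_box_def card_PiE)

lemma w_pos: "0 < w n"
  using \<gamma>_pos g_pos by (auto simp: w_def intro!: mult_pos_pos prod_pos)

text \<open>The two increments made by \<open>cls\<close> multiply the weight by
  \<open>\<gamma> i\<close> and by \<open>(g 1 / g 0) ^ j\<close>; times \<open>g 0\<close> the
  latter is \<open>g j\<close>. Hence, up to normalisation, the equilibrium weight of a joint state
  depends on its class alone.\<close>

lemma w_cls:
  assumes "i < d" "j < 2"
  shows "g 0 * w (cls (i, (n, s), j)) = \<gamma> i * w n * g j"
proof -
  have j: "j = 0 \<or> j = 1" using assms by auto
  have "(\<Prod>i'<d. \<gamma> i' ^ (n(i := n i + 1, d := n d + j)) i') = (\<Prod>i'<d. \<gamma> i' ^ (n(i := n i + 1)) i')"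
    by (rule prod.cong) auto
  also have "\<dots> = \<gamma> i ^ (n i + 1) * (\<Prod>i'\<in>{..<d} - {i}. \<gamma> i' ^ n i')"
    using assms by (subst prod.remove[of _ i]) auto
  also have "\<dots> = \<gamma> i * (\<Prod>i'<d. \<gamma> i' ^ n i')"
    using assms by (subst (2) prod.remove[of _ i]) auto
  finally show ?thesis
    using j g_pos by (auto simp: w_def cls_def)
qed

lemma cls_iff_pre:
  assumes "c \<in> inner_box L" "i < d" "j < 2"
  shows "cls (i, (n, s), j) = c \<longleftrightarrow> n = pre c i j"
proof -
  have "1 \<le> c i" "1 \<le> c d" using assms by (auto simp: inner_box_def PiE_iff)
  then show ?thesis using assms by (auto simp: cls_def pre_def fun_eq_iff)
qed

lemma pre_in_box:
  assumes "c \<in> inner_box L" "i < d" "j < 2"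
  shows "pre c i j \<in> box L"
  using assms by (auto simp: inner_box_def box_def pre_def PiE_iff extensional_def less_imp_diff_less)

text \<open>In an interior class the system level and the target bit determine the bath label, so
  only the multiplicity index is free and the fibre is one full bath level.\<close>

lemma fiber_eq:
  assumes "c \<in> inner_box L" "i < d" "j < 2"
  shows "{x \<in> joint K L. cls x = c \<and> fst x = i \<and> snd (snd x) = j}
    = (\<lambda>s. (i, (pre c i j, s), j)) ` {..<mult K (pre c i j)}" (is "?F = ?G")
proof (intro equalityI subsetI)
  fix x assume x: "x \<in> ?F"
  then obtain n s where "x = (i, (n, s), j)" by (cases x) auto
  with x show "x \<in> ?G"
    using cls_iff_pre[OF assms, of n s] by (auto simp: joint_def bath_def)
next
  fix x assume "x \<in> ?G"
  then show "x \<in> ?F"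
    using cls_iff_pre[OF assms] pre_in_box[OF assms] assms by (auto simp: joint_def bath_def)
qed

text \<open>The bath level in question has weight \<open>g 0 * w c / (\<gamma> i * g j)\<close>, so
  its multiplicity is \<open>a\<close> rounded down. This is the near-proportionality to
  \<open>\<gamma> i * g j\<close>.\<close>

lemma card_fiber_bounds:
  assumes "c \<in> inner_box L" "i < d" "j < 2" "0 < K"
  defines "N \<equiv> real (card {x \<in> joint K L. cls x = c \<and> fst x = i \<and> snd (snd x) = j})"
    and "a \<equiv> K * \<gamma> i * g j / (g 0 * w c)"
  shows "N \<le> a" "a - 1 \<le> N"
proof -
  have "cls (i, (pre c i j, 0), j) = c" using cls_iff_pre assms by blast
  then have *: "g 0 * w c = \<gamma> i * w (pre c i j) * g j"
    using w_cls[OF assms(2,3), of "pre c i j" 0] by simp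
  have j: "j = 0 \<or> j = 1" using assms by auto
  have "a = K / w (pre c i j)"
    unfolding a_def * using \<gamma>_pos[OF assms(2)] g_pos j by auto
  moreover have "N = real (mult K (pre c i j))"
    unfolding N_def fiber_eq[OF assms(1-3)] by (subst card_image) (auto simp: inj_on_def)
  moreover have "0 \<le> K / w (pre c i j)" using assms(4) w_pos[of "pre c i j"] by simp
  ultimately show "N \<le> a" "a - 1 \<le> N" unfolding mult_def by linarith+
qed

end

section \<open>Counts and probabilities within one class\<close>

locale sized_bath = lattice_bath +
  fixes K :: real and L :: nat
  assumes K_pos: "0 < K" and Z_pos: "0 < Z K L"
begin

text \<open>Inside a class \<open>\<gamma> i * w n * g j\<close> is constant, so the probability of
  a state is proportional to \<open>r i / \<gamma> i\<close>, and a sum over \<open>A\<close> only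
  needs the number of its states for each system level.\<close>

lemma sum_prb_class:
  assumes A: "A \<subseteq> {x \<in> joint K L. cls x = c}"
  shows "(\<Sum>x\<in>A. prb K L x)
    = g 0 * w c / Z K L * (\<Sum>i<d. r i / \<gamma> i * real (card {x \<in> A. fst x = i}))"
proof -
  have fin: "finite A" using A by (rule finite_subset) simp
  have "prb K L x = g 0 * w c / Z K L * (r (fst x) / \<gamma> (fst x))" if "x \<in> A" for x
  proof -
    obtain i n s j where x: "x = (i, (n, s), j)" by (cases x) auto
    have ij: "i < d" "j < 2" "cls x = c" using that A x by (auto simp: joint_def)
    have "prb K L x = r i / \<gamma> i * (\<gamma> i * w n * g j) / Z K L"
      using \<gamma>_pos[OF ij(1)] by (simp add: prb_def x)
    also have "\<dots> = g 0 * w c / Z K L * (r i / \<gamma> i)"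
      using w_cls[OF ij(1,2), of n s] ij(3) x by simp
    finally show ?thesis by (simp add: x)
  qed
  then have "(\<Sum>x\<in>A. prb K L x) = (\<Sum>x\<in>A. g 0 * w c / Z K L * (r (fst x) / \<gamma> (fst x)))"
    by (rule sum.cong[OF refl])
  also have "\<dots> = (\<Sum>i<d. \<Sum>x | x \<in> A \<and> fst x = i. g 0 * w c / Z K L * (r (fst x) / \<gamma> (fst x)))"
    using fin A by (intro sum.group[symmetric]) (auto simp: joint_def)
  also have "\<dots> = (\<Sum>i<d. g 0 * w c / Z K L * (r i / \<gamma> i) * real (card {x \<in> A. fst x = i}))"
    by (intro sum.cong refl) (simp add: mult.commute)
  finally show ?thesis by (simp add: sum_distrib_left mult.assoc)
qed

text \<open>Here \<open>t i\<close> is the intended fraction of the states with system level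
  \<open>i\<close> that \<open>A\<close> contains. For the ideal counts the factors
  \<open>\<gamma> i\<close> and the class weight cancel, leaving \<open>K / Z K L\<close> times the
  average of \<open>t\<close> under \<open>r\<close>. The constant suits both the whole class and
  the selected subset.\<close>

lemma sum_prb_class_approx:
  assumes A: "A \<subseteq> {x \<in> joint K L. cls x = c}"
    and card: "\<And>i. i < d \<Longrightarrow>
      \<bar>real (card {x \<in> A. fst x = i}) - t i * (K * \<gamma> i / (g 0 * w c))\<bar> \<le> 4 * real d + 3"
  shows "\<bar>(\<Sum>x\<in>A. prb K L x) - K / Z K L * (\<Sum>i<d. r i * t i)\<bar>
    \<le> g 0 * w c * (\<Sum>i<d. r i / \<gamma> i) * (4 * real d + 3) / Z K L"
proof -
  define \<alpha> where "\<alpha> = g 0 * w c"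
  have \<alpha>: "0 < \<alpha>" using g_pos w_pos by (simp add: \<alpha>_def)
  define k where "k i = real (card {x \<in> A. fst x = i})" for i
  have "K / Z K L * (\<Sum>i<d. r i * t i) = \<alpha> / Z K L * (\<Sum>i<d. r i / \<gamma> i * (t i * (K * \<gamma> i / \<alpha>)))"
    unfolding sum_distrib_left
  proof (rule sum.cong[OF refl])
    fix i assume "i \<in> {..<d}"
    then show "K / Z K L * (r i * t i) = \<alpha> / Z K L * (r i / \<gamma> i * (t i * (K * \<gamma> i / \<alpha>)))"
      using \<gamma>_pos[of i] \<alpha> by simp
  qed
  then have "(\<Sum>x\<in>A. prb K L x) - K / Z K L * (\<Sum>i<d. r i * t i)
    = \<alpha> / Z K L * (\<Sum>i<d. r i / \<gamma> i * (k i - t i * (K * \<gamma> i / \<alpha>)))"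
    unfolding sum_prb_class[OF A] by (simp add: \<alpha>_def k_def right_diff_distrib sum_subtractf)
  also have "\<bar>\<dots>\<bar> = \<alpha> / Z K L * \<bar>\<Sum>i<d. r i / \<gamma> i * (k i - t i * (K * \<gamma> i / \<alpha>))\<bar>"
    using \<alpha> Z_pos by (simp add: abs_mult)
  also have "\<dots> \<le> \<alpha> / Z K L * (\<Sum>i<d. r i / \<gamma> i * (4 * real d + 3))"
  proof (rule mult_left_mono)
    have "\<bar>\<Sum>i<d. r i / \<gamma> i * (k i - t i * (K * \<gamma> i / \<alpha>))\<bar>
        \<le> (\<Sum>i<d. \<bar>r i / \<gamma> i * (k i - t i * (K * \<gamma> i / \<alpha>))\<bar>)" by (rule sum_abs)
    also have "\<dots> \<le> (\<Sum>i<d. r i / \<gamma> i * (4 * real d + 3))"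
    proof (rule sum_mono)
      fix i assume "i \<in> {..<d}"
      then have i: "i < d" by simp
      have "0 \<le> r i / \<gamma> i" using r_nonneg[OF i] \<gamma>_pos[OF i] by simp
      then show "\<bar>r i / \<gamma> i * (k i - t i * (K * \<gamma> i / \<alpha>))\<bar> \<le> r i / \<gamma> i * (4 * real d + 3)"
        using card[OF i] unfolding k_def \<alpha>_def abs_mult
        by (simp only: abs_of_nonneg mult_left_mono)
    qed
    finally show "\<bar>\<Sum>i<d. r i / \<gamma> i * (k i - t i * (K * \<gamma> i / \<alpha>))\<bar>
        \<le> (\<Sum>i<d. r i / \<gamma> i * (4 * real d + 3))" .
  qed (use \<alpha> Z_pos in simp)
  also have "\<dots> = \<alpha> * (\<Sum>i<d. r i / \<gamma> i) * (4 * real d + 3) / Z K L"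
    by (simp add: sum_distrib_right)
  finally show ?thesis by (simp add: \<alpha>_def)
qed

text \<open>The fibres with \<open>j = 0\<close> and \<open>j = 1\<close> each carry a rounding
  error of at most 1, and their ideal sizes add up because \<open>g 0 + g 1 = 1\<close>.\<close>

lemma card_class_approx:
  assumes c: "c \<in> inner_box L" and i: "i < d"
  shows "\<bar>real (card {x \<in> joint K L. cls x = c \<and> fst x = i}) - K * \<gamma> i / (g 0 * w c)\<bar> \<le> 2"
proof -
  have split: "{x \<in> joint K L. cls x = c \<and> fst x = i}
      = (\<Union>j<2. {x \<in> joint K L. cls x = c \<and> fst x = i \<and> snd (snd x) = j})"
    by (auto simp: joint_def)
  have "card {x \<in> joint K L. cls x = c \<and> fst x = i}
      = (\<Sum>j<2. card {x \<in> joint K L. cls x = c \<and> fst x = i \<and> snd (snd x) = j})"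
    unfolding split by (rule card_UN_disjoint) auto
  then have eq: "real (card {x \<in> joint K L. cls x = c \<and> fst x = i})
      = real (card {x \<in> joint K L. cls x = c \<and> fst x = i \<and> snd (snd x) = 0})
      + real (card {x \<in> joint K L. cls x = c \<and> fst x = i \<and> snd (snd x) = 1})"
    by (simp add: lessThan_nat_numeral numeral_eq_Suc)
  have "K * \<gamma> i / (g 0 * w c) = K * \<gamma> i * (g 0 + g 1) / (g 0 * w c)"
    by (simp only: g_sum mult_1_right)
  also have "\<dots> = K * \<gamma> i * g 0 / (g 0 * w c) + K * \<gamma> i * g 1 / (g 0 * w c)"
    by (simp only: distrib_left add_divide_distrib)
  finally show ?thesis
    using card_fiber_bounds[OF c i _ K_pos, of 0] card_fiber_bounds[OF c i _ K_pos, of 1] eq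
    by simp
qed

text \<open>There is one rounding error of at most 1 for each of the \<open>d\<close> system levels;
  the ideal sizes add up by normalisation of \<gamma>.\<close>

lemma card_excited_approx:
  assumes c: "c \<in> inner_box L"
  shows "\<bar>real (card {x \<in> joint K L. cls x = c \<and> snd (snd x) = 1}) - K * g 1 / (g 0 * w c)\<bar> \<le> real d"
proof -
  have split: "{x \<in> joint K L. cls x = c \<and> snd (snd x) = 1}
      = (\<Union>i<d. {x \<in> joint K L. cls x = c \<and> fst x = i \<and> snd (snd x) = 1})"
    by (auto simp: joint_def)
  have "card {x \<in> joint K L. cls x = c \<and> snd (snd x) = 1}
      = (\<Sum>i<d. card {x \<in> joint K L. cls x = c \<and> fst x = i \<and> snd (snd x) = 1})"
    unfolding split by (rule card_UN_disjoint) auto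
  then have eq: "real (card {x \<in> joint K L. cls x = c \<and> snd (snd x) = 1})
      = (\<Sum>i<d. real (card {x \<in> joint K L. cls x = c \<and> fst x = i \<and> snd (snd x) = 1}))"
    by simp
  have "K * g 1 / (g 0 * w c) = (\<Sum>i<d. K * \<gamma> i * g 1 / (g 0 * w c))"
    using \<gamma>_sum by (simp add: sum_divide_distrib[symmetric] sum_distrib_right[symmetric]
        sum_distrib_left[symmetric])
  moreover define f where "f i = real (card {x \<in> joint K L. cls x = c \<and> fst x = i \<and> snd (snd x) = 1})
      - K * \<gamma> i * g 1 / (g 0 * w c)" for i
  ultimately have diff: "real (card {x \<in> joint K L. cls x = c \<and> snd (snd x) = 1}) - K * g 1 / (g 0 * w c)
      = sum f {..<d}"
    unfolding eq f_def by (simp only: sum_subtractf)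
  have f: "\<bar>f i\<bar> \<le> 1" if "i < d" for i
    using card_fiber_bounds[OF c that one_less_two K_pos] unfolding f_def by linarith
  have "\<bar>sum f {..<d}\<bar> \<le> (\<Sum>i<d. \<bar>f i\<bar>)" by (rule sum_abs)
  also have "\<dots> \<le> (\<Sum>i<d. 1)" by (rule sum_mono) (simp add: f)
  finally show ?thesis unfolding diff by simp
qed

lemma prob_class:
  assumes c: "c \<in> inner_box L"
  shows "\<bar>(\<Sum>x | x \<in> joint K L \<and> cls x = c. prb K L x) - K / Z K L\<bar>
    \<le> g 0 * w c * (\<Sum>i<d. r i / \<gamma> i) * (4 * real d + 3) / Z K L"
proof -
  have "\<bar>real (card {x \<in> {x \<in> joint K L. cls x = c}. fst x = i}) - 1 * (K * \<gamma> i / (g 0 * w c))\<bar>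
      \<le> 4 * real d + 3" if "i < d" for i
    using card_class_approx[OF c that] by (simp add: conj_assoc)
  from sum_prb_class_approx[OF subset_refl this] show ?thesis by (simp add: r_sum)
qed

text \<open>By \<open>\<gamma>_m\<close> the ideal number of excited states,
  \<open>K * g 1 / \<alpha>\<close>, equals the sum of \<open>m i\<close> times the ideal fibre
  sizes. A subset with nearly these fractions can therefore have exactly as many elements as there
  are excited states.\<close>

lemma ex_class_subset:
  assumes c: "c \<in> inner_box L"
  shows "\<exists>A \<subseteq> {x \<in> joint K L. cls x = c}.
    card A = card {x \<in> joint K L. cls x = c \<and> snd (snd x) = 1} \<and>
    \<bar>(\<Sum>x\<in>A. prb K L x) - K / Z K L * p\<bar>
      \<le> g 0 * w c * (\<Sum>i<d. r i / \<gamma> i) * (4 * real d + 3) / Z K L"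
proof -
  define X where "X = {x \<in> joint K L. cls x = c}"
  define N where "N = card {x \<in> joint K L. cls x = c \<and> snd (snd x) = 1}"
  define \<alpha> where "\<alpha> = g 0 * w c"
  define F where "F i = real (card {x \<in> X. fst x = i})" for i
  have F: "\<bar>F i - K * \<gamma> i / \<alpha>\<bar> \<le> 2" if "i < d" for i
    using card_class_approx[OF c that] by (simp add: F_def X_def \<alpha>_def conj_assoc)
  have mF: "\<bar>m i * F i - m i * (K * \<gamma> i / \<alpha>)\<bar> \<le> 2" if "i < d" for i
  proof -
    have "\<bar>m i * (F i - K * \<gamma> i / \<alpha>)\<bar> \<le> 1 * 2"
      unfolding abs_mult using F[OF that] m_nonneg[OF that] m_le_1[OF that]
      by (intro mult_mono) auto
    then show ?thesis by (simp add: right_diff_distrib)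
  qed
  have "(\<Sum>i<d. m i * (K * \<gamma> i / \<alpha>)) = K * (\<Sum>i<d. \<gamma> i * m i) / \<alpha>"
    by (simp add: sum_divide_distrib sum_distrib_left mult_ac)
  then have "(\<Sum>i<d. m i * F i) - K * g 1 / \<alpha> = (\<Sum>i<d. m i * F i - m i * (K * \<gamma> i / \<alpha>))"
    by (simp add: sum_subtractf \<gamma>_m)
  also have "\<bar>\<dots>\<bar> \<le> (\<Sum>i<d. \<bar>m i * F i - m i * (K * \<gamma> i / \<alpha>)\<bar>)" by (rule sum_abs)
  also have "\<dots> \<le> (\<Sum>i<d. 2)" using mF by (intro sum_mono) auto
  \<comment> \<open>Each of the \<open>d\<close> weighted fibre counts contributes an error of at
    most 2, and the excited count contributes \<open>d\<close> in total.\<close>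
  finally have gap: "\<bar>real N - (\<Sum>i<d. m i * F i)\<bar> \<le> 3 * real d"
    using card_excited_approx[OF c] unfolding N_def \<alpha>_def by simp
  have "N \<le> card X" unfolding N_def X_def by (intro card_mono) auto
  moreover have "finite X" "fst ` X \<subseteq> {..<d}" by (auto simp: X_def joint_def)
  ultimately have "\<exists>A\<subseteq>X. card A = N \<and>
    (\<forall>i\<in>{..<d}. \<bar>real (card {x \<in> A. fst x = i}) - m i * F i\<bar>
       \<le> 1 + real (card {..<d}) + \<bar>real N - (\<Sum>i<d. m i * F i)\<bar>)"
    unfolding F_def using m_nonneg m_le_1 by (intro ex_subset_fractional_fibers) auto
  then obtain A where A: "A \<subseteq> X" "card A = N"
    "\<forall>i\<in>{..<d}. \<bar>real (card {x \<in> A. fst x = i}) - m i * F i\<bar>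
       \<le> 1 + real (card {..<d}) + \<bar>real N - (\<Sum>i<d. m i * F i)\<bar>"
    by blast
  \<comment> \<open>The choice of the subset costs \<open>1 + d\<close> plus the gap
    \<open>3 * d\<close>; replacing \<open>F i\<close> by its ideal value costs 2 more.\<close>
  have "\<bar>real (card {x \<in> A. fst x = i}) - m i * (K * \<gamma> i / (g 0 * w c))\<bar> \<le> 4 * real d + 3"
    if "i < d" for i
  proof -
    have "\<bar>real (card {x \<in> A. fst x = i}) - m i * F i\<bar> \<le> 1 + real d + 3 * real d"
      using bspec[OF A(3), of i] that gap by simp
    then show ?thesis using mF[OF that] unfolding \<alpha>_def by linarith
  qed
  from sum_prb_class_approx[OF A(1)[unfolded X_def] this]
  show ?thesis using A(1,2) unfolding X_def N_def p_def by (intro exI[of _ A] conjI) simp_all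
qed

end

section \<open>The class-preserving permutation\<close>

context sized_bath
begin

lemma prb_nonneg: "x \<in> joint K L \<Longrightarrow> 0 \<le> prb K L x"
proof -
  assume "x \<in> joint K L"
  then obtain i n s j where x: "x = (i, (n, s), j)" "i < d" "j < 2" by (auto simp: joint_def)
  have "0 < g j" using g_pos x(3) by (auto simp: less_2_cases_iff)
  then show ?thesis using r_nonneg[OF x(2)] w_pos[of n] Z_pos by (simp add: prb_def x(1))
qed

lemma sum_bath: "(\<Sum>b\<in>bath K L. w (fst b) / Z K L) = 1"
proof -
  have "(\<Sum>b\<in>bath K L. w (fst b) / Z K L) = (\<Sum>n\<in>box L. \<Sum>s<mult K n. w n / Z K L)"
    unfolding bath_def by (subst sum.Sigma) (auto simp: case_prod_unfold)
  also have "\<dots> = Z K L / Z K L" by (simp add: Z_def[symmetric] sum_divide_distrib[symmetric])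
  finally show ?thesis using Z_pos by simp
qed

lemma sum_prb: "(\<Sum>x\<in>joint K L. prb K L x) = 1"
proof -
  have "(\<Sum>x\<in>joint K L. prb K L x)
      = (\<Sum>i<d. \<Sum>y\<in>bath K L \<times> {..<2}. r i * (w (fst (fst y)) / Z K L * g (snd y)))"
    unfolding joint_def prb_def
    by (subst sum.cartesian_product) (auto intro!: sum.cong)
  also have "\<dots> = (\<Sum>y\<in>bath K L \<times> {..<2}. w (fst (fst y)) / Z K L * g (snd y))"
    by (simp only: sum_distrib_left[symmetric] sum_distrib_right[symmetric] r_sum mult_1_left)
  also have "\<dots> = (\<Sum>b\<in>bath K L. \<Sum>j<2. w (fst b) / Z K L * g j)"
    by (subst sum.cartesian_product) (auto intro!: sum.cong)
  also have "\<dots> = (\<Sum>b\<in>bath K L. w (fst b) / Z K L * (g 0 + g 1))"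
    by (simp add: lessThan_nat_numeral numeral_eq_Suc distrib_left)
  finally show ?thesis using g_sum sum_bath by (simp only: mult_1_right)
qed

lemma p_bounds: "0 \<le> p" "p \<le> 1"
proof -
  show "0 \<le> p" unfolding p_def using r_nonneg m_nonneg by (auto intro!: sum_nonneg)
  have "p \<le> (\<Sum>i<d. r i)"
    unfolding p_def using r_nonneg m_le_1 by (intro sum_mono) (simp add: mult_left_le)
  then show "p \<le> 1" using r_sum by simp
qed

text \<open>Class by class, the selected states are moved onto the excited ones. Interior classes
  yield the probability \<open>p\<close> up to counting errors; the mass outside them is bounded by
  comparing the interior mass with 1.\<close>

lemma ex_cooling_permutation:
  "\<exists>\<pi>. bij_betw \<pi> (joint K L) (joint K L) \<and> (\<forall>x\<in>joint K L. cls (\<pi> x) = cls x) \<and>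
    \<bar>(\<Sum>x | x \<in> joint K L \<and> snd (snd (\<pi> x)) = 1. prb K L x) - p\<bar>
      \<le> 2 * \<bar>1 - real (card (inner_box L)) * K / Z K L\<bar> + 2 * (err L / Z K L)"
proof -
  define J where "J = joint K L"
  define I where "I = inner_box L"
  define T where "T = {x \<in> J. snd (snd x) = 1}"
  define \<delta> where "\<delta> c = g 0 * w c * (\<Sum>i<d. r i / \<gamma> i) * (4 * real d + 3) / Z K L" for c
  have finJ: "finite J" and finI: "finite I" by (simp_all add: J_def I_def)
  have "\<forall>c\<in>I. \<exists>A. A \<subseteq> {x \<in> J. cls x = c} \<and> card A = card {x \<in> T. cls x = c}
      \<and> \<bar>(\<Sum>x\<in>A. prb K L x) - K / Z K L * p\<bar> \<le> \<delta> c"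
  proof
    fix c assume "c \<in> I"
    have "{x \<in> T. cls x = c} = {x \<in> joint K L. cls x = c \<and> snd (snd x) = 1}"
      by (auto simp: T_def J_def)
    then show "\<exists>A. A \<subseteq> {x \<in> J. cls x = c} \<and> card A = card {x \<in> T. cls x = c}
      \<and> \<bar>(\<Sum>x\<in>A. prb K L x) - K / Z K L * p\<bar> \<le> \<delta> c"
      using ex_class_subset[of c] \<open>c \<in> I\<close> unfolding I_def J_def \<delta>_def by auto
  qed
  from bchoice[OF this] obtain A where "\<forall>c\<in>I. A c \<subseteq> {x \<in> J. cls x = c}
      \<and> card (A c) = card {x \<in> T. cls x = c} \<and> \<bar>(\<Sum>x\<in>A c. prb K L x) - K / Z K L * p\<bar> \<le> \<delta> c" ..
  then have A: "\<And>c. c \<in> I \<Longrightarrow> A c \<subseteq> {x \<in> J. cls x = c}"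
    "\<And>c. c \<in> I \<Longrightarrow> card (A c) = card {x \<in> T. cls x = c}"
    "\<And>c. c \<in> I \<Longrightarrow> \<bar>(\<Sum>x\<in>A c. prb K L x) - K / Z K L * p\<bar> \<le> \<delta> c"
    by blast+
  \<comment> \<open>Boundary classes keep their excited states, so \<open>S\<close> and
    \<open>T\<close> have equally many members in every class, not only in the interior
    ones.\<close>
  define S where "S = {x \<in> J. if cls x \<in> I then x \<in> A (cls x) else x \<in> T}"
  have SJ: "S \<subseteq> J" "T \<subseteq> J" by (auto simp: S_def T_def)
  then have finS: "finite S" "finite T" using finJ by (auto intro: finite_subset)
  have S_cls: "{x \<in> S. cls x = c} = A c" if "c \<in> I" for c
    using A(1)[OF that] that by (auto simp: S_def)
  have card_cls: "card {x \<in> S. cls x = c} = card {x \<in> T. cls x = c}" for c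
  proof (cases "c \<in> I")
    case True
    then show ?thesis using S_cls A(2) by simp
  next
    case False
    then have "{x \<in> S. cls x = c} = {x \<in> T. cls x = c}" using SJ by (auto simp: S_def)
    then show ?thesis by simp
  qed
  \<comment> \<open>Counting for the pair of class and membership gives a permutation that preserves
    classes and carries \<open>S\<close> onto \<open>T\<close>.\<close>
  have "card {x \<in> J. (cls x, x \<in> S) = k} = card {x \<in> J. (cls x, x \<in> T) = k}" for k
  proof (cases k)
    case (Pair c b)
    have split: "card {x \<in> J. cls x = c \<and> x \<notin> U} = card {x \<in> J. cls x = c} - card {x \<in> U. cls x = c}"
      if "U \<subseteq> J" for U
    proof -
      have "{x \<in> J. cls x = c \<and> x \<notin> U} = {x \<in> J. cls x = c} - {x \<in> U. cls x = c}" by auto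
      then show ?thesis using that finJ
        by (simp add: card_Diff_subset finite_subset Collect_mono_iff subset_iff)
    qed
    have pos: "{x \<in> J. cls x = c \<and> x \<in> U} = {x \<in> U. cls x = c}" if "U \<subseteq> J" for U
      using that by auto
    show ?thesis
      using split[OF SJ(1)] split[OF SJ(2)] card_cls[of c] pos[OF SJ(1)] pos[OF SJ(2)]
      by (cases b) (simp_all add: Pair)
  qed
  from ex_bij_betw_fibers[OF finJ finJ this] obtain \<pi> where \<pi>: "bij_betw \<pi> J J"
    "\<And>x. x \<in> J \<Longrightarrow> cls (\<pi> x) = cls x" "\<And>x. x \<in> J \<Longrightarrow> \<pi> x \<in> T \<longleftrightarrow> x \<in> S" by auto
  have "snd (snd (\<pi> x)) = 1 \<longleftrightarrow> x \<in> S" if "x \<in> J" for x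
    using \<pi>(3)[OF that] bij_betwE[OF \<pi>(1)] that by (auto simp: T_def)
  then have S_eq: "{x. x \<in> J \<and> snd (snd (\<pi> x)) = 1} = S" using SJ by auto
  define SI where "SI = {x \<in> S. cls x \<in> I}"
  define JI where "JI = {x \<in> J. cls x \<in> I}"
  have SI: "\<bar>sum (prb K L) SI - real (card I) * K / Z K L * p\<bar> \<le> sum \<delta> I"
  proof -
    have "sum (prb K L) SI = (\<Sum>c\<in>I. \<Sum>x | x \<in> SI \<and> cls x = c. prb K L x)"
      using finS finI by (intro sum.group[symmetric]) (auto simp: SI_def)
    also have "\<dots> = (\<Sum>c\<in>I. sum (prb K L) (A c))"
    proof (rule sum.cong[OF refl])
      fix c assume c: "c \<in> I"
      then have "{x. x \<in> SI \<and> cls x = c} = {x \<in> S. cls x = c}" by (auto simp: SI_def)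
      with S_cls[OF c] show "(\<Sum>x | x \<in> SI \<and> cls x = c. prb K L x) = sum (prb K L) (A c)" by simp
    qed
    finally have SI_sum: "sum (prb K L) SI = (\<Sum>c\<in>I. sum (prb K L) (A c))" .
    have "(\<Sum>c\<in>I. sum (prb K L) (A c) - K / Z K L * p)
        = sum (prb K L) SI - real (card I) * K / Z K L * p"
      unfolding sum_subtractf SI_sum by simp
    moreover have "\<bar>\<Sum>c\<in>I. sum (prb K L) (A c) - K / Z K L * p\<bar> \<le> sum \<delta> I"
      using A(3) by (intro order_trans[OF sum_abs] sum_mono)
    ultimately show ?thesis by (simp only:)
  qed
  have JI: "\<bar>sum (prb K L) JI - real (card I) * K / Z K L\<bar> \<le> sum \<delta> I"
  proof -
    have "sum (prb K L) JI = (\<Sum>c\<in>I. \<Sum>x | x \<in> JI \<and> cls x = c. prb K L x)"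
      using finJ finI by (intro sum.group[symmetric]) (auto simp: JI_def)
    also have "\<dots> = (\<Sum>c\<in>I. \<Sum>x | x \<in> J \<and> cls x = c. prb K L x)"
      by (intro sum.cong refl) (auto simp: JI_def)
    finally have JI_sum: "sum (prb K L) JI = (\<Sum>c\<in>I. \<Sum>x | x \<in> J \<and> cls x = c. prb K L x)" .
    have "(\<Sum>c\<in>I. (\<Sum>x | x \<in> J \<and> cls x = c. prb K L x) - K / Z K L)
        = sum (prb K L) JI - real (card I) * K / Z K L"
      unfolding sum_subtractf JI_sum by simp
    moreover have "\<bar>\<Sum>c\<in>I. (\<Sum>x | x \<in> J \<and> cls x = c. prb K L x) - K / Z K L\<bar> \<le> sum \<delta> I"
      unfolding I_def J_def \<delta>_def by (intro order_trans[OF sum_abs] sum_mono prob_class)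
    ultimately show ?thesis by (simp only:)
  qed
  \<comment> \<open>The selected states outside the interior carry at most the total mass outside
    it.\<close>
  have "S - SI \<subseteq> J - JI" "SI \<subseteq> S" "JI \<subseteq> J" using SJ by (auto simp: SI_def JI_def)
  then have "sum (prb K L) (S - SI) \<le> sum (prb K L) (J - JI)" "0 \<le> sum (prb K L) (S - SI)"
    using prb_nonneg finJ SJ unfolding J_def by (auto intro!: sum_mono2 sum_nonneg)
  then have sandwich: "sum (prb K L) SI \<le> sum (prb K L) S"
      "sum (prb K L) S \<le> sum (prb K L) SI + (1 - sum (prb K L) JI)"
    using \<open>SI \<subseteq> S\<close> \<open>JI \<subseteq> J\<close> finS finJ sum_prb by (simp_all add: sum_diff J_def)
  define t where "t = real (card I) * K / Z K L"
  have "\<bar>t * p - p\<bar> = \<bar>1 - t\<bar> * \<bar>p\<bar>"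
    unfolding abs_mult[symmetric] left_diff_distrib by (simp add: abs_minus_commute)
  also have "\<dots> \<le> \<bar>1 - t\<bar>"
    using p_bounds by (simp add: mult_left_le)
  \<comment> \<open>The deviation of \<open>t\<close> from 1 enters twice, once from replacing
    \<open>t * p\<close> by \<open>p\<close> and once through the boundary mass. The approximations
    of the masses of \<open>SI\<close> and \<open>JI\<close> each add one
    \<open>sum \<delta> I\<close>.\<close>
  finally have "\<bar>sum (prb K L) S - p\<bar> \<le> 2 * \<bar>1 - t\<bar> + 2 * sum \<delta> I"
    using SI JI sandwich abs_ge_self[of "1 - t"] abs_ge_zero[of "1 - t"] unfolding t_def[symmetric]
    by (simp only: abs_le_iff, elim conjE, intro conjI) linarith+
  moreover have "sum \<delta> I = err L / Z K L"
    by (simp add: \<delta>_def err_def I_def sum_divide_distrib)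
  ultimately show ?thesis
    using \<pi>(1,2) S_eq unfolding J_def[symmetric] I_def[symmetric] t_def
    by (intro exI[of _ \<pi>] conjI ballI) simp_all
qed

end

section \<open>Large multiplicities and large boxes\<close>

context lattice_bath
begin

text \<open>Rounding down loses less than one copy, i.e. weight at most \<open>w n\<close>, at each
  level.\<close>

lemma Z_bounds:
  assumes "0 < K"
  shows "K * real (card (box L)) - (\<Sum>n\<in>box L. w n) \<le> Z K L" "Z K L \<le> K * real (card (box L))"
proof -
  have *: "K - w n \<le> real (mult K n) * w n" "real (mult K n) * w n \<le> K" for n
  proof -
    have "0 \<le> K / w n" using assms w_pos[of n] by simp
    then have "K / w n - 1 \<le> real (mult K n)" "real (mult K n) \<le> K / w n"
      unfolding mult_def by linarith+
    then show "K - w n \<le> real (mult K n) * w n" "real (mult K n) * w n \<le> K"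
      using w_pos[of n] by (simp_all add: field_simps)
  qed
  have "(\<Sum>n\<in>box L. K - w n) \<le> Z K L" "Z K L \<le> (\<Sum>n\<in>box L. K)"
    unfolding Z_def by (intro sum_mono *)+
  then show "K * real (card (box L)) - (\<Sum>n\<in>box L. w n) \<le> Z K L" "Z K L \<le> K * real (card (box L))"
    by (simp_all add: sum_subtractf mult.commute)
qed

lemma Z_asymp: "((\<lambda>K. Z K L / K) \<longlongrightarrow> real (card (box L))) at_top"
proof (rule tendsto_sandwich)
  show "\<forall>\<^sub>F K in at_top. real (card (box L)) - (\<Sum>n\<in>box L. w n) / K \<le> Z K L / K"
    using eventually_gt_at_top[of 0]
  proof eventually_elim
    case (elim K)
    then have "(K * real (card (box L)) - (\<Sum>n\<in>box L. w n)) / K \<le> Z K L / K"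
      using Z_bounds(1)[of K L] by (intro divide_right_mono) auto
    then show ?case using elim by (simp add: diff_divide_distrib)
  qed
  show "\<forall>\<^sub>F K in at_top. Z K L / K \<le> real (card (box L))"
    using eventually_gt_at_top[of 0]
  proof eventually_elim
    case (elim K)
    then show ?case using Z_bounds(2)[of K L] by (simp add: field_simps)
  qed
  have "((\<lambda>K. (\<Sum>n\<in>box L. w n) / K) \<longlongrightarrow> 0) at_top"
    by (intro tendsto_divide_0[OF tendsto_const] filterlim_at_top_imp_at_infinity filterlim_ident)
  from tendsto_diff[OF tendsto_const this]
  show "((\<lambda>K. real (card (box L)) - (\<Sum>n\<in>box L. w n) / K) \<longlongrightarrow> real (card (box L))) at_top"
    by simp
qed simp

text \<open>The order of the limits matters: \<open>L\<close> is fixed first, so that the interior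
  fills most of the box, and \<open>K\<close> then grows, which removes both the rounding in
  \<open>Z K L\<close> and the term \<open>err L / Z K L\<close>.\<close>

lemma ex_small_error:
  assumes "0 < \<epsilon>"
  shows "\<exists>K L. 0 < K \<and> 0 < Z K L \<and>
    2 * \<bar>1 - real (card (inner_box L)) * K / Z K L\<bar> + 2 * (err L / Z K L) < \<epsilon>"
proof -
  have lim: "(\<lambda>L. 1 - 1 / real (Suc L)) \<longlonglongrightarrow> 1 - 0"
    by (intro tendsto_diff tendsto_const LIMSEQ_Suc[OF lim_1_over_n])
  have "(\<lambda>L. 2 * \<bar>1 - (1 - 1 / real (Suc L)) ^ Suc d\<bar>) \<longlonglongrightarrow> 2 * \<bar>1 - (1 - 0) ^ Suc d\<bar>"
    by (intro tendsto_mult tendsto_const tendsto_rabs tendsto_diff[OF tendsto_const] tendsto_power lim)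
  then have "\<forall>\<^sub>F L in sequentially. 2 * \<bar>1 - (1 - 1 / real (Suc L)) ^ Suc d\<bar> < \<epsilon>"
    using assms by (intro order_tendstoD(2)) auto
  then obtain L' where L': "2 * \<bar>1 - (1 - 1 / real (Suc L')) ^ Suc d\<bar> < \<epsilon>"
    by (auto dest: eventually_happens)
  \<comment> \<open>Writing \<open>L\<close> as a successor turns the proportion of interior labels
    into \<open>(1 - 1 / L) ^ Suc d\<close>.\<close>
  define L where "L = Suc L'"
  define b where "b = real (card (box L))"
  have b: "0 < b"
    unfolding b_def card_box L_def by (subst of_nat_0_less_iff) (rule zero_less_power, simp)
  have "real (card (inner_box L)) / b = (real L' / real (Suc L')) ^ Suc d"
    by (simp only: b_def card_box L_def of_nat_power power_divide diff_Suc_1)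
  also have "real L' / real (Suc L') = 1 - 1 / real (Suc L')" by (simp add: field_simps)
  finally have ratio: "2 * \<bar>1 - real (card (inner_box L)) / b\<bar> + 2 * 0 < \<epsilon>" using L' by simp
  have "((\<lambda>K. err L / K) \<longlongrightarrow> 0) at_top"
    by (intro tendsto_divide_0[OF tendsto_const] filterlim_at_top_imp_at_infinity filterlim_ident)
  then have "((\<lambda>K. err L / K / (Z K L / K)) \<longlongrightarrow> 0 / b) at_top"
    using Z_asymp b unfolding b_def by (intro tendsto_divide) auto
  then have "((\<lambda>K. 2 * \<bar>1 - real (card (inner_box L)) / (Z K L / K)\<bar> + 2 * (err L / K / (Z K L / K)))
      \<longlongrightarrow> 2 * \<bar>1 - real (card (inner_box L)) / b\<bar> + 2 * 0) at_top"
    using Z_asymp[of L] b unfolding b_def[symmetric] by (intro tendsto_intros) auto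
  then have "\<forall>\<^sub>F K in at_top.
      2 * \<bar>1 - real (card (inner_box L)) / (Z K L / K)\<bar> + 2 * (err L / K / (Z K L / K)) < \<epsilon>"
    using ratio by (rule order_tendstoD(2))
  moreover have "\<forall>\<^sub>F K in at_top. 0 < Z K L / K"
    using Z_asymp[of L] b unfolding b_def[symmetric] by (rule order_tendstoD(1))
  ultimately have "\<forall>\<^sub>F K in at_top. 0 < K \<and> 0 < Z K L \<and>
      2 * \<bar>1 - real (card (inner_box L)) * K / Z K L\<bar> + 2 * (err L / Z K L) < \<epsilon>"
    using eventually_gt_at_top[of 0]
  proof eventually_elim
    case (elim K)
    then show ?case by (auto simp: zero_less_divide_iff)
  qed
  then show ?thesis using eventually_happens'[OF trivial_limit_at_top_linorder] by blast
qed

end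

section \<open>Encoding joint basis states as matrix indices\<close>

lemma mixed_radix_bij:
  "bij_betw (\<lambda>z. (z div 2 div e, z div 2 mod e, z mod 2)) {..<d * e * 2} ({..<d} \<times> {..<e} \<times> {..<2::nat})"
proof (rule bij_betw_byWitness[where f' = "\<lambda>(i, b, j). (i * e + b) * 2 + j"])
  show "(\<lambda>z. (z div 2 div e, z div 2 mod e, z mod 2)) ` {..<d * e * 2} \<subseteq> {..<d} \<times> {..<e} \<times> {..<2}"
  proof safe
    fix z assume z: "z < d * e * 2"
    then have "z div 2 < d * e" by (simp add: less_mult_imp_div_less)
    then show "z div 2 div e < d" "z div 2 mod e < e" "z mod 2 < 2"
      using z by (auto simp: less_mult_imp_div_less intro!: mod_less_divisor gr0I)
  qed
  show "(\<lambda>(i, b, j). (i * e + b) * 2 + j) ` ({..<d} \<times> {..<e} \<times> {..<2}) \<subseteq> {..<d * e * 2}"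
  proof safe
    fix i b j :: nat assume *: "i < d" "b < e" "j < 2"
    have "i * e + b < Suc i * e" using * by simp
    also have "\<dots> \<le> d * e" using * by (intro mult_le_mono1) simp
    finally show "(i * e + b) * 2 + j < d * e * 2" using * by simp
  qed
  show "\<forall>z\<in>{..<d * e * 2}.
      (\<lambda>(i, b, j). (i * e + b) * 2 + j) (z div 2 div e, z div 2 mod e, z mod 2) = z"
    by (simp only: prod.case div_mult_mod_eq) simp
  show "\<forall>x\<in>{..<d} \<times> {..<e} \<times> {..<2}. (\<lambda>z. (z div 2 div e, z div 2 mod e, z mod 2))
      ((\<lambda>(i, b, j). (i * e + b) * 2 + j) x) = x"
  proof (rule ballI)
    fix x assume "x \<in> {..<d} \<times> {..<e} \<times> {..<2::nat}"
    then obtain i b j where x: "x = (i, b, j)" and *: "i < d" "b < e" "j < 2" by auto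
    define y where "y = i * e + b"
    have "(y * 2 + j) div 2 = y" "(y * 2 + j) mod 2 = j" using * by auto
    moreover have "y div e = i" "y mod e = b" using * by (auto simp: y_def)
    ultimately show "(\<lambda>z. (z div 2 div e, z div 2 mod e, z mod 2))
        ((\<lambda>(i, b, j). (i * e + b) * 2 + j) x) = x"
      by (simp only: x prod.case y_def[symmetric])
  qed
qed

text \<open>Here \<open>z\<close> encodes the basis state \<open>(i, b, j)\<close> as \<open>(i * e + b) * 2 + j\<close>.\<close>

definition joint_weight :: "nat \<Rightarrow> (nat \<Rightarrow> real) \<Rightarrow> (nat \<Rightarrow> real) \<Rightarrow> (nat \<Rightarrow> real) \<Rightarrow> nat \<Rightarrow> real" where
  "joint_weight e a \<omega> g z = a (z div 2 div e) * \<omega> (z div 2 mod e) * g (z mod 2)"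

text \<open>The permutation of joint states is transported to indices along an enumeration of the
  bath. The clause about pairs \<open>z\<close>, \<open>z'\<close> is a coherence condition: states
  sharing bath state and target bit are never sent to states that agree on system and bath but
  differ in the target bit.\<close>

lemma (in lattice_bath) ex_bath_permutation:
  assumes "0 < \<epsilon>"
  shows "\<exists>e \<omega> \<sigma>. (\<forall>b<e. 0 < \<omega> b) \<and> (\<Sum>b<e. \<omega> b) = 1 \<and>
    bij_betw \<sigma> {..<d * e * 2} {..<d * e * 2} \<and>
    (\<forall>z<d * e * 2. joint_weight e \<gamma> \<omega> g (\<sigma> z) = joint_weight e \<gamma> \<omega> g z) \<and>
    (\<forall>z<d * e * 2. \<forall>z'<d * e * 2. z div 2 mod e = z' div 2 mod e \<longrightarrow> z mod 2 = z' mod 2 \<longrightarrow>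
      \<sigma> z div 2 = \<sigma> z' div 2 \<longrightarrow> \<sigma> z mod 2 = \<sigma> z' mod 2) \<and>
    \<bar>(\<Sum>z | z < d * e * 2 \<and> \<sigma> z mod 2 = 1. joint_weight e r \<omega> g z) - p\<bar> < \<epsilon>"
proof -
  obtain K L where KL: "0 < K" "0 < Z K L"
    and small: "2 * \<bar>1 - real (card (inner_box L)) * K / Z K L\<bar> + 2 * (err L / Z K L) < \<epsilon>"
    using ex_small_error[OF assms] by blast
  interpret sized_bath d \<gamma> r m g K L by unfold_locales (fact KL)+
  obtain \<pi> where \<pi>: "bij_betw \<pi> (joint K L) (joint K L)"
      "\<And>x. x \<in> joint K L \<Longrightarrow> cls (\<pi> x) = cls x"
      "\<bar>(\<Sum>x | x \<in> joint K L \<and> snd (snd (\<pi> x)) = 1. prb K L x) - p\<bar> < \<epsilon>"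
    using ex_cooling_permutation small by force
  define e where "e = card (bath K L)"
  obtain h where h: "bij_betw h {..<e} (bath K L)"
    using ex_bij_betw_nat_finite[of "bath K L"] by (auto simp: e_def atLeast0LessThan)
  define \<omega> where "\<omega> b = w (fst (h b)) / Z K L" for b
  define N where "N = d * e * 2"
  define \<psi> where "\<psi> z = (z div 2 div e, h (z div 2 mod e), z mod 2)" for z :: nat
  have "bij_betw (map_prod id (map_prod h id)) ({..<d} \<times> {..<e} \<times> {..<2::nat}) (joint K L)"
    unfolding joint_def by (intro bij_betw_map_prod h bij_betw_id)
  from bij_betw_trans[OF mixed_radix_bij this]
  have \<psi>: "bij_betw \<psi> {..<N} (joint K L)"
    by (simp add: N_def \<psi>_def[abs_def] comp_def)
  define \<sigma> where "\<sigma> = the_inv_into {..<N} \<psi> \<circ> (\<pi> \<circ> \<psi>)"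
  have \<sigma>: "bij_betw \<sigma> {..<N} {..<N}"
    unfolding \<sigma>_def by (intro bij_betw_trans[OF bij_betw_trans[OF \<psi> \<pi>(1)] bij_betw_the_inv_into[OF \<psi>]])
  have \<psi>\<sigma>: "\<psi> (\<sigma> z) = \<pi> (\<psi> z)" if "z < N" for z
    using f_the_inv_into_f_bij_betw[OF \<psi>, of "\<pi> (\<psi> z)"] bij_betwE[OF \<psi>] bij_betwE[OF \<pi>(1)] that
    by (auto simp: \<sigma>_def)
  have mem: "\<psi> z \<in> joint K L" if "z < N" for z using bij_betwE[OF \<psi>] that by auto
  have cls_weight: "joint_weight e \<gamma> \<omega> g z = g 0 * w (cls (\<psi> z)) / Z K L" if "z < N" for z
  proof -
    have *: "z div 2 div e < d" using mem[OF that] by (simp add: \<psi>_def joint_def)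
    show ?thesis
      using w_cls[OF *, of "z mod 2" "fst (h (z div 2 mod e))" "snd (h (z div 2 mod e))"]
      by (simp add: joint_weight_def \<omega>_def \<psi>_def)
  qed
  have cls\<sigma>: "cls (\<psi> (\<sigma> z)) = cls (\<psi> z)" if "z < N" for z
    using \<psi>\<sigma>[OF that] \<pi>(2)[OF mem[OF that]] by simp
  have \<sigma>N: "\<sigma> z < N" if "z < N" for z using bij_betwE[OF \<sigma>] that by auto
  have cls_d: "cls (\<psi> z) d = fst (h (z div 2 mod e)) d + z mod 2" if "z < N" for z
    using mem[OF that] by (cases "h (z div 2 mod e)") (auto simp: \<psi>_def cls_def joint_def)
  \<comment> \<open>Coordinate \<open>d\<close> of the class is coordinate \<open>d\<close> of the
    bath label plus the target bit, and it is preserved. Equal bath states and bits before, together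
    with equal bath states after, force equal bits after.\<close>
  have coh: "\<sigma> z mod 2 = \<sigma> z' mod 2"
    if "z < N" "z' < N" "z div 2 mod e = z' div 2 mod e" "z mod 2 = z' mod 2" "\<sigma> z div 2 = \<sigma> z' div 2"
    for z z'
    using cls_d[OF \<sigma>N[OF that(1)]] cls_d[OF \<sigma>N[OF that(2)]] cls_d[OF that(1)] cls_d[OF that(2)]
      cls\<sigma>[OF that(1)] cls\<sigma>[OF that(2)] that(3-5) by simp
  have "(\<Sum>z | z < N \<and> \<sigma> z mod 2 = 1. joint_weight e r \<omega> g z)
      = (\<Sum>z | z < N \<and> \<sigma> z mod 2 = 1. prb K L (\<psi> z))"
  proof (rule sum.cong[OF refl])
    fix z
    show "joint_weight e r \<omega> g z = prb K L (\<psi> z)"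
      by (cases "h (z div 2 mod e)") (simp add: joint_weight_def \<omega>_def \<psi>_def prb_def)
  qed
  also have "\<dots> = (\<Sum>x | x \<in> joint K L \<and> snd (snd (\<pi> x)) = 1. prb K L x)"
  proof (rule sum.reindex_bij_betw)
    have 1: "snd (snd (\<pi> (\<psi> z))) = \<sigma> z mod 2" if "z < N" for z
      using \<psi>\<sigma>[OF that, symmetric] by (simp add: \<psi>_def)
    show "bij_betw \<psi> {z. z < N \<and> \<sigma> z mod 2 = 1} {x. x \<in> joint K L \<and> snd (snd (\<pi> x)) = 1}"
    proof (rule bij_betw_subset[OF \<psi>])
      show "\<psi> ` {z. z < N \<and> \<sigma> z mod 2 = 1} = {x. x \<in> joint K L \<and> snd (snd (\<pi> x)) = 1}"
        using 1 mem bij_betw_imp_surj_on[OF \<psi>] by (auto simp: image_iff Bex_def) (metis lessThan_iff imageE)+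
    qed auto
  qed
  finally have sum: "\<bar>(\<Sum>z | z < N \<and> \<sigma> z mod 2 = 1. joint_weight e r \<omega> g z) - p\<bar> < \<epsilon>"
    using \<pi>(3) by simp
  have \<omega>_sum: "(\<Sum>b<e. \<omega> b) = 1"
    using sum.reindex_bij_betw[OF h, of "\<lambda>b. w (fst b) / Z K L"] sum_bath by (simp add: \<omega>_def)
  have \<omega>_pos: "0 < \<omega> b" for b using w_pos Z_pos by (simp add: \<omega>_def)
  have weight: "joint_weight e \<gamma> \<omega> g (\<sigma> z) = joint_weight e \<gamma> \<omega> g z" if "z < N" for z
    using cls_weight[OF that] cls_weight[OF \<sigma>N[OF that]] cls\<sigma>[OF that] by simp
  show ?thesis
  proof (intro exI[of _ e] exI[of _ \<omega>] exI[of _ \<sigma>] conjI allI impI)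
    fix z z' assume "z < d * e * 2" "z' < d * e * 2" "z div 2 mod e = z' div 2 mod e"
      "z mod 2 = z' mod 2" "\<sigma> z div 2 = \<sigma> z' div 2"
    then show "\<sigma> z mod 2 = \<sigma> z' mod 2" unfolding N_def[symmetric] by (rule coh)
  next
    fix z assume "z < d * e * 2"
    then show "joint_weight e \<gamma> \<omega> g (\<sigma> z) = joint_weight e \<gamma> \<omega> g z"
      unfolding N_def[symmetric] by (rule weight)
  qed (use \<omega>_pos \<omega>_sum \<sigma> sum in \<open>simp_all only: N_def\<close>)
qed

subsection \<open>Unitary diagonalisation\<close>

lemma mult_index:
  assumes "A \<in> carrier_mat n m" "B \<in> carrier_mat m l" "i < n" "j < l"
  shows "(A * B) $$ (i, j) = (\<Sum>k<m. A $$ (i, k) * B $$ (k, j))"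
  using assms by (simp add: scalar_prod_def atLeast0LessThan)

lemma adjoint_dim [simp]: "dim_row (mat_adjoint A) = dim_col A" "dim_col (mat_adjoint A) = dim_row A"
  by (simp_all add: mat_adjoint_def)

lemma adjoint_carrier [simp]: "A \<in> carrier_mat n m \<Longrightarrow> mat_adjoint A \<in> carrier_mat m n"
  by (rule carrier_matI) auto

lemma adjoint_index [simp]:
  fixes A :: "complex mat"
  shows "i < dim_col A \<Longrightarrow> j < dim_row A \<Longrightarrow> mat_adjoint A $$ (i, j) = cnj (A $$ (j, i))"
  by (simp add: mat_adjoint_def mat_of_rows_def)

lemma adjoint_mult:
  fixes A B :: "complex mat"
  assumes "A \<in> carrier_mat n m" "B \<in> carrier_mat m l"
  shows "mat_adjoint (A * B) = mat_adjoint B * mat_adjoint A"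
proof (rule eq_matI)
  fix i j assume "i < dim_row (mat_adjoint B * mat_adjoint A)" "j < dim_col (mat_adjoint B * mat_adjoint A)"
  then have "i < l" "j < n" using assms by auto
  then show "mat_adjoint (A * B) $$ (i, j) = (mat_adjoint B * mat_adjoint A) $$ (i, j)"
    using assms
    by (simp add: mult_index[of _ n m _ l] mult_index[of _ l m _ n] mult.commute del: index_mult_mat(1))
qed (use assms in auto)

lemma adjoint_adjoint [simp]: "mat_adjoint (mat_adjoint A) = (A :: complex mat)"
  by (rule eq_matI) auto

lemma adjoint_one [simp]: "mat_adjoint (1\<^sub>m n) = (1\<^sub>m n :: complex mat)"
  by (rule eq_matI) auto

lemma adjoint_diag [simp]: "mat_adjoint (mat_diag n f) = mat_diag n (\<lambda>i. cnj (f i))"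
  by (rule eq_matI) (auto simp: mat_diag_def)

text \<open>For square matrices a one-sided inverse is two-sided, so checking one product
  suffices.\<close>

lemma unitary_operatorI:
  assumes "U \<in> carrier_mat n n" "U * mat_adjoint U = 1\<^sub>m n"
  shows "unitary_operator n U"
  using assms mat_mult_left_right_inverse[of U n "mat_adjoint U"] by (simp add: unitary_operator_def)

lemma unitary_operatorI':
  assumes "U \<in> carrier_mat n n" "mat_adjoint U * U = 1\<^sub>m n"
  shows "unitary_operator n U"
  using assms mat_mult_left_right_inverse[of "mat_adjoint U" n U] by (simp add: unitary_operator_def)

lemma unitary_carrier [simp]: "unitary_operator n U \<Longrightarrow> U \<in> carrier_mat n n"
  by (simp add: unitary_operator_def)

lemma unitary_simps:
  assumes "unitary_operator n U"
  shows "U * mat_adjoint U = 1\<^sub>m n" "mat_adjoint U * U = 1\<^sub>m n"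
  using assms by (simp_all add: unitary_operator_def)

lemma unitary_cancel:
  assumes "unitary_operator n U" "A \<in> carrier_mat n m"
  shows "U * (mat_adjoint U * A) = A" "mat_adjoint U * (U * A) = A"
proof -
  have U: "U \<in> carrier_mat n n" "mat_adjoint U \<in> carrier_mat n n" using assms by auto
  show "U * (mat_adjoint U * A) = A" "mat_adjoint U * (U * A) = A"
    using assms U assoc_mult_mat[OF U assms(2)] assoc_mult_mat[OF U(2,1) assms(2)]
    by (auto simp: unitary_operator_def)
qed

lemma unitary_adjoint: "unitary_operator n U \<Longrightarrow> unitary_operator n (mat_adjoint U)"
  by (simp add: unitary_operator_def)

lemma unitary_mult:
  assumes "unitary_operator n U" "unitary_operator n V"
  shows "unitary_operator n (U * V)"
proof (rule unitary_operatorI)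
  have c: "U \<in> carrier_mat n n" "V \<in> carrier_mat n n" using assms by auto
  then show "U * V \<in> carrier_mat n n" by simp
  show "U * V * mat_adjoint (U * V) = 1\<^sub>m n"
    using c assms unitary_cancel(1)[OF assms(2), of "mat_adjoint U" n]
    by (simp add: adjoint_mult[of _ n n _ n] assoc_mult_mat[of _ n n _ n _ n] mult_carrier_mat[of _ n n])
      (simp add: unitary_operator_def)
qed

lemma diag_conj_index:
  assumes "U \<in> carrier_mat n n" "i < n" "j < n"
  shows "(U * mat_diag n f * mat_adjoint U) $$ (i, j) = (\<Sum>k<n. U $$ (i, k) * f k * cnj (U $$ (j, k)))"
proof -
  have "U * mat_diag n f \<in> carrier_mat n n" using assms by simp
  then show ?thesis
    using assms
    by (simp add: mult_index[of _ n n _ n] mat_diag_mult_right[of _ n n] del: index_mult_mat(1))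
qed

text \<open>The vector is completed to a basis and orthogonalised. Gram-Schmidt keeps the first
  vector, and normalising the columns rescales it, which accounts for the factor
  \<open>c\<close>.\<close>

lemma ex_unitary_first_column:
  fixes v :: "complex vec"
  assumes v: "v \<in> carrier_vec n" and v0: "v \<noteq> 0\<^sub>v n"
  shows "\<exists>W c. unitary_operator n W \<and> col W 0 = c \<cdot>\<^sub>v v"
proof -
  interpret cof_vec_space n "TYPE(complex)" .
  define b where "b = basis_completion v"
  define ws where "ws = gram_schmidt n b"
  note bc = basis_completion[OF v v0, folded b_def]
  have n: "0 < n" using v v0 by (cases n) auto
  then obtain vs where bv: "b = v # vs" using bc(6,7) by (cases b) auto
  have ws: "set ws \<subseteq> carrier_vec n" "corthogonal ws" "length ws = n"
    using gram_schmidt_result[OF bc(2) bc(4) bc(5) refl, folded ws_def] bc(6) by auto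
  have hd: "ws ! 0 = v"
    using gram_schmidt_hd[OF v, of vs, folded bv] ws(3) n by (metis hd_conv_nth list.size(3) not_less0 ws_def)
  have wsc: "ws ! i \<in> carrier_vec n" if "i < n" for i using ws that by auto
  define q where "q i = ws ! i \<bullet>c ws ! i" for i
  have q: "0 < q i" if "i < n" for i
    using corthogonalD[OF ws(2), of i i] ws(3) that conjugate_square_ge_0_vec[of "ws ! i"]
    by (auto simp: q_def less_le)
  \<comment> \<open>\<open>q i\<close> is a positive real number of complex type, so the normalising
    factor is computed from its real part.\<close>
  define s where "s i = complex_of_real (1 / sqrt (Re (q i)))" for i
  have s: "s i * cnj (s i) * q i = 1" if "i < n" for i
  proof -
    have "0 < Re (q i)" "q i = complex_of_real (Re (q i))"
      using q[OF that] by (auto simp: less_complex_def complex_eq_iff)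
    then obtain t where "0 < t" "q i = complex_of_real t" by blast
    then show ?thesis by (simp add: s_def flip: of_real_mult)
  qed
  define W where "W = mat n n (\<lambda>(i, j). s j * (ws ! j) $ i)"
  have W: "W \<in> carrier_mat n n" by (simp add: W_def)
  have "mat_adjoint W * W = 1\<^sub>m n"
  proof (rule eq_matI)
    fix i j assume "i < dim_row (1\<^sub>m n :: complex mat)" "j < dim_col (1\<^sub>m n :: complex mat)"
    then have ij: "i < n" "j < n" by auto
    have "(mat_adjoint W * W) $$ (i, j) = (\<Sum>k<n. cnj (s i) * cnj ((ws ! i) $ k) * (s j * (ws ! j) $ k))"
      using W ij by (subst mult_index[of _ n n _ n]) (auto simp: W_def)
    also have "\<dots> = cnj (s i) * s j * (ws ! j \<bullet>c ws ! i)"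
      using wsc[OF ij(1)] wsc[OF ij(2)]
      by (simp add: scalar_prod_def atLeast0LessThan sum_distrib_left mult_ac)
    also have "\<dots> = (1\<^sub>m n) $$ (i, j)"
      using corthogonalD[OF ws(2), of j i] ws(3) ij s[OF ij(1)] by (cases "i = j") (auto simp: q_def mult_ac)
    finally show "(mat_adjoint W * W) $$ (i, j) = (1\<^sub>m n) $$ (i, j)" .
  qed (use W in auto)
  then have "unitary_operator n W" using W by (intro unitary_operatorI')
  moreover have "col W 0 = s 0 \<cdot>\<^sub>v v"
    using n v by (intro eq_vecI) (auto simp: W_def hd)
  ultimately show ?thesis by blast
qed

text \<open>Induction by deflation: a unitary whose first column is an eigenvector makes the first
  column of the conjugated matrix \<open>B\<close> a multiple of the first unit vector, normality
  clears the rest of the first row, and the remaining block is again normal.\<close>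

theorem normal_unitarily_diagonalizable:
  fixes A :: "complex mat"
  assumes "A \<in> carrier_mat n n" "A * mat_adjoint A = mat_adjoint A * A"
  shows "\<exists>U f. unitary_operator n U \<and> A = U * mat_diag n f * mat_adjoint U"
  using assms
proof (induction n arbitrary: A)
  case 0
  then have "A = 1\<^sub>m 0 * mat_diag 0 (\<lambda>_. 0) * mat_adjoint (1\<^sub>m 0)" by (intro eq_matI) auto
  moreover have "unitary_operator 0 (1\<^sub>m 0)" by (simp add: unitary_operator_def)
  ultimately show ?case by blast
next
  case (Suc n)
  let ?N = "Suc n"
  have A: "A \<in> carrier_mat ?N ?N" by fact
  obtain es where es: "char_poly A = (\<Prod>a\<leftarrow>es. [:- a, 1:])" "length es = ?N"
    using char_poly_factorized[OF A] by blast
  then obtain e where "eigenvalue A e"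
    unfolding eigenvalue_root_char_poly[OF A] by (cases es) auto
  then obtain v where v: "v \<in> carrier_vec ?N" "v \<noteq> 0\<^sub>v ?N" "A *\<^sub>v v = e \<cdot>\<^sub>v v"
    using A by (auto simp: eigenvalue_def eigenvector_def)
  obtain W c where W: "unitary_operator ?N W" and colW: "col W 0 = c \<cdot>\<^sub>v v"
    using ex_unitary_first_column[OF v(1,2)] by blast
  have Wc: "W \<in> carrier_mat ?N ?N" "mat_adjoint W \<in> carrier_mat ?N ?N" using W by auto
  note assoc = assoc_mult_mat[of _ ?N ?N _ ?N _ ?N] mult_carrier_mat[of _ ?N ?N]
  define B where "B = mat_adjoint W * (A * W)"
  have B: "B \<in> carrier_mat ?N ?N" using A Wc by (simp add: B_def assoc)
  have adjB: "mat_adjoint B = mat_adjoint W * (mat_adjoint A * W)"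
    using A Wc by (simp add: B_def adjoint_mult[of _ ?N ?N _ ?N] assoc)
  have AB: "A = W * B * mat_adjoint W"
    using A Wc W by (simp add: B_def assoc unitary_cancel[OF W, of _ ?N] unitary_simps[OF W])
  have BB: "B * mat_adjoint B = mat_adjoint B * B"
  proof -
    have "B * mat_adjoint B = mat_adjoint W * (A * mat_adjoint A * W)"
      unfolding adjB unfolding B_def using A Wc W by (simp add: assoc unitary_cancel[OF W, of _ ?N])
    also have "\<dots> = mat_adjoint B * B"
      unfolding adjB Suc.prems(2) unfolding B_def using A Wc W by (simp add: assoc unitary_cancel[OF W, of _ ?N])
    finally show ?thesis .
  qed
  have col0: "B $$ (i, 0) = (if i = 0 then e else 0)" if "i < ?N" for i
  proof -
    have "col (A * W) 0 = A *\<^sub>v col W 0" by (rule col_mult2[OF A Wc(1)]) simp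
    also have "\<dots> = e \<cdot>\<^sub>v col W 0"
      using A v by (simp add: colW mult_mat_vec smult_smult_assoc mult.commute)
    finally have "B $$ (i, 0) = row (mat_adjoint W) i \<bullet> (e \<cdot>\<^sub>v col W 0)"
      using A Wc that by (simp add: B_def del: col_mult2)
    also have "\<dots> = e * (mat_adjoint W * W) $$ (i, 0)"
      using Wc that by simp
    finally show ?thesis using W that by (simp add: unitary_operator_def)
  qed
  \<comment> \<open>Entry \<open>(0, 0)\<close> of \<open>B * mat_adjoint B\<close> is the squared
    norm of the first row, that of \<open>mat_adjoint B * B\<close> the squared norm of the first
    column. Normality equates them, and both contain the term of the eigenvalue.\<close>
  have row0: "B $$ (0, Suc j) = 0" if "j < n" for j
  proof -
    have "(\<Sum>k<?N. B $$ (0, k) * cnj (B $$ (0, k))) = (B * mat_adjoint B) $$ (0, 0)"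
      using B by (simp add: mult_index[of _ ?N ?N _ ?N] del: index_mult_mat(1))
    also have "\<dots> = (\<Sum>k<?N. cnj (B $$ (k, 0)) * B $$ (k, 0))"
      unfolding BB using B by (simp add: mult_index[of _ ?N ?N _ ?N] del: index_mult_mat(1))
    also have "\<dots> = cnj e * e"
      unfolding sum.lessThan_Suc_shift using col0 by simp
    finally have "(\<Sum>k<n. B $$ (0, Suc k) * cnj (B $$ (0, Suc k))) = 0"
      unfolding sum.lessThan_Suc_shift using col0[of 0] by simp
    then have "complex_of_real (\<Sum>k<n. (cmod (B $$ (0, Suc k)))\<^sup>2) = 0"
      by (simp only: of_real_sum complex_norm_square)
    then have "(\<Sum>k<n. (cmod (B $$ (0, Suc k)))\<^sup>2) = 0" by (simp only: of_real_eq_0_iff)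
    then show ?thesis using that by (simp add: sum_nonneg_eq_0_iff)
  qed
  define C where "C = mat n n (\<lambda>(i, j). B $$ (Suc i, Suc j))"
  have C: "C \<in> carrier_mat n n" by (simp add: C_def)
  have "C * mat_adjoint C = mat_adjoint C * C"
  proof (rule eq_matI)
    fix i j assume "i < dim_row (mat_adjoint C * C)" "j < dim_col (mat_adjoint C * C)"
    then have ij: "i < n" "j < n" using C by auto
    have "(C * mat_adjoint C) $$ (i, j) = (\<Sum>k<n. B $$ (Suc i, Suc k) * cnj (B $$ (Suc j, Suc k)))"
      using C ij by (subst mult_index[of _ n n _ n]) (auto simp: C_def)
    also have "\<dots> = (B * mat_adjoint B) $$ (Suc i, Suc j)"
      using B ij col0
      by (simp add: mult_index[of _ ?N ?N _ ?N] sum.lessThan_Suc_shift del: index_mult_mat(1) sum.lessThan_Suc)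
    also have "\<dots> = (\<Sum>k<n. cnj (B $$ (Suc k, Suc i)) * B $$ (Suc k, Suc j))"
      unfolding BB using B ij row0
      by (simp add: mult_index[of _ ?N ?N _ ?N] sum.lessThan_Suc_shift del: index_mult_mat(1) sum.lessThan_Suc)
    also have "\<dots> = (mat_adjoint C * C) $$ (i, j)"
      using C ij by (subst mult_index[of _ n n _ n]) (auto simp: C_def)
    finally show "(C * mat_adjoint C) $$ (i, j) = (mat_adjoint C * C) $$ (i, j)" .
  qed (use C in auto)
  from Suc.IH[OF C this] obtain V f where V: "unitary_operator n V"
    and Cf: "C = V * mat_diag n f * mat_adjoint V" by blast
  have Vc: "V \<in> carrier_mat n n" using V by simp
  \<comment> \<open>Direct sum of the 1 by 1 identity with \<open>V\<close>.\<close>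
  define V' where "V' = mat ?N ?N (\<lambda>(i, j). case (i, j) of (0, 0) \<Rightarrow> 1 | (Suc i, Suc j) \<Rightarrow> V $$ (i, j) | _ \<Rightarrow> 0)"
  have V'c: "V' \<in> carrier_mat ?N ?N" by (simp add: V'_def)
  have V'_simps: "V' $$ (0, 0) = 1" "\<And>i. i < n \<Longrightarrow> V' $$ (Suc i, 0) = 0"
    "\<And>i. i < n \<Longrightarrow> V' $$ (0, Suc i) = 0"
    "\<And>i j. i < n \<Longrightarrow> j < n \<Longrightarrow> V' $$ (Suc i, Suc j) = V $$ (i, j)"
    by (simp_all add: V'_def)
  define f' where "f' i = (case i of 0 \<Rightarrow> e | Suc i \<Rightarrow> f i)" for i
  \<comment> \<open>Kept general in the diagonal \<open>h\<close>: the constant 1 gives unitarity of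
    \<open>V'\<close>, and \<open>f'\<close> gives the diagonalisation of \<open>B\<close>.\<close>
  have block: "(V' * mat_diag ?N h * mat_adjoint V') $$ (i, j)
      = (case (i, j) of (0, 0) \<Rightarrow> h 0 | (Suc i, Suc j) \<Rightarrow> (V * mat_diag n (\<lambda>k. h (Suc k)) * mat_adjoint V) $$ (i, j) | _ \<Rightarrow> 0)"
    if "i < ?N" "j < ?N" for h i j
    unfolding diag_conj_index[OF V'c that] sum.lessThan_Suc_shift
    using that V'_simps diag_conj_index[OF Vc] by (auto split: nat.split simp del: index_mult_mat(1))
  have "V' * mat_diag ?N (\<lambda>_. 1) * mat_adjoint V' = 1\<^sub>m ?N"
  proof (rule eq_matI)
    fix i j assume "i < dim_row (1\<^sub>m ?N :: complex mat)" "j < dim_col (1\<^sub>m ?N :: complex mat)"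
    then have ij: "i < ?N" "j < ?N" by auto
    have "V * mat_diag n (\<lambda>k. 1) * mat_adjoint V = 1\<^sub>m n" using V Vc by (simp add: unitary_operator_def)
    then show "(V' * mat_diag ?N (\<lambda>_. 1) * mat_adjoint V') $$ (i, j) = 1\<^sub>m ?N $$ (i, j)"
      using block[OF ij, of "\<lambda>_. 1"] ij by (auto split: nat.splits simp del: index_mult_mat(1) mat_diag_one)
  qed (use V'c in auto)
  then have V': "unitary_operator ?N V'" using V'c by (intro unitary_operatorI) auto
  have "B = V' * mat_diag ?N f' * mat_adjoint V'"
  proof (rule eq_matI)
    fix i j assume "i < dim_row (V' * mat_diag ?N f' * mat_adjoint V')" "j < dim_col (V' * mat_diag ?N f' * mat_adjoint V')"
    then have ij: "i < ?N" "j < ?N" using V'c by auto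
    have f': "(\<lambda>k. f' (Suc k)) = f" "f' 0 = e" by (auto simp: f'_def)
    have "B $$ (Suc i, Suc j) = (V * mat_diag n f * mat_adjoint V) $$ (i, j)" if "i < n" "j < n" for i j
      using that unfolding Cf[symmetric] by (simp add: C_def)
    then show "B $$ (i, j) = (V' * mat_diag ?N f' * mat_adjoint V') $$ (i, j)"
      unfolding block[OF ij] f' using ij col0 row0 by (auto split: nat.splits simp del: index_mult_mat(1))
  qed (use B V'c in auto)
  then have "A = (W * V') * mat_diag ?N f' * mat_adjoint (W * V')"
    unfolding AB using Wc V'c by (simp add: adjoint_mult[of _ ?N ?N _ ?N] assoc)
  then show ?case using unitary_mult[OF W V'] by blast
qed

subsection \<open>Positive operators, tensor products and partial traces\<close>

lemma quadratic_form_index: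
  assumes "A \<in> carrier_mat n n" "v \<in> carrier_vec n"
  shows "(A *\<^sub>v v) \<bullet>c v = (\<Sum>i<n. \<Sum>j<n. A $$ (i, j) * v $ j * cnj (v $ i))"
  using assms by (simp add: scalar_prod_def atLeast0LessThan sum_distrib_right)

lemma adjoint_scalar_prod:
  fixes A :: "complex mat"
  assumes "A \<in> carrier_mat n m" "x \<in> carrier_vec n" "y \<in> carrier_vec m"
  shows "(mat_adjoint A *\<^sub>v x) \<bullet>c y = x \<bullet>c (A *\<^sub>v y)"
proof -
  have "(mat_adjoint A *\<^sub>v x) \<bullet>c y = (\<Sum>j<m. \<Sum>i<n. cnj (A $$ (i, j)) * x $ i * cnj (y $ j))"
    using assms by (simp add: scalar_prod_def atLeast0LessThan sum_distrib_right)
  also have "\<dots> = (\<Sum>i<n. \<Sum>j<m. cnj (A $$ (i, j)) * x $ i * cnj (y $ j))" by (rule sum.swap)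
  also have "\<dots> = x \<bullet>c (A *\<^sub>v y)"
    using assms by (simp add: scalar_prod_def atLeast0LessThan sum_distrib_left mult_ac)
  finally show ?thesis .
qed

lemma positive_operator_carrier [simp]: "positive_operator n A \<Longrightarrow> A \<in> carrier_mat n n"
  by (simp add: positive_operator_def)

lemma positive_operator_conj:
  assumes P: "positive_operator n P" and u: "u \<in> carrier_mat n n"
  shows "positive_operator n (mat_adjoint u * P * u)"
  unfolding positive_operator_def
proof (intro conjI ballI)
  have Pc: "P \<in> carrier_mat n n" using P by simp
  show "mat_adjoint u * P * u \<in> carrier_mat n n"
    using Pc u by (simp add: mult_carrier_mat[of _ n n])
  fix v :: "complex vec" assume v: "v \<in> carrier_vec n"
  have "mat_adjoint u * P * u *\<^sub>v v = mat_adjoint u *\<^sub>v (P *\<^sub>v (u *\<^sub>v v))"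
    using Pc u v by (simp add: assoc_mult_mat_vec[of _ n n _ n] mult_carrier_mat[of _ n n])
  then have "(mat_adjoint u * P * u *\<^sub>v v) \<bullet>c v = (P *\<^sub>v (u *\<^sub>v v)) \<bullet>c (u *\<^sub>v v)"
    using Pc u v by (simp add: adjoint_scalar_prod[of _ n n])
  then show "0 \<le> (mat_adjoint u * P * u *\<^sub>v v) \<bullet>c v"
    using P u v by (simp add: positive_operator_def)
qed

lemma positive_operator_diag_entry:
  assumes "positive_operator n A" "k < n"
  shows "0 \<le> A $$ (k, k)"
proof -
  have A: "A \<in> carrier_mat n n" using assms by simp
  have "(A *\<^sub>v unit_vec n k) \<bullet>c unit_vec n k
      = (\<Sum>i<n. \<Sum>j<n. if j = k then if i = k then A $$ (i, j) else 0 else 0)"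
    unfolding quadratic_form_index[OF A unit_vec_carrier] using assms(2) by (intro sum.cong refl) simp
  also have "\<dots> = A $$ (k, k)" using assms(2) by simp
  finally have "(A *\<^sub>v unit_vec n k) \<bullet>c unit_vec n k = A $$ (k, k)" .
  then show ?thesis using assms by (metis positive_operator_def unit_vec_carrier)
qed

lemma positive_operator_diag:
  assumes "\<And>i. i < n \<Longrightarrow> 0 \<le> f i"
  shows "positive_operator n (mat_diag n f)"
  unfolding positive_operator_def
proof (intro conjI ballI)
  fix v :: "complex vec" assume v: "v \<in> carrier_vec n"
  have "(mat_diag n f *\<^sub>v v) \<bullet>c v = (\<Sum>i<n. \<Sum>j<n. if i = j then f i * (v $ i * cnj (v $ i)) else 0)"
    unfolding quadratic_form_index[OF mat_diag_dim v] by (intro sum.cong refl) (simp add: mat_diag_def)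
  also have "\<dots> = (\<Sum>i<n. f i * (v $ i * cnj (v $ i)))" by simp
  also have "0 \<le> \<dots>"
  proof (rule sum_nonneg)
    fix i assume "i \<in> {..<n}"
    moreover have "0 \<le> v $ i * cnj (v $ i)" by (simp add: less_eq_complex_def)
    ultimately show "0 \<le> f i * (v $ i * cnj (v $ i))"
      using assms by (simp only: lessThan_iff mult_nonneg_nonneg)
  qed
  finally show "0 \<le> (mat_diag n f *\<^sub>v v) \<bullet>c v" .
qed simp

text \<open>The values 1, -1, \<i> and -\<i> of \<open>c\<close> later isolate the real and
  imaginary parts of off-diagonal entries.\<close>

lemma quadratic_form_two_entries:
  fixes c :: complex
  assumes A: "A \<in> carrier_mat n n" and ij: "i < n" "j < n" "i \<noteq> j"
  defines "v \<equiv> vec n (\<lambda>k. if k = i then 1 else if k = j then c else 0)"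
  shows "(A *\<^sub>v v) \<bullet>c v
    = A $$ (i, i) + A $$ (i, j) * c + A $$ (j, i) * cnj c + A $$ (j, j) * (c * cnj c)"
proof -
  have v: "v \<in> carrier_vec n" by (simp add: v_def)
  have "(A *\<^sub>v v) \<bullet>c v = (\<Sum>a<n. \<Sum>b<n. A $$ (a, b) * v $ b * cnj (v $ a))"
    by (rule quadratic_form_index[OF A v])
  also have "\<dots> = (\<Sum>a\<in>{i, j}. \<Sum>b<n. A $$ (a, b) * v $ b * cnj (v $ a))"
    using ij by (intro sum.mono_neutral_right) (auto simp: v_def)
  also have "\<dots> = (\<Sum>a\<in>{i, j}. \<Sum>b\<in>{i, j}. A $$ (a, b) * v $ b * cnj (v $ a))"
    using ij by (intro sum.cong refl sum.mono_neutral_right) (auto simp: v_def)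
  finally show ?thesis using ij by (simp add: v_def algebra_simps)
qed

lemma positive_operator_two_entries:
  assumes A: "positive_operator n A" and ij: "i < n" "j < n" "i \<noteq> j"
  shows "0 \<le> A $$ (i, i) + A $$ (i, j) * c + A $$ (j, i) * cnj c + A $$ (j, j) * (c * cnj c)"
  using A unfolding quadratic_form_two_entries[OF positive_operator_carrier[OF A] ij, symmetric]
  by (simp add: positive_operator_def)

text \<open>The diagonal entries are real. Reality of the form at \<open>c = 1\<close> makes the
  imaginary parts of opposite entries cancel, and at \<open>c = \<i>\<close> it makes their real
  parts equal.\<close>

lemma positive_operator_hermitian:
  assumes A: "positive_operator n A"
  shows "mat_adjoint A = A"
proof (rule eq_matI)
  have Ac: "A \<in> carrier_mat n n" using A by simp
  fix i j assume "i < dim_row A" "j < dim_col A"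
  then have ij: "i < n" "j < n" using Ac by auto
  have "cnj (A $$ (j, i)) = A $$ (i, j)"
  proof (cases "i = j")
    case True
    then show ?thesis
      using positive_operator_diag_entry[OF A ij(1)] by (simp add: less_eq_complex_def complex_eq_iff)
  next
    case False
    show ?thesis
      using positive_operator_two_entries[OF A ij False, of 1]
        positive_operator_two_entries[OF A ij False, of \<i>]
        positive_operator_diag_entry[OF A ij(1)] positive_operator_diag_entry[OF A ij(2)]
      by (simp add: less_eq_complex_def complex_eq_iff)
  qed
  then show "mat_adjoint A $$ (i, j) = A $$ (i, j)" using Ac ij by simp
qed (use A in \<open>auto dest: positive_operator_carrier\<close>)

lemma commuting_hermitian_diagonalizable:
  fixes A B :: "complex mat"
  assumes A: "A \<in> carrier_mat n n" "mat_adjoint A = A" and B: "B \<in> carrier_mat n n" "mat_adjoint B = B"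
    and comm: "A * B = B * A"
  shows "\<exists>U (a :: nat \<Rightarrow> real) (b :: nat \<Rightarrow> real). unitary_operator n U
    \<and> A = U * mat_diag n (\<lambda>i. of_real (a i)) * mat_adjoint U
    \<and> B = U * mat_diag n (\<lambda>i. of_real (b i)) * mat_adjoint U"
proof -
  \<comment> \<open>\<open>A + \<i> B\<close> is normal, and its spectral decomposition diagonalises its Hermitian and
    anti-Hermitian parts simultaneously.\<close>
  define H where "H = mat n n (\<lambda>(i, j). A $$ (i, j) + \<i> * B $$ (i, j))"
  have H: "H \<in> carrier_mat n n" by (simp add: H_def)
  have herm: "cnj (A $$ (j, i)) = A $$ (i, j)" "cnj (B $$ (j, i)) = B $$ (i, j)"
    if "i < n" "j < n" for i j
    using that A B adjoint_index[of i A j] adjoint_index[of i B j] by auto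
  have "H * mat_adjoint H = mat_adjoint H * H"
  proof (rule eq_matI)
    fix i j assume "i < dim_row (mat_adjoint H * H)" "j < dim_col (mat_adjoint H * H)"
    then have ij: "i < n" "j < n" using H by auto
    have "(\<Sum>k<n. A $$ (i, k) * B $$ (k, j)) = (\<Sum>k<n. B $$ (i, k) * A $$ (k, j))"
      using arg_cong[OF comm, of "\<lambda>X. X $$ (i, j)"] A(1) B(1) ij
      by (simp add: mult_index[of _ n n _ n] del: index_mult_mat(1))
    then have "(\<Sum>k<n. (A $$ (i, k) + \<i> * B $$ (i, k)) * (A $$ (k, j) - \<i> * B $$ (k, j)))
        = (\<Sum>k<n. (A $$ (i, k) - \<i> * B $$ (i, k)) * (A $$ (k, j) + \<i> * B $$ (k, j)))"
      by (simp add: algebra_simps sum.distrib sum_subtractf flip: sum_distrib_left)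
    then show "(H * mat_adjoint H) $$ (i, j) = (mat_adjoint H * H) $$ (i, j)"
      using H ij by (simp add: mult_index[of _ n n _ n] H_def herm del: index_mult_mat(1))
  qed (use H in auto)
  from normal_unitarily_diagonalizable[OF H this] obtain U f where U: "unitary_operator n U"
    and Hf: "H = U * mat_diag n f * mat_adjoint U" by blast
  have Uc: "U \<in> carrier_mat n n" using U by simp
  have H_index: "H $$ (i, j) = (\<Sum>k<n. U $$ (i, k) * f k * cnj (U $$ (j, k)))" if "i < n" "j < n" for i j
    unfolding Hf using diag_conj_index[OF Uc that] .
  have "A = U * mat_diag n (\<lambda>i. of_real (Re (f i))) * mat_adjoint U"
  proof (rule eq_matI, goal_cases)
    case (1 i j)
    then have ij: "i < n" "j < n" using Uc by auto
    have "A $$ (i, j) = (H $$ (i, j) + cnj (H $$ (j, i))) / 2"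
      using ij herm[OF ij] by (simp add: H_def)
    also have "\<dots> = (\<Sum>k<n. U $$ (i, k) * ((f k + cnj (f k)) / 2) * cnj (U $$ (j, k)))"
      unfolding H_index[OF ij] H_index[OF ij(2,1)]
      by (simp add: sum_divide_distrib add_divide_distrib sum.distrib algebra_simps)
    finally show ?case
      unfolding diag_conj_index[OF Uc ij] by (simp add: complex_add_cnj)
  qed (use A Uc in auto)
  moreover have "B = U * mat_diag n (\<lambda>i. of_real (Im (f i))) * mat_adjoint U"
  proof (rule eq_matI, goal_cases)
    case (1 i j)
    then have ij: "i < n" "j < n" using Uc by auto
    have "B $$ (i, j) = (H $$ (i, j) - cnj (H $$ (j, i))) / (2 * \<i>)"
      using ij herm[OF ij] by (simp add: H_def)
    also have "\<dots> = (\<Sum>k<n. U $$ (i, k) * ((f k - cnj (f k)) / (2 * \<i>)) * cnj (U $$ (j, k)))"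
      unfolding H_index[OF ij] H_index[OF ij(2,1)]
      by (simp add: sum_divide_distrib diff_divide_distrib sum_subtractf algebra_simps)
    finally have B_index: "B $$ (i, j)
        = (\<Sum>k<n. U $$ (i, k) * ((f k - cnj (f k)) / (2 * \<i>)) * cnj (U $$ (j, k)))" .
    have "(f k - cnj (f k)) / (2 * \<i>) = of_real (Im (f k))" for k
      by (simp add: complex_eq_iff)
    then show ?case
      unfolding diag_conj_index[OF Uc ij] B_index by (simp only:)
  qed (use B Uc in auto)
  ultimately show ?thesis using U
    by (intro exI[of _ U] exI[of _ "\<lambda>i. Re (f i)"] exI[of _ "\<lambda>i. Im (f i)"]) simp
qed

lemma unitary_conj_cancel:
  assumes "unitary_operator n U" "A \<in> carrier_mat n n"
  shows "mat_adjoint U * (U * A * mat_adjoint U) * U = A"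
proof -
  have U: "U \<in> carrier_mat n n" "mat_adjoint U \<in> carrier_mat n n" using assms by auto
  show ?thesis
    using U assms(2) by (simp add: assoc_mult_mat[of _ n n _ n _ n] mult_carrier_mat[of _ n n]
        unitary_cancel[OF assms(1), of _ n] unitary_simps[OF assms(1)])
qed

text \<open>Conjugating back with \<open>U\<close> makes the eigenvalue a diagonal entry of a
  positive operator.\<close>

lemma positive_operator_eigenvalue:
  assumes "positive_operator n (U * mat_diag n f * mat_adjoint U)" "unitary_operator n U" "k < n"
  shows "0 \<le> f k"
  using positive_operator_diag_entry[OF positive_operator_conj[OF assms(1)
        unitary_carrier[OF assms(2)]] assms(3)] assms(3)
  unfolding unitary_conj_cancel[OF assms(2) mat_diag_dim] by (simp add: mat_diag_def)

text \<open>The square root is taken on the eigenvalues. The factorisation is used for positivity of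
  tensor products and of reduced effects.\<close>

lemma positive_operator_factor:
  assumes A: "positive_operator n A"
  shows "\<exists>S \<in> carrier_mat n n. A = S * mat_adjoint S"
proof -
  have Ac: "A \<in> carrier_mat n n" using A by simp
  obtain U a where U: "unitary_operator n U"
    and Aeq: "A = U * mat_diag n (\<lambda>i. of_real (a i)) * mat_adjoint U"
    using commuting_hermitian_diagonalizable[OF Ac positive_operator_hermitian[OF A]
        Ac positive_operator_hermitian[OF A] refl] by blast
  have Uc: "U \<in> carrier_mat n n" using U by simp
  have a: "0 \<le> a k" if "k < n" for k
    using positive_operator_eigenvalue[OF A[unfolded Aeq] U that] by (simp add: less_eq_complex_def)
  define S where "S = U * mat_diag n (\<lambda>i. of_real (sqrt (a i)))"
  have S: "S \<in> carrier_mat n n" using Uc by (simp add: S_def)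
  have sq: "mat_diag n (\<lambda>i. of_real (sqrt (a i)) * of_real (sqrt (a i))) = mat_diag n (\<lambda>i. complex_of_real (a i))"
    using a by (intro eq_matI) (auto simp: mat_diag_def simp flip: of_real_mult)
  have "S * mat_adjoint S = U * (mat_diag n (\<lambda>i. of_real (sqrt (a i))) * (mat_diag n (\<lambda>i. of_real (sqrt (a i))) * mat_adjoint U))"
    using Uc by (simp add: S_def adjoint_mult[of _ n n _ n] assoc_mult_mat[of _ n n _ n _ n]
        mult_carrier_mat[of _ n n] del: mat_diag_diag)
  also have "\<dots> = U * (mat_diag n (\<lambda>i. of_real (sqrt (a i)) * of_real (sqrt (a i))) * mat_adjoint U)"
    using Uc by (simp flip: assoc_mult_mat[of _ n n _ n _ n])
  also have "\<dots> = A"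
    unfolding sq Aeq using Uc by (simp add: assoc_mult_mat[of _ n n _ n _ n])
  finally show ?thesis using S by auto
qed

section \<open>Traces and Kronecker products\<close>

lemma trace_mult_comm:
  assumes "A \<in> carrier_mat n m" "B \<in> carrier_mat m n"
  shows "mat_trace (A * B) = mat_trace (B * A)"
proof -
  have "mat_trace (A * B) = (\<Sum>i<n. \<Sum>k<m. A $$ (i, k) * B $$ (k, i))"
    using assms by (simp add: mat_trace_def mult_index[of _ n m _ n] del: index_mult_mat(1))
  also have "\<dots> = (\<Sum>k<m. \<Sum>i<n. B $$ (k, i) * A $$ (i, k))"
    by (subst sum.swap) (simp add: mult.commute)
  also have "\<dots> = mat_trace (B * A)"
    using assms by (simp add: mat_trace_def mult_index[of _ m n _ m] del: index_mult_mat(1))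
  finally show ?thesis .
qed

text \<open>Splits the running index of a Kronecker product into its two factor indices.\<close>

lemma sum_div_mod: "(\<Sum>k<m * r. f (k div r) (k mod r)) = (\<Sum>a<m. \<Sum>b<r. f a (b :: nat))"
proof -
  have "(\<Sum>k<m * r. f (k div r) (k mod r)) = (\<Sum>a<m. \<Sum>k\<in>{a * r..<a * r + r}. f (k div r) (k mod r))"
    by (rule sum.nat_group[symmetric])
  also have "\<dots> = (\<Sum>a<m. \<Sum>b<r. f a b)"
  proof (rule sum.cong[OF refl])
    fix a
    have "(\<Sum>k\<in>{a * r..<a * r + r}. f (k div r) (k mod r)) = (\<Sum>b<r. f ((b + a * r) div r) ((b + a * r) mod r))"
      using sum.shift_bounds_nat_ivl[of "\<lambda>k. f (k div r) (k mod r)" 0 "a * r" r]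
      by (simp add: atLeast0LessThan add.commute)
    then show "(\<Sum>k\<in>{a * r..<a * r + r}. f (k div r) (k mod r)) = (\<Sum>b<r. f a b)" by simp
  qed
  finally show ?thesis .
qed

lemma div_mod_less: "k < m * r \<Longrightarrow> k div r < m" "k < m * r \<Longrightarrow> k mod r < (r :: nat)"
  by (auto simp: less_mult_imp_div_less intro!: mod_less_divisor gr0I)

lemma pair_index_less: "a < m \<Longrightarrow> b < r \<Longrightarrow> a * r + b < m * (r :: nat)"
  by (metis add.commute add_less_cancel_left less_le_trans mult_Suc mult_le_mono1 Suc_leI)

lemma tensor_dim [simp]: "dim_row (A \<otimes>\<^sub>m B) = dim_row A * dim_row B"
  "dim_col (A \<otimes>\<^sub>m B) = dim_col A * dim_col B"
  by (simp_all add: tensor_mat_def)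

lemma tensor_carrier [simp]:
  "A \<in> carrier_mat n m \<Longrightarrow> B \<in> carrier_mat p q \<Longrightarrow> A \<otimes>\<^sub>m B \<in> carrier_mat (n * p) (m * q)"
  by (rule carrier_matI) auto

lemma tensor_index:
  assumes "A \<in> carrier_mat n m" "B \<in> carrier_mat p q" "i < n * p" "j < m * q"
  shows "(A \<otimes>\<^sub>m B) $$ (i, j) = A $$ (i div p, j div q) * B $$ (i mod p, j mod q)"
  using assms by (auto simp: tensor_mat_def)

lemma tensor_mult:
  assumes "A \<in> carrier_mat n m" "B \<in> carrier_mat p q" "C \<in> carrier_mat m l" "D \<in> carrier_mat q s"
  shows "(A \<otimes>\<^sub>m B) * (C \<otimes>\<^sub>m D) = (A * C) \<otimes>\<^sub>m (B * D)"
proof (rule eq_matI, goal_cases)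
  case (1 i j)
  then have ij: "i < n * p" "j < l * s" using assms by auto
  note ij' = div_mod_less[OF ij(1)] div_mod_less[OF ij(2)]
  have "((A \<otimes>\<^sub>m B) * (C \<otimes>\<^sub>m D)) $$ (i, j)
      = (\<Sum>k<m * q. (A $$ (i div p, k div q) * C $$ (k div q, j div s))
          * (B $$ (i mod p, k mod q) * D $$ (k mod q, j mod s)))"
    using assms ij
    by (subst mult_index[of _ "n * p" "m * q" _ "l * s"]) (simp_all add: tensor_index[of _ n m _ p q] tensor_index[of _ m l _ q s] mult_ac)
  also have "\<dots> = (A * C) $$ (i div p, j div s) * (B * D) $$ (i mod p, j mod s)"
    unfolding sum_div_mod[where f = "\<lambda>a b. (A $$ (i div p, a) * C $$ (a, j div s)) * (B $$ (i mod p, b) * D $$ (b, j mod s))"]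
    using assms ij' by (simp add: mult_index[of _ n m _ l] mult_index[of _ p q _ s] sum_product del: index_mult_mat(1))
  also have "\<dots> = ((A * C) \<otimes>\<^sub>m (B * D)) $$ (i, j)"
    using assms ij by (subst tensor_index[of _ n l _ p s]) auto
  finally show ?case .
qed (use assms in auto)

lemma tensor_adjoint:
  assumes "A \<in> carrier_mat n m" "B \<in> carrier_mat p q"
  shows "mat_adjoint (A \<otimes>\<^sub>m B) = mat_adjoint A \<otimes>\<^sub>m mat_adjoint B"
proof (rule eq_matI, goal_cases)
  case (1 i j)
  then have ij: "i < m * q" "j < n * p" using assms by auto
  then show ?case
    using assms div_mod_less[OF ij(1)] div_mod_less[OF ij(2)]
    by (simp add: tensor_index[of _ n m _ p q] tensor_index[of _ m n _ q p])
qed (use assms in auto)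

lemma tensor_diag: "mat_diag n f \<otimes>\<^sub>m mat_diag m h = mat_diag (n * m) (\<lambda>k. f (k div m) * h (k mod m))"
proof (rule eq_matI, goal_cases)
  case (1 i j)
  then have ij: "i < n * m" "j < n * m" by (auto simp: mat_diag_def)
  have "i = j" if "i div m = j div m" "i mod m = j mod m" using that by (metis div_mult_mod_eq)
  then show ?case
    using ij div_mod_less[OF ij(1)] div_mod_less[OF ij(2)]
    by (auto simp: tensor_index[of _ n n _ m m] mat_diag_def)
qed (auto simp: mat_diag_def)

lemma tensor_one: "1\<^sub>m n \<otimes>\<^sub>m 1\<^sub>m m = (1\<^sub>m (n * m) :: complex mat)"
  using tensor_diag[of n "\<lambda>_. 1" m "\<lambda>_. 1"] by simp

lemma tensor_assoc:
  assumes "A \<in> carrier_mat n m" "B \<in> carrier_mat p q" "C \<in> carrier_mat l s"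
  shows "A \<otimes>\<^sub>m B \<otimes>\<^sub>m C = A \<otimes>\<^sub>m (B \<otimes>\<^sub>m C)"
proof (rule eq_matI, goal_cases)
  case (1 i j)
  then have ij: "i < n * p * l" "j < m * q * s" using assms by (auto simp: mult.assoc)
  then have ij2: "i < n * (p * l)" "j < m * (q * s)" by (simp_all add: mult.assoc)
  have pos: "0 < l" "0 < s" using ij by (auto intro: gr0I)
  have div: "i div (p * l) = i div l div p" "j div (q * s) = j div s div q"
    by (simp_all add: div_mult2_eq mult.commute[of p] mult.commute[of q])
  have mod: "i mod (p * l) = l * (i div l mod p) + i mod l" "j mod (q * s) = s * (j div s mod q) + j mod s"
    by (simp_all add: mod_mult2_eq mult.commute[of p] mult.commute[of q])
  have "(A \<otimes>\<^sub>m B \<otimes>\<^sub>m C) $$ (i, j)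
      = A $$ (i div l div p, j div s div q) * B $$ (i div l mod p, j div s mod q) * C $$ (i mod l, j mod s)"
    using assms ij div_mod_less[OF ij(1)] div_mod_less[OF ij(2)]
    by (simp add: tensor_index[of _ "n * p" "m * q" _ l s] tensor_index[of _ n m _ p q])
  also have "\<dots> = A $$ (i div (p * l), j div (q * s)) * (B \<otimes>\<^sub>m C) $$ (i mod (p * l), j mod (q * s))"
    unfolding div tensor_index[OF assms(2,3) div_mod_less(2)[OF ij2(1)] div_mod_less(2)[OF ij2(2)]]
    using pos by (simp add: mod)
  also have "\<dots> = (A \<otimes>\<^sub>m (B \<otimes>\<^sub>m C)) $$ (i, j)"
    using tensor_index[OF assms(1) tensor_carrier[OF assms(2,3)] ij2] by simp
  finally show ?case .
qed (use assms in auto)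

lemma unitary_tensor:
  assumes "unitary_operator n U" "unitary_operator m V"
  shows "unitary_operator (n * m) (U \<otimes>\<^sub>m V)"
proof (rule unitary_operatorI)
  have c: "U \<in> carrier_mat n n" "V \<in> carrier_mat m m" using assms by auto
  then show "U \<otimes>\<^sub>m V \<in> carrier_mat (n * m) (n * m)" by simp
  show "U \<otimes>\<^sub>m V * mat_adjoint (U \<otimes>\<^sub>m V) = 1\<^sub>m (n * m)"
    using c by (simp add: tensor_adjoint[of _ n n _ m m] tensor_mult[of _ n n _ m m _ n _ m]
        unitary_simps[OF assms(1)] unitary_simps[OF assms(2)] tensor_one)
qed

lemma unitary_one: "unitary_operator n (1\<^sub>m n)"
  by (rule unitary_operatorI) auto

text \<open>The factors \<open>S\<close> and \<open>R\<close> of the two operators combine to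
  \<open>S \<otimes>\<^sub>m R\<close>, so the product is a conjugate of the identity.\<close>

lemma positive_operator_tensor:
  assumes "positive_operator n A" "positive_operator m B"
  shows "positive_operator (n * m) (A \<otimes>\<^sub>m B)"
proof -
  obtain S R where S: "S \<in> carrier_mat n n" "A = S * mat_adjoint S"
    and R: "R \<in> carrier_mat m m" "B = R * mat_adjoint R"
    using assms positive_operator_factor by metis
  have "positive_operator (n * m) (mat_diag (n * m) (\<lambda>_. 1))"
    by (rule positive_operator_diag) (simp add: less_eq_complex_def)
  then have one: "positive_operator (n * m) (1\<^sub>m (n * m))" by simp
  have "A \<otimes>\<^sub>m B = mat_adjoint (mat_adjoint (S \<otimes>\<^sub>m R)) * 1\<^sub>m (n * m) * mat_adjoint (S \<otimes>\<^sub>m R)"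
    using S(1) R(1) tensor_mult[of S n n R m m "mat_adjoint S" n "mat_adjoint R" m]
    by (simp add: S(2) R(2) tensor_adjoint[of _ n n _ m m])
  then show ?thesis
    using positive_operator_conj[OF one, of "mat_adjoint (S \<otimes>\<^sub>m R)"] S(1) R(1) by simp
qed

section \<open>Partial trace over the first factor\<close>

lemma ptrace_fst_entry:
  assumes "Y \<in> carrier_mat (m * r) (m * r)" "i < r" "j < r"
  shows "ptrace_fst m r Y $$ (i, j) = (\<Sum>a<m. Y $$ (a * r + i, a * r + j))"
  using assms by (simp add: ptrace_fst_def)

lemma tensor_one_mult_index:
  assumes A: "A \<in> carrier_mat m m" and Y: "Y \<in> carrier_mat (m * r) (m * r)"
    and "a < m" "i < r" "l < m * r"
  shows "((A \<otimes>\<^sub>m 1\<^sub>m r) * Y) $$ (a * r + i, l) = (\<Sum>b<m. A $$ (a, b) * Y $$ (b * r + i, l))"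
    and "(Y * (A \<otimes>\<^sub>m 1\<^sub>m r)) $$ (l, a * r + i) = (\<Sum>b<m. Y $$ (l, b * r + i) * A $$ (b, a))"
proof -
  have x: "a * r + i < m * r" using assms by (simp add: pair_index_less)
  have T: "A \<otimes>\<^sub>m 1\<^sub>m r \<in> carrier_mat (m * r) (m * r)" using A by simp
  have "((A \<otimes>\<^sub>m 1\<^sub>m r) * Y) $$ (a * r + i, l)
      = (\<Sum>k<m * r. (\<lambda>b j. A $$ (a, b) * (if i = j then 1 else 0) * Y $$ (b * r + j, l)) (k div r) (k mod r))"
    using A assms x unfolding mult_index[OF T Y x assms(5)]
    by (intro sum.cong refl) (simp add: tensor_index[of _ m m _ r r] div_mod_less)
  also have "\<dots> = (\<Sum>b<m. A $$ (a, b) * Y $$ (b * r + i, l))"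
    unfolding sum_div_mod[where f = "\<lambda>b j. A $$ (a, b) * (if i = j then 1 else 0) * Y $$ (b * r + j, l)"]
    using assms(4) by (simp add: if_distrib if_distribR cong: if_cong)
  finally show "((A \<otimes>\<^sub>m 1\<^sub>m r) * Y) $$ (a * r + i, l) = (\<Sum>b<m. A $$ (a, b) * Y $$ (b * r + i, l))" .
  have "(Y * (A \<otimes>\<^sub>m 1\<^sub>m r)) $$ (l, a * r + i)
      = (\<Sum>k<m * r. (\<lambda>b j. Y $$ (l, b * r + j) * (A $$ (b, a) * (if j = i then 1 else 0))) (k div r) (k mod r))"
    using A assms x unfolding mult_index[OF Y T assms(5) x]
    by (intro sum.cong refl) (simp add: tensor_index[of _ m m _ r r] div_mod_less)
  also have "\<dots> = (\<Sum>b<m. Y $$ (l, b * r + i) * A $$ (b, a))"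
    unfolding sum_div_mod[where f = "\<lambda>b j. Y $$ (l, b * r + j) * (A $$ (b, a) * (if j = i then 1 else 0))"]
    using assms(4) by (simp add: if_distrib if_distribR cong: if_cong)
  finally show "(Y * (A \<otimes>\<^sub>m 1\<^sub>m r)) $$ (l, a * r + i) = (\<Sum>b<m. Y $$ (l, b * r + i) * A $$ (b, a))" .
qed

text \<open>An operator acting only on the traced-out factor can be moved cyclically, because the
  indices it touches are all summed over.\<close>

lemma ptrace_fst_cyclic:
  assumes A: "A \<in> carrier_mat m m" and Y: "Y \<in> carrier_mat (m * r) (m * r)"
  shows "ptrace_fst m r ((A \<otimes>\<^sub>m 1\<^sub>m r) * Y) = ptrace_fst m r (Y * (A \<otimes>\<^sub>m 1\<^sub>m r))"
proof (rule eq_matI, goal_cases)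
  case (1 i j)
  then have ij: "i < r" "j < r" by (simp_all add: ptrace_fst_def)
  have T: "A \<otimes>\<^sub>m 1\<^sub>m r \<in> carrier_mat (m * r) (m * r)" using A by simp
  have "(\<Sum>a<m. \<Sum>b<m. A $$ (a, b) * Y $$ (b * r + i, a * r + j))
      = (\<Sum>b<m. \<Sum>a<m. Y $$ (b * r + i, a * r + j) * A $$ (a, b))"
    by (subst sum.swap) (simp add: mult.commute)
  then show ?case
    using A Y T ij
    by (simp add: ptrace_fst_entry[of _ m r] mult_carrier_mat[of _ "m * r" "m * r"]
        tensor_one_mult_index[OF A Y] pair_index_less del: index_mult_mat(1))
qed (simp_all add: ptrace_fst_def)

text \<open>A change of basis on the traced-out factor is invisible in the reduced state. This
  removes the rotation to the eigenbasis when the output of the cooling unitary is computed.\<close>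

lemma ptrace_fst_unitary_conj:
  assumes U: "unitary_operator m U" and Y: "Y \<in> carrier_mat (m * r) (m * r)"
  defines "W \<equiv> U \<otimes>\<^sub>m 1\<^sub>m r"
  shows "ptrace_fst m r (W * Y * mat_adjoint W) = ptrace_fst m r Y"
proof -
  have Uc: "U \<in> carrier_mat m m" using U by simp
  have W: "unitary_operator (m * r) W" unfolding W_def by (rule unitary_tensor[OF U unitary_one])
  then have Wc: "W \<in> carrier_mat (m * r) (m * r)" by simp
  have "ptrace_fst m r (W * (Y * mat_adjoint W)) = ptrace_fst m r (Y * mat_adjoint W * W)"
    unfolding W_def by (rule ptrace_fst_cyclic[OF Uc]) (use Y Uc in \<open>simp add: mult_carrier_mat[of _ "m * r" "m * r"]\<close>)
  then show ?thesis
    using Wc Y by (simp add: assoc_mult_mat[of _ "m * r" "m * r" _ "m * r" _ "m * r"] unitary_simps[OF W])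
qed

lemma trace_mult_index:
  assumes "A \<in> carrier_mat n n" "B \<in> carrier_mat n n"
  shows "mat_trace (A * B) = (\<Sum>i<n. \<Sum>k<n. A $$ (i, k) * B $$ (k, i))"
  using assms by (simp add: mat_trace_def mult_index[of _ n n _ n] del: index_mult_mat(1))

lemma trace_tensor:
  assumes "A \<in> carrier_mat n n" "B \<in> carrier_mat m m"
  shows "mat_trace (A \<otimes>\<^sub>m B) = mat_trace A * mat_trace B"
proof -
  have "mat_trace (A \<otimes>\<^sub>m B) = (\<Sum>k<n * m. A $$ (k div m, k div m) * B $$ (k mod m, k mod m))"
    using assms by (simp add: mat_trace_def tensor_index[of _ n n _ m m])
  also have "\<dots> = (\<Sum>a<n. \<Sum>b<m. A $$ (a, a) * B $$ (b, b))"
    by (rule sum_div_mod[where f = "\<lambda>a b. A $$ (a, a) * B $$ (b, b)"])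
  finally show ?thesis using assms by (simp add: mat_trace_def sum_product)
qed

subsection \<open>From conversions to decision rules\<close>

text \<open>The partial trace over the second factor of \<open>Q\<close> times the identity tensored
  with \<sigma>, i.e. the Heisenberg dual of appending the state \<sigma>. It turns a joint effect
  into an effect on the first factor.\<close>

definition partial_effect :: "nat \<Rightarrow> nat \<Rightarrow> complex mat \<Rightarrow> complex mat \<Rightarrow> complex mat" where
  "partial_effect d r \<sigma> Q = mat d d (\<lambda>(a, b). \<Sum>x<r. \<Sum>y<r. Q $$ (a * r + x, b * r + y) * \<sigma> $$ (y, x))"

lemma partial_effect_carrier [simp]: "partial_effect d r \<sigma> Q \<in> carrier_mat d d"
  by (simp add: partial_effect_def)

lemma trace_partial_effect:
  assumes A: "A \<in> carrier_mat d d" and \<sigma>: "\<sigma> \<in> carrier_mat r r" and Q: "Q \<in> carrier_mat (d * r) (d * r)"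
  shows "mat_trace ((A \<otimes>\<^sub>m \<sigma>) * Q) = mat_trace (A * partial_effect d r \<sigma> Q)"
proof -
  define F where "F b y a x = A $$ (b, a) * \<sigma> $$ (y, x) * Q $$ (a * r + x, b * r + y)" for a b x y
  have "mat_trace ((A \<otimes>\<^sub>m \<sigma>) * Q) = (\<Sum>k<d * r. \<Sum>l<d * r. (A \<otimes>\<^sub>m \<sigma>) $$ (k, l) * Q $$ (l, k))"
    using A \<sigma> Q by (intro trace_mult_index) auto
  also have "\<dots> = (\<Sum>k<d * r. \<Sum>l<d * r. F (k div r) (k mod r) (l div r) (l mod r))"
    using A \<sigma> by (intro sum.cong refl) (simp add: tensor_index[of _ d d _ r r] F_def)
  also have "\<dots> = (\<Sum>b<d. \<Sum>y<r. \<Sum>a<d. \<Sum>x<r. F b y a x)"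
    by (simp only: sum_div_mod sum_div_mod[where f = "\<lambda>b y. \<Sum>a<d. \<Sum>x<r. F b y a x"])
  also have "\<dots> = (\<Sum>b<d. \<Sum>a<d. \<Sum>y<r. \<Sum>x<r. F b y a x)"
    by (rule sum.cong[OF refl], rule sum.swap)
  also have "\<dots> = (\<Sum>b<d. \<Sum>a<d. \<Sum>x<r. \<Sum>y<r. F b y a x)"
    by (rule sum.cong[OF refl], rule sum.cong[OF refl], rule sum.swap)
  also have "\<dots> = (\<Sum>b<d. \<Sum>a<d. A $$ (b, a) * partial_effect d r \<sigma> Q $$ (a, b))"
    by (intro sum.cong refl) (simp add: partial_effect_def F_def sum_distrib_left mult_ac)
  also have "\<dots> = mat_trace (A * partial_effect d r \<sigma> Q)"
    using A by (intro trace_mult_index[symmetric]) auto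
  finally show ?thesis .
qed

text \<open>Tracing out the second factor of the two equal products gives \<open>A\<close> times the
  reduced effect on one side and the reduced effect times \<open>A\<close> on the other.\<close>

lemma partial_effect_commute:
  assumes A: "A \<in> carrier_mat d d" and \<sigma>: "\<sigma> \<in> carrier_mat r r" and Q: "Q \<in> carrier_mat (d * r) (d * r)"
    and comm: "(A \<otimes>\<^sub>m \<sigma>) * Q = Q * (A \<otimes>\<^sub>m \<sigma>)"
  shows "A * partial_effect d r \<sigma> Q = partial_effect d r \<sigma> Q * A"
proof (rule eq_matI, goal_cases)
  case (1 a b)
  then have ab: "a < d" "b < d" using A by (auto simp: partial_effect_def)
  have T: "A \<otimes>\<^sub>m \<sigma> \<in> carrier_mat (d * r) (d * r)" using A \<sigma> by simp
  have left: "((A \<otimes>\<^sub>m \<sigma>) * Q) $$ (a * r + x, b * r + x)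
      = (\<Sum>c<d. \<Sum>z<r. A $$ (a, c) * \<sigma> $$ (x, z) * Q $$ (c * r + z, b * r + x))" if "x < r" for x
  proof -
    note px = pair_index_less[OF ab(1) that] pair_index_less[OF ab(2) that]
    have "((A \<otimes>\<^sub>m \<sigma>) * Q) $$ (a * r + x, b * r + x)
      = (\<Sum>k<d * r. A $$ (a, k div r) * \<sigma> $$ (x, k mod r) * Q $$ (k div r * r + k mod r, b * r + x))"
      unfolding mult_index[OF T Q px] using A \<sigma> px that
      by (intro sum.cong refl) (simp add: tensor_index[of _ d d _ r r])
    then show ?thesis
      unfolding sum_div_mod[where f = "\<lambda>c z. A $$ (a, c) * \<sigma> $$ (x, z) * Q $$ (c * r + z, b * r + x)"] .
  qed
  have right: "(Q * (A \<otimes>\<^sub>m \<sigma>)) $$ (a * r + x, b * r + x)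
      = (\<Sum>c<d. \<Sum>z<r. Q $$ (a * r + x, c * r + z) * (A $$ (c, b) * \<sigma> $$ (z, x)))" if "x < r" for x
  proof -
    note px = pair_index_less[OF ab(1) that] pair_index_less[OF ab(2) that]
    have "(Q * (A \<otimes>\<^sub>m \<sigma>)) $$ (a * r + x, b * r + x)
      = (\<Sum>k<d * r. Q $$ (a * r + x, k div r * r + k mod r) * (A $$ (k div r, b) * \<sigma> $$ (k mod r, x)))"
      unfolding mult_index[OF Q T px] using A \<sigma> px that
      by (intro sum.cong refl) (simp add: tensor_index[of _ d d _ r r])
    then show ?thesis
      unfolding sum_div_mod[where f = "\<lambda>c z. Q $$ (a * r + x, c * r + z) * (A $$ (c, b) * \<sigma> $$ (z, x))"] .
  qed
  have "(A * partial_effect d r \<sigma> Q) $$ (a, b)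
      = (\<Sum>c<d. A $$ (a, c) * (\<Sum>z<r. \<Sum>x<r. Q $$ (c * r + z, b * r + x) * \<sigma> $$ (x, z)))"
    using A ab by (subst mult_index[of _ d d _ d]) (auto simp: partial_effect_def)
  also have "\<dots> = (\<Sum>c<d. \<Sum>z<r. \<Sum>x<r. A $$ (a, c) * \<sigma> $$ (x, z) * Q $$ (c * r + z, b * r + x))"
    by (simp add: sum_distrib_left mult_ac)
  also have "\<dots> = (\<Sum>c<d. \<Sum>x<r. \<Sum>z<r. A $$ (a, c) * \<sigma> $$ (x, z) * Q $$ (c * r + z, b * r + x))"
    by (rule sum.cong[OF refl], rule sum.swap)
  also have "\<dots> = (\<Sum>x<r. \<Sum>c<d. \<Sum>z<r. A $$ (a, c) * \<sigma> $$ (x, z) * Q $$ (c * r + z, b * r + x))"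
    by (rule sum.swap)
  also have "\<dots> = (\<Sum>x<r. ((A \<otimes>\<^sub>m \<sigma>) * Q) $$ (a * r + x, b * r + x))"
    by (rule sum.cong[OF refl]) (simp only: left lessThan_iff)
  also have "\<dots> = (\<Sum>x<r. \<Sum>c<d. \<Sum>z<r. Q $$ (a * r + x, c * r + z) * (A $$ (c, b) * \<sigma> $$ (z, x)))"
    unfolding comm by (rule sum.cong[OF refl]) (simp only: right lessThan_iff)
  also have "\<dots> = (\<Sum>c<d. \<Sum>x<r. \<Sum>z<r. Q $$ (a * r + x, c * r + z) * (A $$ (c, b) * \<sigma> $$ (z, x)))"
    by (rule sum.swap)
  also have "\<dots> = (\<Sum>c<d. (\<Sum>x<r. \<Sum>z<r. Q $$ (a * r + x, c * r + z) * \<sigma> $$ (z, x)) * A $$ (c, b))"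
    by (simp add: sum_distrib_left mult_ac)
  also have "\<dots> = (partial_effect d r \<sigma> Q * A) $$ (a, b)"
    using A ab by (subst mult_index[of _ d d _ d]) (auto simp: partial_effect_def)
  finally show ?case .
qed (use A in \<open>auto simp: partial_effect_def\<close>)

text \<open>With \<open>\<sigma> = S * mat_adjoint S\<close>, the quadratic form at \<open>v\<close>
  is the sum, over the columns of \<open>S\<close>, of the forms of \<open>Q\<close> at
  \<open>v\<close> tensored with that column.\<close>

lemma partial_effect_positive:
  assumes \<sigma>: "positive_operator r \<sigma>" and Q: "positive_operator (d * r) Q"
  shows "positive_operator d (partial_effect d r \<sigma> Q)"
  unfolding positive_operator_def
proof (intro conjI ballI)
  fix v :: "complex vec" assume v: "v \<in> carrier_vec d"
  obtain S where S: "S \<in> carrier_mat r r" "\<sigma> = S * mat_adjoint S"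
    using positive_operator_factor[OF \<sigma>] by blast
  define t where "t m = vec (d * r) (\<lambda>k. v $ (k div r) * S $$ (k mod r, m))" for m
  define F where "F m a x b y = Q $$ (a * r + x, b * r + y) * (v $ b * S $$ (y, m)) * cnj (v $ a * S $$ (x, m))"
    for m a x b y
  have quad: "(Q *\<^sub>v t m) \<bullet>c t m = (\<Sum>a<d. \<Sum>x<r. \<Sum>b<d. \<Sum>y<r. F m a x b y)" for m
  proof -
    have "(Q *\<^sub>v t m) \<bullet>c t m = (\<Sum>k<d * r. \<Sum>l<d * r. Q $$ (k, l) * t m $ l * cnj (t m $ k))"
      using Q by (intro quadratic_form_index) (auto simp: t_def)
    also have "\<dots> = (\<Sum>k<d * r. \<Sum>l<d * r. F m (k div r) (k mod r) (l div r) (l mod r))"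
      by (intro sum.cong refl) (simp add: F_def t_def)
    finally show ?thesis
      by (simp only: sum_div_mod sum_div_mod[where f = "\<lambda>a x. \<Sum>b<d. \<Sum>y<r. F m a x b y"])
  qed
  have \<sigma>_index: "\<sigma> $$ (y, x) = (\<Sum>m<r. S $$ (y, m) * cnj (S $$ (x, m)))" if "x < r" "y < r" for x y
    using S that by (simp add: mult_index[of _ r r _ r] del: index_mult_mat(1))
  have "(partial_effect d r \<sigma> Q *\<^sub>v v) \<bullet>c v
      = (\<Sum>a<d. \<Sum>b<d. partial_effect d r \<sigma> Q $$ (a, b) * v $ b * cnj (v $ a))"
    by (rule quadratic_form_index[OF partial_effect_carrier v])
  also have "\<dots> = (\<Sum>a<d. \<Sum>b<d. \<Sum>x<r. \<Sum>y<r. \<Sum>m<r. F m a x b y)"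
    by (intro sum.cong refl)
      (simp add: partial_effect_def F_def \<sigma>_index sum_distrib_left sum_distrib_right mult_ac)
  also have "\<dots> = (\<Sum>a<d. \<Sum>x<r. \<Sum>b<d. \<Sum>y<r. \<Sum>m<r. F m a x b y)"
    by (rule sum.cong[OF refl], rule sum.swap)
  also have "\<dots> = (\<Sum>a<d. \<Sum>x<r. \<Sum>b<d. \<Sum>m<r. \<Sum>y<r. F m a x b y)"
    by (rule sum.cong[OF refl], rule sum.cong[OF refl], rule sum.cong[OF refl], rule sum.swap)
  also have "\<dots> = (\<Sum>a<d. \<Sum>x<r. \<Sum>m<r. \<Sum>b<d. \<Sum>y<r. F m a x b y)"
    by (rule sum.cong[OF refl], rule sum.cong[OF refl], rule sum.swap)
  also have "\<dots> = (\<Sum>a<d. \<Sum>m<r. \<Sum>x<r. \<Sum>b<d. \<Sum>y<r. F m a x b y)"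
    by (rule sum.cong[OF refl], rule sum.swap)
  also have "\<dots> = (\<Sum>m<r. \<Sum>a<d. \<Sum>x<r. \<Sum>b<d. \<Sum>y<r. F m a x b y)"
    by (rule sum.swap)
  also have "\<dots> = (\<Sum>m<r. (Q *\<^sub>v t m) \<bullet>c t m)" by (simp only: quad)
  also have "0 \<le> \<dots>"
    using Q by (intro sum_nonneg) (auto simp: positive_operator_def t_def)
  finally show "0 \<le> (partial_effect d r \<sigma> Q *\<^sub>v v) \<bullet>c v" .
qed simp

text \<open>Reducing the identity leaves the trace of \<sigma>, which is 1 for a state, so
  complementary joint effects reduce to a decision rule.\<close>

lemma partial_effect_complement:
  assumes \<sigma>: "\<sigma> \<in> carrier_mat r r" and Q: "Q \<in> carrier_mat (d * r) (d * r)" "R \<in> carrier_mat (d * r) (d * r)"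
    and sum: "Q + R = 1\<^sub>m (d * r)"
  shows "partial_effect d r \<sigma> Q + partial_effect d r \<sigma> R = mat_trace \<sigma> \<cdot>\<^sub>m 1\<^sub>m d"
proof (rule eq_matI, goal_cases)
  case (1 a b)
  then have ab: "a < d" "b < d" by auto
  have *: "Q $$ (a * r + x, b * r + y) + R $$ (a * r + x, b * r + y) = (if a = b \<and> x = y then 1 else 0)"
    if "x < r" "y < r" for x y
  proof -
    note px = pair_index_less[OF ab(1) that(1)] pair_index_less[OF ab(2) that(2)]
    have "a * r + x = b * r + y \<longleftrightarrow> a = b \<and> x = y"
    proof
      assume eq: "a * r + x = b * r + y"
      from arg_cong[OF eq, of "\<lambda>k. k div r"] arg_cong[OF eq, of "\<lambda>k. k mod r"] that
      show "a = b \<and> x = y" by simp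
    qed simp
    moreover have "Q $$ (a * r + x, b * r + y) + R $$ (a * r + x, b * r + y) = (Q + R) $$ (a * r + x, b * r + y)"
      using Q px by simp
    ultimately show ?thesis using px by (simp add: sum)
  qed
  have "(partial_effect d r \<sigma> Q + partial_effect d r \<sigma> R) $$ (a, b)
      = (\<Sum>x<r. \<Sum>y<r. (Q $$ (a * r + x, b * r + y) + R $$ (a * r + x, b * r + y)) * \<sigma> $$ (y, x))"
    using ab by (simp add: partial_effect_def sum.distrib distrib_right)
  also have "\<dots> = (\<Sum>x<r. \<Sum>y<r. if y = x then (if a = b then \<sigma> $$ (x, x) else 0) else 0)"
    by (intro sum.cong refl) (simp add: *)
  also have "\<dots> = (mat_trace \<sigma> \<cdot>\<^sub>m 1\<^sub>m d) $$ (a, b)"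
    using \<sigma> ab by (simp add: mat_trace_def)
  finally show ?case .
qed (simp_all add: partial_effect_def)

text \<open>The target bit is the parity of the Kronecker index, so this is the identity tensored
  with the projection onto target level \<open>j\<close>.\<close>

definition target_projection :: "nat \<Rightarrow> nat \<Rightarrow> complex mat" where
  "target_projection m j = mat_diag (m * 2) (\<lambda>k. if k mod 2 = j then 1 else 0)"

lemma target_projection_carrier [simp]: "target_projection m j \<in> carrier_mat (m * 2) (m * 2)"
  by (simp add: target_projection_def)

lemma target_projection_positive: "positive_operator (m * 2) (target_projection m j)"
  unfolding target_projection_def by (rule positive_operator_diag) (simp add: less_eq_complex_def)

lemma target_projection_complement: "target_projection m 0 + target_projection m 1 = 1\<^sub>m (m * 2)"
  by (rule eq_matI) (auto simp: target_projection_def mat_diag_def)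

lemma trace_target_projection:
  assumes Y: "Y \<in> carrier_mat (m * 2) (m * 2)" and j: "j < 2"
  shows "mat_trace (Y * target_projection m j) = ptrace_fst m 2 Y $$ (j, j)"
proof -
  have "mat_trace (Y * target_projection m j) = (\<Sum>k<m * 2. Y $$ (k, k) * (if k mod 2 = j then 1 else 0))"
    unfolding target_projection_def mat_diag_mult_right[OF Y] mat_trace_def using Y by simp
  also have "\<dots> = (\<Sum>k<m * 2. Y $$ (k div 2 * 2 + k mod 2, k div 2 * 2 + k mod 2) * (if k mod 2 = j then 1 else 0))"
    by simp
  also have "\<dots> = (\<Sum>a<m. \<Sum>b<2. Y $$ (a * 2 + b, a * 2 + b) * (if b = j then 1 else 0))"
    by (rule sum_div_mod[where f = "\<lambda>a b. Y $$ (a * 2 + b, a * 2 + b) * (if b = j then 1 else 0)"])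
  also have "\<dots> = (\<Sum>a<m. Y $$ (a * 2 + j, a * 2 + j))"
    using j by (simp add: if_distrib cong: if_cong)
  finally show ?thesis using Y j by (simp add: ptrace_fst_entry)
qed

text \<open>Both operators are diagonal on the target factor; this is where diagonality of the
  equilibrium state of the target enters.\<close>

lemma target_projection_commute:
  assumes A: "A \<in> carrier_mat m m"
  shows "(A \<otimes>\<^sub>m mat_diag 2 h) * target_projection m j = target_projection m j * (A \<otimes>\<^sub>m mat_diag 2 h)"
proof (rule eq_matI, goal_cases)
  have T: "A \<otimes>\<^sub>m mat_diag 2 h \<in> carrier_mat (m * 2) (m * 2)" using A by simp
  case (1 k l)
  then have kl: "k < m * 2" "l < m * 2" using A by (auto simp: target_projection_def mat_diag_def)
  then show ?case
    unfolding target_projection_def mat_diag_mult_right[OF T] mat_diag_mult_left[OF T]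
    using A by (simp add: tensor_index[of _ m m _ 2 2] mat_diag_def)
qed (use A in \<open>auto simp: target_projection_def mat_diag_def\<close>)

lemma smult_one: "1 \<cdot>\<^sub>m A = (A :: complex mat)"
  by (rule eq_matI) auto

text \<open>Heisenberg picture: \<open>E j\<close> is \<open>mat_adjoint u * P j * u\<close>
  averaged over bath and target in equilibrium. Commutation with the joint equilibrium state holds
  for \<open>u\<close> and \<open>P j\<close>, hence for the pulled-back effect, and passes to its
  reduction.\<close>

lemma conversion_decision_rule:
  assumes \<gamma>: "\<gamma> \<in> carrier_mat d d" and \<rho>: "\<rho> \<in> carrier_mat d d"
    and g: "density_matrix e g" and h: "density_matrix 2 (mat_diag 2 h)"
    and u: "unitary_operator (d * e * 2) u"
    and comm: "u * (\<gamma> \<otimes>\<^sub>m g \<otimes>\<^sub>m mat_diag 2 h) = (\<gamma> \<otimes>\<^sub>m g \<otimes>\<^sub>m mat_diag 2 h) * u"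
  shows "\<exists>E0 E1. decision_rule d E0 E1 \<and> E1 * \<gamma> = \<gamma> * E1 \<and> mat_trace (\<gamma> * E1) = mat_trace \<gamma> * h 1 \<and>
    mat_trace (\<rho> * E1)
      = ptrace_fst (d * e) 2 (u * (\<rho> \<otimes>\<^sub>m g \<otimes>\<^sub>m mat_diag 2 h) * mat_adjoint u) $$ (1, 1)"
proof -
  define N where "N = d * e * 2"
  define \<sigma> where "\<sigma> = g \<otimes>\<^sub>m mat_diag 2 h"
  have gc: "g \<in> carrier_mat e e" and g_pos: "positive_operator e g" "positive_operator 2 (mat_diag 2 h)"
    using g h by (auto simp: density_matrix_def)
  have N: "N = d * (e * 2)" by (simp add: N_def)
  have \<sigma>: "positive_operator (e * 2) \<sigma>" unfolding \<sigma>_def by (intro positive_operator_tensor g_pos)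
  then have \<sigma>c: "\<sigma> \<in> carrier_mat (e * 2) (e * 2)" by simp
  have \<sigma>_trace: "mat_trace \<sigma> = 1"
    using g h gc by (simp add: \<sigma>_def trace_tensor[of _ e _ 2] density_matrix_def)
  have uc: "u \<in> carrier_mat N N" "mat_adjoint u \<in> carrier_mat N N" using u by (auto simp: N_def)
  note u' = u[folded N_def]
  note simps = assoc_mult_mat[of _ N N _ N _ N] mult_carrier_mat[of _ N N]
    unitary_cancel[OF u', of _ N] unitary_simps[OF u']
  define P where "P j = target_projection (d * e) j" for j
  have Pc: "P j \<in> carrier_mat N N" for j by (simp add: P_def N_def)
  define Q where "Q j = mat_adjoint u * P j * u" for j
  have Qc: "Q j \<in> carrier_mat N N" for j using uc Pc by (simp add: Q_def simps)
  have Q_pos: "positive_operator (d * (e * 2)) (Q j)" for j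
    using positive_operator_conj[OF target_projection_positive, of u "d * e" j] uc(1)
    by (simp add: Q_def P_def N_def mult.assoc)
  have "Q 0 + Q 1 = mat_adjoint u * (P 0 + P 1) * u"
    using uc Pc by (simp add: Q_def mult_add_distrib_mat[of _ N N _ N] add_mult_distrib_mat[of _ N N _ _ N] simps)
  also have "P 0 + P 1 = 1\<^sub>m N" by (simp only: P_def N_def target_projection_complement)
  finally have Q_sum: "Q 0 + Q 1 = 1\<^sub>m (d * (e * 2))" using uc by (simp add: simps flip: N)
  define E where "E j = partial_effect d (e * 2) \<sigma> (Q j)" for j
  have rule: "decision_rule d (E 0) (E 1)"
    using partial_effect_positive[OF \<sigma> Q_pos]
      partial_effect_complement[OF \<sigma>c Qc[unfolded N] Qc[unfolded N] Q_sum]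
    by (simp add: decision_rule_def E_def \<sigma>_trace smult_one)
  define \<Gamma> where "\<Gamma> = \<gamma> \<otimes>\<^sub>m \<sigma>"
  have assoc: "A \<otimes>\<^sub>m g \<otimes>\<^sub>m mat_diag 2 h = A \<otimes>\<^sub>m \<sigma>" if "A \<in> carrier_mat d d" for A
    unfolding \<sigma>_def by (rule tensor_assoc[OF that gc mat_diag_dim])
  have Tc: "A \<otimes>\<^sub>m \<sigma> \<in> carrier_mat N N" if "A \<in> carrier_mat d d" for A
    unfolding N using that \<sigma>c by simp
  \<comment> \<open>Duality and cyclicity of the trace move the evolution from the effect back to
    the state.\<close>
  have trace: "mat_trace (A * E j) = ptrace_fst (d * e) 2 (u * (A \<otimes>\<^sub>m \<sigma>) * mat_adjoint u) $$ (j, j)"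
    if A: "A \<in> carrier_mat d d" and "j < 2" for A j
  proof -
    note AT = Tc[OF A]
    have "mat_trace (A * E j) = mat_trace ((A \<otimes>\<^sub>m \<sigma>) * Q j)"
      unfolding E_def by (rule trace_partial_effect[symmetric, OF A \<sigma>c Qc[unfolded N]])
    also have "\<dots> = mat_trace (((A \<otimes>\<^sub>m \<sigma>) * mat_adjoint u * P j) * u)"
      using uc Pc AT by (simp add: Q_def simps)
    also have "\<dots> = mat_trace (u * ((A \<otimes>\<^sub>m \<sigma>) * mat_adjoint u * P j))"
      using uc Pc AT by (intro trace_mult_comm[of _ N N]) (simp_all add: simps)
    also have "\<dots> = mat_trace (u * (A \<otimes>\<^sub>m \<sigma>) * mat_adjoint u * P j)"
      using uc Pc AT by (simp add: simps)
    also have "\<dots> = ptrace_fst (d * e) 2 (u * (A \<otimes>\<^sub>m \<sigma>) * mat_adjoint u) $$ (j, j)"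
      unfolding P_def using uc AT that by (intro trace_target_projection) (simp_all add: simps flip: N_def)
    finally show ?thesis .
  qed
  have \<Gamma>c: "\<Gamma> \<in> carrier_mat N N" unfolding \<Gamma>_def by (rule Tc[OF \<gamma>])
  have u\<Gamma>: "u * \<Gamma> = \<Gamma> * u" using comm unfolding assoc[OF \<gamma>] \<Gamma>_def .
  have \<Gamma>u: "\<Gamma> * mat_adjoint u = mat_adjoint u * \<Gamma>"
  proof -
    have "\<Gamma> * mat_adjoint u = mat_adjoint u * (u * \<Gamma>) * mat_adjoint u" using uc \<Gamma>c by (simp add: simps)
    also have "\<dots> = mat_adjoint u * \<Gamma>" unfolding u\<Gamma> using uc \<Gamma>c by (simp add: simps)
    finally show ?thesis .
  qed
  have \<Gamma>P: "\<Gamma> * P j = P j * \<Gamma>" for j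
    using target_projection_commute[of "\<gamma> \<otimes>\<^sub>m g" "d * e" h j] \<gamma> gc
    unfolding \<Gamma>_def P_def assoc[OF \<gamma>, symmetric] by simp
  have "\<Gamma> * Q j = Q j * \<Gamma>" for j
  proof -
    have "\<Gamma> * Q j = \<Gamma> * mat_adjoint u * (P j * u)" using uc Pc \<Gamma>c by (simp add: Q_def simps)
    also have "\<dots> = mat_adjoint u * (\<Gamma> * P j * u)" unfolding \<Gamma>u using uc Pc \<Gamma>c by (simp add: simps)
    also have "\<dots> = mat_adjoint u * (P j * (\<Gamma> * u))" unfolding \<Gamma>P using uc Pc \<Gamma>c by (simp add: simps)
    also have "\<dots> = Q j * \<Gamma>" unfolding u\<Gamma>[symmetric] using uc Pc \<Gamma>c by (simp add: Q_def simps)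
    finally show ?thesis .
  qed
  from partial_effect_commute[OF \<gamma> \<sigma>c Qc[unfolded N] this[unfolded \<Gamma>_def]]
  have commE: "E 1 * \<gamma> = \<gamma> * E 1" by (simp add: E_def)
  \<comment> \<open>The evolution fixes the joint equilibrium state, so the equilibrium expectation
    of \<open>E 1\<close> is the initial excited population of the target.\<close>
  have "u * \<Gamma> * mat_adjoint u = \<Gamma>"
    unfolding u\<Gamma> using uc \<Gamma>c by (simp add: simps)
  then have "u * (\<gamma> \<otimes>\<^sub>m \<sigma>) * mat_adjoint u = (\<gamma> \<otimes>\<^sub>m g) \<otimes>\<^sub>m mat_diag 2 h"
    unfolding \<Gamma>_def assoc[OF \<gamma>] .
  then have "mat_trace (\<gamma> * E 1) = (mat_trace (\<gamma> \<otimes>\<^sub>m g) \<cdot>\<^sub>m mat_diag 2 h) $$ (1, 1)"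
    using trace[OF \<gamma>, of 1] ptrace_fst_tensor_mat[OF tensor_carrier[OF \<gamma> gc] mat_diag_dim] by simp
  also have "\<dots> = mat_trace \<gamma> * h 1"
    using trace_tensor[OF \<gamma> gc] g by (simp add: density_matrix_def mat_diag_def)
  finally show ?thesis
    using rule commE trace[OF \<rho>, of 1] assoc[OF \<rho>] by (intro exI[of _ "E 0"] exI[of _ "E 1"]) simp
qed

section \<open>Compactness of the set of decision rules\<close>

text \<open>Diagonal entries lie between 0 and 1 because the two positive operators sum to the
  identity. The form at \<open>c = 1\<close>, -1, \<i> and -\<i> then bounds the real and the
  imaginary part of an off-diagonal entry by 1 each.\<close>

lemma decision_rule_entry_bound:
  assumes "decision_rule d E0 E1" and ij: "i < d" "j < d"
  shows "cmod (E1 $$ (i, j)) \<le> 2"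
proof -
  have E0: "positive_operator d E0" and E1: "positive_operator d E1" and sum: "E0 + E1 = 1\<^sub>m d"
    using assms(1) by (auto simp: decision_rule_def)
  have c: "E0 \<in> carrier_mat d d" "E1 \<in> carrier_mat d d" using E0 E1 by auto
  have diag: "0 \<le> Re (E1 $$ (k, k))" "Re (E1 $$ (k, k)) \<le> 1" "Im (E1 $$ (k, k)) = 0" if "k < d" for k
  proof -
    have "E0 $$ (k, k) + E1 $$ (k, k) = 1" using arg_cong[OF sum, of "\<lambda>X. X $$ (k, k)"] c that by simp
    then have "Re (E0 $$ (k, k)) + Re (E1 $$ (k, k)) = 1" by (simp add: complex_eq_iff)
    then show "0 \<le> Re (E1 $$ (k, k))" "Re (E1 $$ (k, k)) \<le> 1" "Im (E1 $$ (k, k)) = 0"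
      using positive_operator_diag_entry[OF E0 that] positive_operator_diag_entry[OF E1 that]
      by (auto simp: less_eq_complex_def)
  qed
  show ?thesis
  proof (cases "i = j")
    case True
    then have "cmod (E1 $$ (i, j)) = \<bar>Re (E1 $$ (i, i))\<bar>" using diag(3)[OF ij(1)] by (simp add: cmod_def)
    then show ?thesis using diag[OF ij(1)] by simp
  next
    case False
    have herm: "E1 $$ (j, i) = cnj (E1 $$ (i, j))"
      using positive_operator_hermitian[OF E1] adjoint_index[of j E1 i] c ij by auto
    have "\<bar>Re (E1 $$ (i, j))\<bar> \<le> 1" "\<bar>Im (E1 $$ (i, j))\<bar> \<le> 1"
      using positive_operator_two_entries[OF E1 ij False, of 1] positive_operator_two_entries[OF E1 ij False, of "-1"]
        positive_operator_two_entries[OF E1 ij False, of \<i>] positive_operator_two_entries[OF E1 ij False, of "-\<i>"]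
        diag[OF ij(1)] diag[OF ij(2)]
      by (auto simp: herm less_eq_complex_def)
    then show ?thesis using cmod_le[of "E1 $$ (i, j)"] by linarith
  qed
qed

text \<open>Induction on the family: each step refines the current subsequence by
  Bolzano-Weierstrass, which preserves the limits found before.\<close>

lemma finite_family_convergent_subseq:
  fixes s :: "'i \<Rightarrow> nat \<Rightarrow> complex"
  assumes "finite I" "\<And>i n. i \<in> I \<Longrightarrow> cmod (s i n) \<le> C"
  shows "\<exists>f. strict_mono f \<and> (\<forall>i\<in>I. \<exists>l. (\<lambda>n. s i (f n)) \<longlonglongrightarrow> l)"
  using assms
proof (induction I)
  case empty
  show ?case using strict_mono_id by auto
next
  case (insert j I)
  then obtain f where f: "strict_mono f" "\<And>i. i \<in> I \<Longrightarrow> \<exists>l. (\<lambda>n. s i (f n)) \<longlonglongrightarrow> l" by auto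
  obtain h z where h: "strict_mono (h :: nat \<Rightarrow> nat)"
    "\<forall>e>0. \<exists>N. \<forall>n\<ge>N. cmod (s j (f (h n)) - z) < e"
    using Bolzano_Weierstrass_complex_disc[of "\<lambda>n. s j (f n)" C] insert.prems by auto
  have "(\<lambda>n. s j (f (h n))) \<longlonglongrightarrow> z" using h(2) by (simp add: LIMSEQ_iff)
  moreover have "\<exists>l. (\<lambda>n. s i (f (h n))) \<longlonglongrightarrow> l" if "i \<in> I" for i
    using f(2)[OF that] LIMSEQ_subseq_LIMSEQ[OF _ h(1)] by (fastforce simp: comp_def)
  ultimately show ?case
    using strict_mono_o[OF f(1) h(1)] unfolding o_def by (intro exI[of _ "\<lambda>n. f (h n)"]) auto
qed

lemma nonneg_complex_limit:
  fixes z :: "nat \<Rightarrow> complex"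
  assumes "z \<longlonglongrightarrow> l" "\<And>n. 0 \<le> z n"
  shows "0 \<le> l"
proof -
  have "(\<lambda>n. Im (z n)) \<longlonglongrightarrow> Im l" "(\<lambda>n. Re (z n)) \<longlonglongrightarrow> Re l"
    using assms(1) by (auto intro: tendsto_intros)
  moreover have "(\<lambda>n. Im (z n)) = (\<lambda>_. 0)" "\<And>n. 0 \<le> Re (z n)"
    using assms(2) by (auto simp: less_eq_complex_def)
  ultimately show ?thesis
    by (auto simp: less_eq_complex_def LIMSEQ_const_iff intro: LIMSEQ_le_const)
qed

lemma positive_operator_limit:
  assumes "\<And>n. positive_operator d (A n)" "L \<in> carrier_mat d d" "mat_tendsto d A L"
  shows "positive_operator d L"
  unfolding positive_operator_def
proof (intro conjI ballI)
  fix v :: "complex vec" assume v: "v \<in> carrier_vec d"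
  have Ac: "A n \<in> carrier_mat d d" for n using assms(1) by simp
  have "(\<lambda>n. \<Sum>i<d. \<Sum>j<d. A n $$ (i, j) * v $ j * cnj (v $ i))
      \<longlonglongrightarrow> (\<Sum>i<d. \<Sum>j<d. L $$ (i, j) * v $ j * cnj (v $ i))"
    using assms(3) by (intro tendsto_sum tendsto_mult tendsto_const) (auto simp: mat_tendsto_def)
  then have "(\<lambda>n. (A n *\<^sub>v v) \<bullet>c v) \<longlonglongrightarrow> (L *\<^sub>v v) \<bullet>c v"
    unfolding quadratic_form_index[OF assms(2) v] quadratic_form_index[OF Ac v] .
  then show "0 \<le> (L *\<^sub>v v) \<bullet>c v"
    by (rule nonneg_complex_limit) (use assms(1) v in \<open>auto simp: positive_operator_def\<close>)
qed (fact assms(2))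

lemma mat_tendsto_mult:
  assumes "mat_tendsto d A L" "mat_tendsto d B M" "\<And>n. A n \<in> carrier_mat d d" "\<And>n. B n \<in> carrier_mat d d"
    and "L \<in> carrier_mat d d" "M \<in> carrier_mat d d"
  shows "mat_tendsto d (\<lambda>n. A n * B n) (L * M)"
  unfolding mat_tendsto_def
proof (intro allI impI)
  fix i j assume ij: "i < d" "j < d"
  show "(\<lambda>n. (A n * B n) $$ (i, j)) \<longlonglongrightarrow> (L * M) $$ (i, j)"
    unfolding mult_index[OF assms(3,4) ij] mult_index[OF assms(5,6) ij]
    using assms(1,2) ij by (intro tendsto_sum tendsto_mult) (auto simp: mat_tendsto_def)
qed

lemma mat_tendsto_const: "mat_tendsto d (\<lambda>_. A) A"
  by (simp add: mat_tendsto_def)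

lemma mat_tendsto_unique:
  assumes "mat_tendsto d A L" "mat_tendsto d A M" "L \<in> carrier_mat d d" "M \<in> carrier_mat d d"
  shows "L = M"
proof (rule eq_matI)
  fix i j assume "i < dim_row M" "j < dim_col M"
  then have "i < d" "j < d" using assms(4) by auto
  then show "L $$ (i, j) = M $$ (i, j)"
    using assms(1,2) LIMSEQ_unique[of "\<lambda>n. A n $$ (i, j)"] by (simp add: mat_tendsto_def)
qed (use assms(3,4) in auto)

lemma mat_tendsto_trace:
  assumes "mat_tendsto d A L" "\<And>n. A n \<in> carrier_mat d d" "L \<in> carrier_mat d d"
  shows "(\<lambda>n. mat_trace (A n)) \<longlonglongrightarrow> mat_trace L"
proof -
  have "(\<lambda>n. \<Sum>i<d. A n $$ (i, i)) \<longlonglongrightarrow> (\<Sum>i<d. L $$ (i, i))"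
    using assms(1) by (intro tendsto_sum) (auto simp: mat_tendsto_def)
  moreover have "dim_row (A n) = d" "dim_row L = d" for n using assms(2)[of n] assms(3) by auto
  ultimately show ?thesis by (simp add: mat_trace_def)
qed

text \<open>A subsequence is extracted for the second operators; the first ones are their
  complements and converge along with them. Positivity survives entrywise limits.\<close>

lemma decision_rule_limit:
  fixes E0 E1 :: "nat \<Rightarrow> complex mat"
  assumes rule: "\<And>n. decision_rule d (E0 n) (E1 n)"
  shows "\<exists>f F0 F1. strict_mono f \<and> decision_rule d F0 F1 \<and> mat_tendsto d (\<lambda>n. E1 (f n)) F1"
proof -
  have c: "E0 n \<in> carrier_mat d d" "E1 n \<in> carrier_mat d d" for n
    using rule[of n] by (auto simp: decision_rule_def)
  have "\<exists>f. strict_mono f \<and> (\<forall>x\<in>{..<d} \<times> {..<d}. \<exists>l. (\<lambda>n. E1 (f n) $$ x) \<longlonglongrightarrow> l)"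
    using decision_rule_entry_bound[OF rule]
      finite_family_convergent_subseq[of "{..<d} \<times> {..<d}" "\<lambda>x n. E1 n $$ x" 2] by auto
  then obtain f where f: "strict_mono f"
    and "\<And>x. x \<in> {..<d} \<times> {..<d} \<Longrightarrow> \<exists>l. (\<lambda>n. E1 (f n) $$ x) \<longlonglongrightarrow> l" by auto
  then obtain l where l: "\<And>i j. i < d \<Longrightarrow> j < d \<Longrightarrow> (\<lambda>n. E1 (f n) $$ (i, j)) \<longlonglongrightarrow> l (i, j)"
    by (metis SigmaI lessThan_iff)
  define F1 where "F1 = mat d d l"
  define F0 where "F0 = 1\<^sub>m d - F1"
  have F: "F1 \<in> carrier_mat d d" "F0 \<in> carrier_mat d d" by (auto simp: F0_def F1_def)
  have lim1: "mat_tendsto d (\<lambda>n. E1 (f n)) F1"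
    using l by (simp add: mat_tendsto_def F1_def)
  have E0: "E0 n $$ (i, j) = 1\<^sub>m d $$ (i, j) - E1 n $$ (i, j)" if "i < d" "j < d" for n i j
  proof -
    have "E0 n $$ (i, j) + E1 n $$ (i, j) = (E0 n + E1 n) $$ (i, j)" using c[of n] that by simp
    also have "\<dots> = 1\<^sub>m d $$ (i, j)" using rule[of n] by (simp add: decision_rule_def)
    finally show ?thesis by (simp add: algebra_simps)
  qed
  have lim0: "mat_tendsto d (\<lambda>n. E0 (f n)) F0"
    unfolding mat_tendsto_def
  proof (intro allI impI)
    fix i j assume ij: "i < d" "j < d"
    have "(\<lambda>n. 1\<^sub>m d $$ (i, j) - E1 (f n) $$ (i, j)) \<longlonglongrightarrow> 1\<^sub>m d $$ (i, j) - l (i, j)"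
      using l[OF ij] by (intro tendsto_diff tendsto_const)
    then show "(\<lambda>n. E0 (f n) $$ (i, j)) \<longlonglongrightarrow> F0 $$ (i, j)"
      unfolding E0[OF ij] using ij by (simp add: F0_def F1_def)
  qed
  have "positive_operator d F0" "positive_operator d F1"
    using positive_operator_limit[OF _ F(2) lim0] positive_operator_limit[OF _ F(1) lim1] rule
    by (auto simp: decision_rule_def)
  moreover have "F0 + F1 = 1\<^sub>m d" by (rule eq_matI) (auto simp: F0_def F1_def)
  ultimately show ?thesis using f lim1 unfolding decision_rule_def by blast
qed

text \<open>All effects act on the input space, although the bath dimension varies with
  \<open>n\<close>, so compactness applies. Their equilibrium expectation is constant, whereas their
  expectation in the input state tends to the excited entry of the target.\<close>

lemma converts_imp_decision_rule:
  assumes \<gamma>: "\<gamma> \<in> carrier_mat d d" and \<rho>: "\<rho> \<in> carrier_mat d d"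
    and h: "density_matrix 2 (mat_diag 2 h)"
    and conv: "converts d (\<rho>, \<gamma>) 2 (\<rho>', mat_diag 2 h)"
  shows "\<exists>E0 E1. decision_rule d E0 E1 \<and> E1 * \<gamma> = \<gamma> * E1
    \<and> mat_trace (\<gamma> * E1) = mat_trace \<gamma> * h 1 \<and> mat_trace (\<rho> * E1) = \<rho>' $$ (1, 1)"
proof -
  obtain e g u where g: "\<And>n. full_rank_density_matrix (e n) (g n)"
    and u: "\<And>n. unitary_operator (d * e n * 2) (u n)"
    and comm: "\<And>n. u n * (\<gamma> \<otimes>\<^sub>m g n \<otimes>\<^sub>m mat_diag 2 h) = (\<gamma> \<otimes>\<^sub>m g n \<otimes>\<^sub>m mat_diag 2 h) * u n"
    and lim: "mat_tendsto 2 (\<lambda>n. ptrace_fst (d * e n) 2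
          (u n * (\<rho> \<otimes>\<^sub>m g n \<otimes>\<^sub>m mat_diag 2 h) * mat_adjoint (u n))) \<rho>'"
    using conv unfolding converts_def Let_def by auto
  define out where "out n = ptrace_fst (d * e n) 2
          (u n * (\<rho> \<otimes>\<^sub>m g n \<otimes>\<^sub>m mat_diag 2 h) * mat_adjoint (u n)) $$ (1, 1)" for n
  have "\<forall>n. \<exists>E. decision_rule d (fst E) (snd E) \<and> snd E * \<gamma> = \<gamma> * snd E
      \<and> mat_trace (\<gamma> * snd E) = mat_trace \<gamma> * h 1 \<and> mat_trace (\<rho> * snd E) = out n"
    using conversion_decision_rule[OF \<gamma> \<rho> _ h u comm] g
    unfolding out_def full_rank_density_matrix_def by fastforce
  from choice[OF this] obtain E where E: "\<And>n. decision_rule d (fst (E n)) (snd (E n))"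
    "\<And>n. snd (E n) * \<gamma> = \<gamma> * snd (E n)" "\<And>n. mat_trace (\<gamma> * snd (E n)) = mat_trace \<gamma> * h 1"
    "\<And>n. mat_trace (\<rho> * snd (E n)) = out n" by auto
  from decision_rule_limit[of d "\<lambda>n. fst (E n)" "\<lambda>n. snd (E n)", OF E(1)]
  obtain f F0 F1 where f: "strict_mono f" and F: "decision_rule d F0 F1"
    and F1_lim: "mat_tendsto d (\<lambda>n. snd (E (f n))) F1" by blast
  have c: "F1 \<in> carrier_mat d d" "snd (E n) \<in> carrier_mat d d" for n
    using F E(1)[of n] by (auto simp: decision_rule_def)
  have left: "mat_tendsto d (\<lambda>n. A * snd (E (f n))) (A * F1)"
    and right: "mat_tendsto d (\<lambda>n. snd (E (f n)) * A) (F1 * A)" if "A \<in> carrier_mat d d" for A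
    using that c by (intro mat_tendsto_mult mat_tendsto_const F1_lim; simp)+
  have "F1 * \<gamma> = \<gamma> * F1"
    using left[OF \<gamma>] right[OF \<gamma>] \<gamma> c unfolding E(2)
    by (intro mat_tendsto_unique[of d "\<lambda>n. \<gamma> * snd (E (f n))"]) (simp_all add: mult_carrier_mat[of _ d d])
  moreover have trace: "(\<lambda>n. mat_trace (A * snd (E (f n)))) \<longlonglongrightarrow> mat_trace (A * F1)"
    if "A \<in> carrier_mat d d" for A
    using that c by (intro mat_tendsto_trace[OF left[OF that]]) (simp_all add: mult_carrier_mat[of _ d d])
  have "mat_trace (\<gamma> * F1) = mat_trace \<gamma> * h 1"
    using trace[OF \<gamma>] unfolding E(3) by (simp add: LIMSEQ_const_iff)
  moreover have "mat_trace (\<rho> * F1) = \<rho>' $$ (1, 1)"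
  proof (rule LIMSEQ_unique)
    show "(\<lambda>n. out (f n)) \<longlonglongrightarrow> mat_trace (\<rho> * F1)" using trace[OF \<rho>] unfolding E(4) .
    have "out \<longlonglongrightarrow> \<rho>' $$ (1, 1)" using lim by (simp add: mat_tendsto_def out_def[abs_def])
    then show "(\<lambda>n. out (f n)) \<longlonglongrightarrow> \<rho>' $$ (1, 1)"
      using LIMSEQ_subseq_LIMSEQ[OF _ f] by (auto simp: comp_def)
  qed
  ultimately show ?thesis using F by blast
qed

subsection \<open>From decision rules to conversions\<close>

definition perm_mat :: "nat \<Rightarrow> (nat \<Rightarrow> nat) \<Rightarrow> complex mat" where
  "perm_mat N \<sigma> = mat N N (\<lambda>(x, y). if x = \<sigma> y then 1 else 0)"

lemma perm_mat_carrier [simp]: "perm_mat N \<sigma> \<in> carrier_mat N N"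
  by (simp add: perm_mat_def)

lemma perm_mat_unitary:
  assumes "bij_betw \<sigma> {..<N} {..<N}"
  shows "unitary_operator N (perm_mat N \<sigma>)"
proof (rule unitary_operatorI')
  show "mat_adjoint (perm_mat N \<sigma>) * perm_mat N \<sigma> = 1\<^sub>m N"
  proof (rule eq_matI, goal_cases)
    case (1 i j)
    then have ij: "i < N" "j < N" by auto
    have \<sigma>: "\<sigma> i < N" "\<sigma> i = \<sigma> j \<longleftrightarrow> i = j"
      using assms ij by (auto simp: bij_betw_def inj_on_def)
    have "(mat_adjoint (perm_mat N \<sigma>) * perm_mat N \<sigma>) $$ (i, j)
        = (\<Sum>k<N. if k = \<sigma> i then if k = \<sigma> j then 1 else 0 else 0)"
      unfolding mult_index[OF adjoint_carrier[OF perm_mat_carrier] perm_mat_carrier ij]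
      using ij by (intro sum.cong refl) (auto simp: perm_mat_def)
    also have "\<dots> = 1\<^sub>m N $$ (i, j)" using \<sigma> ij by simp
    finally show ?case .
  qed (simp_all add: perm_mat_def)
qed simp

text \<open>Evaluated at images of indices, which avoids the inverse permutation.\<close>

lemma perm_mat_conj_index:
  assumes \<sigma>: "\<sigma> ` {..<N} \<subseteq> {..<N}" "inj_on \<sigma> {..<N}" and R: "R \<in> carrier_mat N N" and y: "y < N" "y' < N"
  shows "(perm_mat N \<sigma> * R * mat_adjoint (perm_mat N \<sigma>)) $$ (\<sigma> y, \<sigma> y') = R $$ (y, y')"
proof -
  have inj: "\<sigma> y = \<sigma> k \<longleftrightarrow> k = y" "\<sigma> y' = \<sigma> k \<longleftrightarrow> k = y'" if "k < N" for k
    using \<sigma>(2) that y by (auto simp: inj_on_def)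
  have \<sigma>y: "\<sigma> y < N" "\<sigma> y' < N" using \<sigma>(1) y by auto
  have PR: "perm_mat N \<sigma> * R \<in> carrier_mat N N" using R by (simp add: mult_carrier_mat[of _ N N])
  have left: "(perm_mat N \<sigma> * R) $$ (\<sigma> y, l) = R $$ (y, l)" if "l < N" for l
  proof -
    have "(perm_mat N \<sigma> * R) $$ (\<sigma> y, l) = (\<Sum>k<N. if k = y then R $$ (k, l) else 0)"
      unfolding mult_index[OF perm_mat_carrier R \<sigma>y(1) that]
      using \<sigma>y inj by (intro sum.cong refl) (auto simp: perm_mat_def)
    then show ?thesis using y by simp
  qed
  have "(perm_mat N \<sigma> * R * mat_adjoint (perm_mat N \<sigma>)) $$ (\<sigma> y, \<sigma> y')
      = (\<Sum>k<N. if k = y' then R $$ (y, k) else 0)"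
    unfolding mult_index[OF PR adjoint_carrier[OF perm_mat_carrier] \<sigma>y]
    using \<sigma>y inj left by (intro sum.cong refl) (auto simp: perm_mat_def)
  then show ?thesis using y by simp
qed

lemma perm_mat_commute_diag:
  assumes "\<And>y. y < N \<Longrightarrow> f (\<sigma> y) = f y"
  shows "perm_mat N \<sigma> * mat_diag N f = mat_diag N f * perm_mat N \<sigma>"
  unfolding mat_diag_mult_right[OF perm_mat_carrier] mat_diag_mult_left[OF perm_mat_carrier]
  using assms by (intro eq_matI) (auto simp: perm_mat_def)

lemma det_mat_diag: "det (mat_diag n f) = (\<Prod>i<n. f i)"
proof -
  have "det (mat_diag n f) = prod_list (diag_mat (mat_diag n f))"
    by (rule det_upper_triangular[of _ n]) (auto simp: mat_diag_def)
  also have "diag_mat (mat_diag n f) = map f [0..<n]"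
    by (auto simp: diag_mat_def mat_diag_def)
  also have "prod_list (map f [0..<n]) = (\<Prod>i<n. f i)"
    by (subst prod.distinct_set_conv_list[symmetric]) (auto simp: atLeast0LessThan)
  finally show ?thesis .
qed

lemma mat_diag_index: "i < n \<Longrightarrow> mat_diag n f $$ (i, i) = f i"
  by (simp add: mat_diag_def)

lemma trace_diag: "mat_trace (mat_diag n f) = (\<Sum>i<n. f i)"
  by (simp add: mat_trace_def mat_diag_def)

lemma density_matrix_diag:
  assumes "\<And>i. i < n \<Longrightarrow> 0 \<le> \<omega> i" "(\<Sum>i<n. \<omega> i) = 1"
  shows "density_matrix n (mat_diag n (\<lambda>i. complex_of_real (\<omega> i)))"
proof -
  have "(\<Sum>i<n. complex_of_real (\<omega> i)) = 1" using assms(2) by (metis of_real_1 of_real_sum)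
  then show ?thesis
    using assms(1) unfolding density_matrix_def trace_diag
    by (auto intro!: positive_operator_diag simp: less_eq_complex_def)
qed

text \<open>Full rank is read off from the determinant, the product of the positive weights.\<close>

lemma full_rank_density_matrix_diag:
  assumes "\<And>i. i < n \<Longrightarrow> 0 < \<omega> i" "(\<Sum>i<n. \<omega> i) = 1"
  shows "full_rank_density_matrix n (mat_diag n (\<lambda>i. complex_of_real (\<omega> i)))"
proof -
  interpret vec_space "TYPE(complex)" n .
  have "det (mat_diag n (\<lambda>i. complex_of_real (\<omega> i))) \<noteq> 0"
    using assms(1) by (force simp: det_mat_diag)
  then have "rank (mat_diag n (\<lambda>i. complex_of_real (\<omega> i))) = n"
    using det_rank_iff[OF mat_diag_dim] by blast
  then show ?thesis
    using density_matrix_diag[of n \<omega>] assms by (simp add: full_rank_density_matrix_def less_imp_le)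
qed

section \<open>The cooling unitary\<close>

lemma triple_tensor_index:
  assumes "A \<in> carrier_mat d d" "B \<in> carrier_mat e e" "C \<in> carrier_mat 2 2" "z < d * e * 2" "z' < d * e * 2"
  shows "(A \<otimes>\<^sub>m B \<otimes>\<^sub>m C) $$ (z, z')
    = A $$ (z div 2 div e, z' div 2 div e) * B $$ (z div 2 mod e, z' div 2 mod e) * C $$ (z mod 2, z' mod 2)"
  using assms div_mod_less[OF assms(4)] div_mod_less[OF assms(5)]
  by (simp add: tensor_index[of _ "d * e" "d * e" _ 2 2] tensor_index[of _ d d _ e e])

lemma triple_tensor_diag:
  "mat_diag d (\<lambda>i. complex_of_real (a i)) \<otimes>\<^sub>m mat_diag e (\<lambda>i. of_real (\<omega> i)) \<otimes>\<^sub>m mat_diag 2 (\<lambda>i. of_real (g i))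
    = mat_diag (d * e * 2) (\<lambda>z. of_real (joint_weight e a \<omega> g z))"
  unfolding tensor_diag joint_weight_def by simp

text \<open>The permutation acts in the eigenbasis of the equilibrium state, to which
  \<open>W\<close> rotates. The input state may have off-diagonal entries in this basis; the
  coherence condition on the permutation keeps them out of the off-diagonal part of the
  output.\<close>

lemma (in lattice_bath) ex_cooling_unitary:
  assumes V: "unitary_operator d V" and \<rho>: "\<rho> \<in> carrier_mat d d"
    and diag: "\<And>i. i < d \<Longrightarrow> (mat_adjoint V * \<rho> * V) $$ (i, i) = of_real (r i)"
    and \<epsilon>: "0 < \<epsilon>"
  defines "\<Gamma> \<equiv> V * mat_diag d (\<lambda>i. of_real (\<gamma> i)) * mat_adjoint V" and "h \<equiv> mat_diag 2 (\<lambda>i. of_real (g i))"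
  shows "\<exists>e \<beta> u. full_rank_density_matrix e \<beta> \<and> unitary_operator (d * e * 2) u \<and>
    u * (\<Gamma> \<otimes>\<^sub>m \<beta> \<otimes>\<^sub>m h) = (\<Gamma> \<otimes>\<^sub>m \<beta> \<otimes>\<^sub>m h) * u \<and>
    (\<exists>q :: real. \<bar>q - p\<bar> < \<epsilon> \<and> ptrace_fst (d * e) 2 (u * (\<rho> \<otimes>\<^sub>m \<beta> \<otimes>\<^sub>m h) * mat_adjoint u)
      = mat_diag 2 (\<lambda>i. of_real (if i = 0 then 1 - q else q)))"
proof -
  obtain e \<omega> \<sigma> where \<omega>: "\<And>b. b < e \<Longrightarrow> 0 < \<omega> b" "(\<Sum>b<e. \<omega> b) = 1"
    and \<sigma>: "bij_betw \<sigma> {..<d * e * 2} {..<d * e * 2}"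
    and weight: "\<And>z. z < d * e * 2 \<Longrightarrow> joint_weight e \<gamma> \<omega> g (\<sigma> z) = joint_weight e \<gamma> \<omega> g z"
    and coh: "\<And>z z'. z < d * e * 2 \<Longrightarrow> z' < d * e * 2 \<Longrightarrow> z div 2 mod e = z' div 2 mod e \<Longrightarrow>
      z mod 2 = z' mod 2 \<Longrightarrow> \<sigma> z div 2 = \<sigma> z' div 2 \<Longrightarrow> \<sigma> z mod 2 = \<sigma> z' mod 2"
    and approx: "\<bar>(\<Sum>z | z < d * e * 2 \<and> \<sigma> z mod 2 = 1. joint_weight e r \<omega> g z) - p\<bar> < \<epsilon>"
    using ex_bath_permutation[OF \<epsilon>] by blast
  define N where "N = d * e * 2"
  define \<beta> where "\<beta> = mat_diag e (\<lambda>b. complex_of_real (\<omega> b))"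
  define W where "W = V \<otimes>\<^sub>m 1\<^sub>m e \<otimes>\<^sub>m 1\<^sub>m 2"
  define P where "P = perm_mat N \<sigma>"
  define \<rho>' where "\<rho>' = mat_adjoint V * \<rho> * V"
  define R where "R = \<rho>' \<otimes>\<^sub>m \<beta> \<otimes>\<^sub>m h"
  define D where "D = mat_diag N (\<lambda>z. complex_of_real (joint_weight e \<gamma> \<omega> g z))"
  define u where "u = W * P * mat_adjoint W"
  have Vc: "V \<in> carrier_mat d d" "mat_adjoint V \<in> carrier_mat d d" using V by auto
  have \<beta>c: "\<beta> \<in> carrier_mat e e" and hc: "h \<in> carrier_mat 2 2" by (simp_all add: \<beta>_def h_def)
  have \<rho>'c: "\<rho>' \<in> carrier_mat d d" using Vc \<rho> by (simp add: \<rho>'_def mult_carrier_mat[of _ d d])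
  have Ve: "unitary_operator (d * e) (V \<otimes>\<^sub>m 1\<^sub>m e)" by (intro unitary_tensor V unitary_one)
  have W: "unitary_operator N W" unfolding W_def N_def by (intro unitary_tensor V unitary_one)
  have P: "unitary_operator N P" using \<sigma> unfolding P_def N_def by (rule perm_mat_unitary)
  have Wc: "W \<in> carrier_mat N N" "mat_adjoint W \<in> carrier_mat N N"
    and Pc: "P \<in> carrier_mat N N" "mat_adjoint P \<in> carrier_mat N N" using W P by auto
  have Rc: "R \<in> carrier_mat N N" and Dc: "D \<in> carrier_mat N N"
    using \<rho>'c \<beta>c hc by (simp_all add: R_def N_def D_def)
  note simps = assoc_mult_mat[of _ N N _ N _ N] mult_carrier_mat[of _ N N]
    unitary_cancel[OF W, of _ N] unitary_cancel[OF P, of _ N]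
  have adjW: "mat_adjoint W = mat_adjoint V \<otimes>\<^sub>m 1\<^sub>m e \<otimes>\<^sub>m 1\<^sub>m 2"
    unfolding W_def using Vc by (simp add: tensor_adjoint[of _ "d * e" "d * e" _ 2 2] tensor_adjoint[of _ d d _ e e])
  have conj: "W * (A \<otimes>\<^sub>m \<beta> \<otimes>\<^sub>m h) * mat_adjoint W = (V * A * mat_adjoint V) \<otimes>\<^sub>m \<beta> \<otimes>\<^sub>m h"
    if A: "A \<in> carrier_mat d d" for A
  proof -
    have "W * (A \<otimes>\<^sub>m \<beta> \<otimes>\<^sub>m h) = (V * A) \<otimes>\<^sub>m \<beta> \<otimes>\<^sub>m h"
      unfolding W_def using A Vc \<beta>c hc
      by (simp add: tensor_mult[of _ "d * e" "d * e" _ 2 2 _ "d * e" _ 2] tensor_mult[of _ d d _ e e _ d _ e])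
    then show ?thesis
      unfolding adjW using A Vc \<beta>c hc
      by (simp add: tensor_mult[of _ "d * e" "d * e" _ 2 2 _ "d * e" _ 2] tensor_mult[of _ d d _ e e _ d _ e]
          mult_carrier_mat[of _ d d])
  qed
  have \<Gamma>_eq: "\<Gamma> \<otimes>\<^sub>m \<beta> \<otimes>\<^sub>m h = W * D * mat_adjoint W"
    using conj[OF mat_diag_dim, of "\<lambda>i. of_real (\<gamma> i)"]
    unfolding \<Gamma>_def h_def \<beta>_def D_def N_def triple_tensor_diag by simp
  have "V * \<rho>' * mat_adjoint V = \<rho>"
    using Vc \<rho> by (simp add: \<rho>'_def assoc_mult_mat[of _ d d _ d _ d] mult_carrier_mat[of _ d d]
        unitary_cancel[OF V, of _ d] unitary_simps[OF V])
  then have \<rho>_eq: "\<rho> \<otimes>\<^sub>m \<beta> \<otimes>\<^sub>m h = W * R * mat_adjoint W"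
    using conj[OF \<rho>'c] by (simp add: R_def)
  have PD: "P * D = D * P"
    unfolding P_def D_def by (rule perm_mat_commute_diag) (simp add: weight N_def)
  have comm: "u * (\<Gamma> \<otimes>\<^sub>m \<beta> \<otimes>\<^sub>m h) = (\<Gamma> \<otimes>\<^sub>m \<beta> \<otimes>\<^sub>m h) * u"
  proof -
    have "u * (\<Gamma> \<otimes>\<^sub>m \<beta> \<otimes>\<^sub>m h) = W * (P * D) * mat_adjoint W"
      unfolding \<Gamma>_eq u_def using Wc Pc Dc by (simp add: simps)
    also have "\<dots> = (\<Gamma> \<otimes>\<^sub>m \<beta> \<otimes>\<^sub>m h) * u"
      unfolding PD \<Gamma>_eq u_def using Wc Pc Dc by (simp add: simps)
    finally show ?thesis .
  qed
  have unitary: "unitary_operator N u" unfolding u_def by (intro unitary_mult W P unitary_adjoint)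
  define Y where "Y = P * R * mat_adjoint P"
  have Yc: "Y \<in> carrier_mat N N" using Pc Rc by (simp add: Y_def simps)
  have "u * (\<rho> \<otimes>\<^sub>m \<beta> \<otimes>\<^sub>m h) * mat_adjoint u = W * Y * mat_adjoint W"
    unfolding \<rho>_eq u_def Y_def using Wc Pc Rc by (simp add: simps adjoint_mult[of _ N N _ N])
  \<comment> \<open>\<open>W\<close> acts trivially on the target, so it drops out of the reduced
    state.\<close>
  then have out: "ptrace_fst (d * e) 2 (u * (\<rho> \<otimes>\<^sub>m \<beta> \<otimes>\<^sub>m h) * mat_adjoint u) = ptrace_fst (d * e) 2 Y"
    using ptrace_fst_unitary_conj[OF Ve, of Y 2] Yc unfolding W_def N_def by simp
  have Y_index: "Y $$ (\<sigma> z, \<sigma> z') = R $$ (z, z')" if "z < N" "z' < N" for z z'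
    unfolding Y_def P_def using \<sigma> Rc that
    by (intro perm_mat_conj_index) (auto simp: bij_betw_def N_def)
  have R_index: "R $$ (z, z') = \<rho>' $$ (z div 2 div e, z' div 2 div e)
      * \<beta> $$ (z div 2 mod e, z' div 2 mod e) * h $$ (z mod 2, z' mod 2)" if "z < N" "z' < N" for z z'
    unfolding R_def using that by (intro triple_tensor_index[OF \<rho>'c \<beta>c hc]) (simp_all add: N_def)
  have R_diag: "R $$ (z, z) = of_real (joint_weight e r \<omega> g z)" if "z < N" for z
  proof -
    have "z < d * e * 2" using that by (simp add: N_def)
    then have "z div 2 < d * e" by (rule div_mod_less)
    then show ?thesis
      using diag[of "z div 2 div e"] div_mod_less[of "z div 2" d e]
      by (simp add: R_index[OF that that] \<beta>_def h_def mat_diag_def joint_weight_def \<rho>'_def)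
  qed
  \<comment> \<open>Contributions to an off-diagonal target entry come from pairs with different
    target bits but equal system and bath states after the permutation. By coherence their preimages
    differ in the bath state or the target bit, where \<open>\<beta>\<close> or \<open>h\<close> has
    a vanishing entry.\<close>
  have zero: "Y $$ (x, x') = 0" if x: "x < N" "x' < N" "x div 2 = x' div 2" "x mod 2 \<noteq> x' mod 2" for x x'
  proof -
    have "x \<in> \<sigma> ` {..<N}" "x' \<in> \<sigma> ` {..<N}"
      using \<sigma> x(1,2) by (simp_all add: bij_betw_def N_def)
    then obtain z z' where z: "z < N" "z' < N" "x = \<sigma> z" "x' = \<sigma> z'" by auto
    have "\<not> (z div 2 mod e = z' div 2 mod e \<and> z mod 2 = z' mod 2)"
      using coh[OF z(1,2)[unfolded N_def]] x(3,4) unfolding z(3,4) by blast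
    moreover have "z div 2 mod e < e" "z' div 2 mod e < e"
      using div_mod_less[of z "d * e" 2] div_mod_less[of z' "d * e" 2] z
        div_mod_less[of "z div 2" d e] div_mod_less[of "z' div 2" d e] by (auto simp: N_def)
    ultimately have "R $$ (z, z') = 0"
      by (auto simp: R_index[OF z(1,2)] \<beta>_def h_def mat_diag_def)
    then show ?thesis using Y_index[OF z(1,2)] z by simp
  qed
  define q where "q = (\<Sum>z | z < N \<and> \<sigma> z mod 2 = 1. joint_weight e r \<omega> g z)"
  have entry: "ptrace_fst (d * e) 2 Y $$ (j, j) = of_real (\<Sum>z | z < N \<and> \<sigma> z mod 2 = j. joint_weight e r \<omega> g z)"
    if j: "j < 2" for j
  proof -
    have "ptrace_fst (d * e) 2 Y $$ (j, j) = (\<Sum>a<d * e. Y $$ (a * 2 + j, a * 2 + j))"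
      using Yc j unfolding N_def by (rule ptrace_fst_entry) (fact j)
    also have "\<dots> = (\<Sum>x | x < N \<and> x mod 2 = j. Y $$ (x, x))"
      using j by (intro sum.reindex_bij_witness[of _ "\<lambda>x. x div 2" "\<lambda>a. a * 2 + j"])
        (auto simp: N_def pair_index_less less_mult_imp_div_less)
    also have "\<dots> = (\<Sum>z | z < N \<and> \<sigma> z mod 2 = j. Y $$ (\<sigma> z, \<sigma> z))"
    proof (rule sum.reindex_bij_betw[symmetric])
      show "bij_betw \<sigma> {z. z < N \<and> \<sigma> z mod 2 = j} {x. x < N \<and> x mod 2 = j}"
      proof (rule bij_betw_subset[OF \<sigma>])
        have img: "\<sigma> ` {..<N} = {..<N}" using \<sigma> by (simp add: bij_betw_def N_def)
        show "\<sigma> ` {z. z < N \<and> \<sigma> z mod 2 = j} = {x. x < N \<and> x mod 2 = j}"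
        proof (intro equalityI subsetI)
          fix x assume x: "x \<in> {x. x < N \<and> x mod 2 = j}"
          then have "x \<in> \<sigma> ` {..<N}" using img by simp
          then show "x \<in> \<sigma> ` {z. z < N \<and> \<sigma> z mod 2 = j}" using x by auto
        qed (use img in auto)
      qed (auto simp: N_def)
    qed
    also have "\<dots> = of_real (\<Sum>z | z < N \<and> \<sigma> z mod 2 = j. joint_weight e r \<omega> g z)"
      unfolding of_real_sum by (rule sum.cong[OF refl]) (simp add: Y_index R_diag)
    finally show ?thesis .
  qed
  have total: "(\<Sum>z<N. joint_weight e r \<omega> g z) = 1"
  proof -
    have "(\<Sum>z<N. joint_weight e r \<omega> g z) = (\<Sum>k<d * e. \<Sum>j<2. r (k div e) * \<omega> (k mod e) * g j)"
      unfolding N_def joint_weight_def by (rule sum_div_mod[where f = "\<lambda>k j. r (k div e) * \<omega> (k mod e) * g j"])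
    also have "\<dots> = (\<Sum>k<d * e. r (k div e) * \<omega> (k mod e) * (g 0 + g 1))"
      by (simp add: lessThan_nat_numeral numeral_eq_Suc distrib_left)
    also have "\<dots> = (\<Sum>i<d. \<Sum>b<e. r i * \<omega> b)"
      unfolding g_sum mult_1_right by (rule sum_div_mod[where f = "\<lambda>i b. r i * \<omega> b"])
    finally show ?thesis using \<omega>(2) r_sum by (simp add: sum_product[symmetric])
  qed
  have "(\<Sum>z<N. joint_weight e r \<omega> g z)
      = (\<Sum>z | z < N \<and> \<sigma> z mod 2 = 0. joint_weight e r \<omega> g z) + q"
    unfolding q_def by (subst sum.union_disjoint[symmetric]) (auto intro!: sum.cong)
  then have q0: "(\<Sum>z | z < N \<and> \<sigma> z mod 2 = 0. joint_weight e r \<omega> g z) = 1 - q" using total by simp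
  have out_eq: "ptrace_fst (d * e) 2 Y = mat_diag 2 (\<lambda>i. of_real (if i = 0 then 1 - q else q))"
  proof (rule eq_matI, goal_cases)
    case (1 i j)
    then have ij: "i < 2" "j < 2" by (auto simp: mat_diag_def)
    show ?case
    proof (cases "i = j")
      case True
      have "i = 0 \<or> i = 1" using ij by auto
      moreover have "ptrace_fst (d * e) 2 Y $$ (0, 0) = of_real (1 - q)" unfolding entry[OF pos2] q0 ..
      moreover have "ptrace_fst (d * e) 2 Y $$ (1, 1) = of_real q" unfolding entry[OF one_less_two] q_def ..
      ultimately show ?thesis using True by (auto simp: mat_diag_def)
    next
      case False
      have "ptrace_fst (d * e) 2 Y $$ (i, j) = (\<Sum>a<d * e. Y $$ (a * 2 + i, a * 2 + j))"
        using Yc ij unfolding N_def by (rule ptrace_fst_entry)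
      also have "\<dots> = 0"
        using ij False by (intro sum.neutral ballI zero) (auto simp: N_def pair_index_less)
      finally show ?thesis using ij False by (simp add: mat_diag_def)
    qed
  qed (simp_all add: ptrace_fst_def mat_diag_def)
  have "full_rank_density_matrix e \<beta>"
    unfolding \<beta>_def using \<omega> by (rule full_rank_density_matrix_diag)
  moreover have "\<bar>q - p\<bar> < \<epsilon>" using approx by (simp add: q_def N_def)
  moreover have "ptrace_fst (d * e) 2 (u * (\<rho> \<otimes>\<^sub>m \<beta> \<otimes>\<^sub>m h) * mat_adjoint u)
      = mat_diag 2 (\<lambda>i. of_real (if i = 0 then 1 - q else q))"
    unfolding out by (rule out_eq)
  ultimately show ?thesis
    using unitary comm unfolding N_def by blast
qed

section \<open>Conversion sequences and the equivalence\<close>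

lemma mat_trace_add:
  "A \<in> carrier_mat n n \<Longrightarrow> B \<in> carrier_mat n n \<Longrightarrow> mat_trace (A + B) = mat_trace A + mat_trace B"
  by (simp add: mat_trace_def sum.distrib)

text \<open>By cyclicity only the diagonal of \<open>A\<close> in the eigenbasis meets the
  eigenvalues; this turns the expectations of an effect into the weighted sums of
  \<open>lattice_bath\<close>.\<close>

lemma trace_conj_diag:
  assumes "unitary_operator n U" "A \<in> carrier_mat n n"
  shows "mat_trace (A * (U * mat_diag n f * mat_adjoint U))
    = (\<Sum>i<n. (mat_adjoint U * A * U) $$ (i, i) * f i)"
proof -
  have U: "U \<in> carrier_mat n n" "mat_adjoint U \<in> carrier_mat n n" using assms by auto
  note simps = assoc_mult_mat[of _ n n _ n _ n] mult_carrier_mat[of _ n n]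
  have UAU: "mat_adjoint U * A * U \<in> carrier_mat n n" using U assms by (simp add: simps)
  have "mat_trace (A * (U * mat_diag n f * mat_adjoint U)) = mat_trace ((A * U * mat_diag n f) * mat_adjoint U)"
    using U assms by (simp add: simps)
  also have "\<dots> = mat_trace (mat_adjoint U * (A * U * mat_diag n f))"
    using U assms by (intro trace_mult_comm[of _ n n]) (simp_all add: simps)
  also have "\<dots> = mat_trace (mat_adjoint U * A * U * mat_diag n f)"
    using U assms by (simp add: simps)
  also have "\<dots> = (\<Sum>i<n. (mat_adjoint U * A * U) $$ (i, i) * f i)"
    unfolding mat_diag_mult_right[OF UAU] by (simp add: mat_trace_def)
  finally show ?thesis .
qed

text \<open>In a common eigenbasis of \<gamma> and \<open>E1\<close> the data satisfy the
  assumptions of \<open>lattice_bath\<close> with \<open>p = s\<close>; one cooling unitary for each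
  tolerance gives the sequence.\<close>

lemma decision_rule_imp_converts:
  assumes \<gamma>: "full_rank_density_matrix d \<gamma>" and \<rho>: "density_matrix d \<rho>"
    and rule: "decision_rule d E0 E1" and comm: "E1 * \<gamma> = \<gamma> * E1"
    and g: "0 < g 0" "0 < g 1" "g 0 + g 1 = (1 :: real)"
    and \<gamma>E: "mat_trace (\<gamma> * E1) = of_real (g 1)" and \<rho>E: "mat_trace (\<rho> * E1) = of_real s"
  shows "converts d (\<rho>, \<gamma>) 2
    (mat_diag 2 (\<lambda>i. of_real (if i = 0 then 1 - s else s)), mat_diag 2 (\<lambda>i. of_real (g i)))"
proof -
  have \<gamma>pos: "positive_operator d \<gamma>" and \<rho>pos: "positive_operator d \<rho>" and E1pos: "positive_operator d E1"
    and E0pos: "positive_operator d E0"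
    using \<gamma> \<rho> rule by (auto simp: full_rank_density_matrix_def density_matrix_def decision_rule_def)
  have c: "\<gamma> \<in> carrier_mat d d" "\<rho> \<in> carrier_mat d d" "E1 \<in> carrier_mat d d" "E0 \<in> carrier_mat d d"
    using \<gamma>pos \<rho>pos E1pos E0pos by auto
  obtain V a b where V: "unitary_operator d V"
    and \<gamma>V: "\<gamma> = V * mat_diag d (\<lambda>i. complex_of_real (a i)) * mat_adjoint V"
    and EV: "E1 = V * mat_diag d (\<lambda>i. complex_of_real (b i)) * mat_adjoint V"
    using commuting_hermitian_diagonalizable[OF c(1) positive_operator_hermitian[OF \<gamma>pos]
        c(3) positive_operator_hermitian[OF E1pos] comm[symmetric]] by blast
  have Vc: "V \<in> carrier_mat d d" "mat_adjoint V \<in> carrier_mat d d" using V by auto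
  note simps = assoc_mult_mat[of _ d d _ d _ d] mult_carrier_mat[of _ d d] unitary_cancel[OF V, of _ d]
    unitary_simps[OF V]
  have \<gamma>_conj: "mat_adjoint V * \<gamma> * V = mat_diag d (\<lambda>i. complex_of_real (a i))"
    unfolding \<gamma>V by (rule unitary_conj_cancel[OF V mat_diag_dim])
  \<comment> \<open>Full rank turns non-negative eigenvalues into positive ones, as the bath weights
    require.\<close>
  have a_pos: "0 < a i" if "i < d" for i
  proof -
    interpret vec_space "TYPE(complex)" d .
    have "det \<gamma> \<noteq> 0" using \<gamma> det_rank_iff[OF c(1)] by (simp add: full_rank_density_matrix_def)
    then have "(\<Prod>i<d. complex_of_real (a i)) \<noteq> 0"
      unfolding \<gamma>V using Vc by (auto simp: det_mult[of _ d] det_mat_diag mult_carrier_mat[of _ d d])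
    then have "a i \<noteq> 0" using that by auto
    moreover have "0 \<le> a i"
      using positive_operator_eigenvalue[OF \<gamma>pos[unfolded \<gamma>V] V that] by (simp add: less_eq_complex_def)
    ultimately show ?thesis by simp
  qed
  \<comment> \<open>Positivity of the complementary operator \<open>E0\<close> provides the upper
    bound 1 for the eigenvalues of \<open>E1\<close>.\<close>
  have E0V: "E0 = V * mat_diag d (\<lambda>i. complex_of_real (1 - b i)) * mat_adjoint V"
  proof (rule eq_matI, goal_cases)
    case (1 i j)
    then have ij: "i < d" "j < d" using Vc by auto
    have "E0 $$ (i, j) + E1 $$ (i, j) = (E0 + E1) $$ (i, j)" using c ij by simp
    also have "\<dots> = 1\<^sub>m d $$ (i, j)" using rule by (simp add: decision_rule_def)
    finally have "E0 $$ (i, j) = 1\<^sub>m d $$ (i, j) - E1 $$ (i, j)" by (simp add: algebra_simps)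
    also have "1\<^sub>m d = V * mat_diag d (\<lambda>i. 1) * mat_adjoint V"
      using Vc by (simp add: simps)
    also have "(V * mat_diag d (\<lambda>i. 1) * mat_adjoint V) $$ (i, j) - E1 $$ (i, j)
        = (V * mat_diag d (\<lambda>i. complex_of_real (1 - b i)) * mat_adjoint V) $$ (i, j)"
      unfolding EV diag_conj_index[OF Vc(1) ij]
      by (simp add: sum_subtractf algebra_simps)
    finally show ?case .
  qed (use c Vc in auto)
  have b: "0 \<le> b i" "b i \<le> 1" if "i < d" for i
    using positive_operator_eigenvalue[OF E1pos[unfolded EV] V that]
      positive_operator_eigenvalue[OF E0pos[unfolded E0V] V that]
    by (simp_all add: less_eq_complex_def)
  define r where "r i = Re ((mat_adjoint V * \<rho> * V) $$ (i, i))" for i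
  have r: "(mat_adjoint V * \<rho> * V) $$ (i, i) = of_real (r i)" "0 \<le> r i" if "i < d" for i
    using positive_operator_diag_entry[OF positive_operator_conj[OF \<rho>pos Vc(1)] that]
    by (auto simp: r_def less_eq_complex_def complex_eq_iff)
  have one: "A * (V * mat_diag d (\<lambda>i. 1) * mat_adjoint V) = A" if "A \<in> carrier_mat d d" for A
    using that Vc by (simp add: simps)
  have "complex_of_real (\<Sum>i<d. a i) = 1"
    using trace_conj_diag[OF V c(1), of "\<lambda>_. 1"] \<gamma> one[OF c(1)]
    by (simp add: \<gamma>_conj full_rank_density_matrix_def density_matrix_def mat_diag_index)
  then have a_sum: "(\<Sum>i<d. a i) = 1" by (simp only: of_real_eq_1_iff)
  have "complex_of_real (\<Sum>i<d. r i) = 1"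
    using trace_conj_diag[OF V c(2), of "\<lambda>_. 1"] \<rho> one[OF c(2)]
    by (simp add: r density_matrix_def)
  then have r_sum: "(\<Sum>i<d. r i) = 1" by (simp only: of_real_eq_1_iff)
  have "complex_of_real (\<Sum>i<d. a i * b i) = of_real (g 1)"
    using trace_conj_diag[OF V c(1), of "\<lambda>i. of_real (b i)"] \<gamma>E
    by (simp add: \<gamma>_conj EV[symmetric] mat_diag_index)
  then have ab: "(\<Sum>i<d. a i * b i) = g 1" by (simp only: of_real_eq_iff)
  have "complex_of_real (\<Sum>i<d. r i * b i) = of_real s"
    using trace_conj_diag[OF V c(2), of "\<lambda>i. of_real (b i)"] \<rho>E by (simp add: r EV[symmetric])
  then have rb: "(\<Sum>i<d. r i * b i) = s" by (simp only: of_real_eq_iff)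
  interpret lattice_bath d a r b g
    by unfold_locales (use a_pos a_sum r r_sum b g ab in auto)
  have p: "p = s" using rb by (simp add: p_def)
  define h where "h = mat_diag 2 (\<lambda>i. complex_of_real (g i))"
  \<comment> \<open>The \<open>n\<close>-th conversion is accurate to \<open>1 / (n + 1)\<close>.
    Bath, unitary and output population are packed into one tuple so that a single choice yields all
    sequences.\<close>
  have "\<forall>n. \<exists>x. case x of (e, \<beta>, u, q) \<Rightarrow> full_rank_density_matrix e \<beta> \<and> unitary_operator (d * e * 2) u \<and>
    u * (\<gamma> \<otimes>\<^sub>m \<beta> \<otimes>\<^sub>m h) = (\<gamma> \<otimes>\<^sub>m \<beta> \<otimes>\<^sub>m h) * u \<and> \<bar>q - s\<bar> < inverse (real (Suc n)) \<and>
    ptrace_fst (d * e) 2 (u * (\<rho> \<otimes>\<^sub>m \<beta> \<otimes>\<^sub>m h) * mat_adjoint u)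
      = mat_diag 2 (\<lambda>i. of_real (if i = 0 then 1 - q else q))"
  proof
    fix n
    have "0 < inverse (real (Suc n))" by simp
    from ex_cooling_unitary[OF V c(2) r(1) this, folded \<gamma>V h_def, unfolded p]
    show "\<exists>x. case x of (e, \<beta>, u, q) \<Rightarrow> full_rank_density_matrix e \<beta> \<and> unitary_operator (d * e * 2) u \<and>
      u * (\<gamma> \<otimes>\<^sub>m \<beta> \<otimes>\<^sub>m h) = (\<gamma> \<otimes>\<^sub>m \<beta> \<otimes>\<^sub>m h) * u \<and> \<bar>q - s\<bar> < inverse (real (Suc n)) \<and>
      ptrace_fst (d * e) 2 (u * (\<rho> \<otimes>\<^sub>m \<beta> \<otimes>\<^sub>m h) * mat_adjoint u)
        = mat_diag 2 (\<lambda>i. of_real (if i = 0 then 1 - q else q))"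
      by (simp only: split_paired_Ex prod.case) blast
  qed
  from choice[OF this] obtain x where x: "\<forall>n. case x n of (e, \<beta>, u, q) \<Rightarrow> full_rank_density_matrix e \<beta> \<and> unitary_operator (d * e * 2) u \<and>
    u * (\<gamma> \<otimes>\<^sub>m \<beta> \<otimes>\<^sub>m h) = (\<gamma> \<otimes>\<^sub>m \<beta> \<otimes>\<^sub>m h) * u \<and> \<bar>q - s\<bar> < inverse (real (Suc n)) \<and>
    ptrace_fst (d * e) 2 (u * (\<rho> \<otimes>\<^sub>m \<beta> \<otimes>\<^sub>m h) * mat_adjoint u)
      = mat_diag 2 (\<lambda>i. of_real (if i = 0 then 1 - q else q))" ..
  define e where "e n = fst (x n)" for n
  define \<beta> where "\<beta> n = fst (snd (x n))" for n
  define u where "u n = fst (snd (snd (x n)))" for n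
  define q where "q n = snd (snd (snd (x n)))" for n
  have all: "full_rank_density_matrix (e n) (\<beta> n)" "unitary_operator (d * e n * 2) (u n)"
    "u n * (\<gamma> \<otimes>\<^sub>m \<beta> n \<otimes>\<^sub>m h) = (\<gamma> \<otimes>\<^sub>m \<beta> n \<otimes>\<^sub>m h) * u n" "\<bar>q n - s\<bar> < inverse (real (Suc n))"
    "ptrace_fst (d * e n) 2 (u n * (\<rho> \<otimes>\<^sub>m \<beta> n \<otimes>\<^sub>m h) * mat_adjoint (u n))
      = mat_diag 2 (\<lambda>i. of_real (if i = 0 then 1 - q n else q n))" for n
    using x[rule_format, of n] unfolding e_def \<beta>_def u_def q_def case_prod_unfold by blast+
  have "(\<lambda>n. \<bar>q n - s\<bar>) \<longlonglongrightarrow> 0"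
    using all(4) by (intro real_tendsto_sandwich[OF _ _ tendsto_const LIMSEQ_inverse_real_of_nat])
      (auto intro!: always_eventually less_imp_le)
  then have "(\<lambda>n. q n - s) \<longlonglongrightarrow> 0" by (rule tendsto_rabs_zero_cancel)
  then have q_lim: "q \<longlonglongrightarrow> s" by (simp add: LIM_zero_iff)
  have "mat_tendsto 2 (\<lambda>n. ptrace_fst (d * e n) 2 (u n * (\<rho> \<otimes>\<^sub>m \<beta> n \<otimes>\<^sub>m h) * mat_adjoint (u n)))
      (mat_diag 2 (\<lambda>i. of_real (if i = 0 then 1 - s else s)))"
    unfolding all(5) mat_tendsto_def
  proof (intro allI impI)
    fix i j :: nat assume ij: "i < 2" "j < 2"
    have "(\<lambda>n. complex_of_real (if i = j then if i = 0 then 1 - q n else q n else 0))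
        \<longlonglongrightarrow> of_real (if i = j then if i = 0 then 1 - s else s else 0)"
      using q_lim by (intro tendsto_of_real) (auto intro: tendsto_intros)
    then show "(\<lambda>n. mat_diag 2 (\<lambda>i. complex_of_real (if i = 0 then 1 - q n else q n)) $$ (i, j))
        \<longlonglongrightarrow> mat_diag 2 (\<lambda>i. complex_of_real (if i = 0 then 1 - s else s)) $$ (i, j)"
      using ij by (simp add: mat_diag_def split: if_splits)
  qed
  then show ?thesis
    unfolding converts_def Let_def fst_conv snd_conv h_def[symmetric] using all(1-3)
    by blast
qed

theorem theorem7:
  fixes k T E T' :: real and d :: nat and \<rho> \<gamma> :: "complex mat"
  assumes "k > 0" and "T \<noteq> 0" and "E > 0" and "T' \<noteq> 0" and "1 / T' > 1 / T"
    and "is_object d (\<rho>, \<gamma>)"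
  shows "can_cool_qubit k T d (\<rho>, \<gamma>) E T' \<longleftrightarrow>
    (\<exists>E\<^sub>\<rho> E\<^sub>\<gamma>. decision_rule d E\<^sub>\<rho> E\<^sub>\<gamma> \<and> E\<^sub>\<gamma> * \<gamma> = \<gamma> * E\<^sub>\<gamma> \<and>
       mat_trace (\<gamma> * E\<^sub>\<rho>) = complex_of_real (1 / (1 + exp (- E / (k * T)))) \<and>
       mat_trace (\<rho> * E\<^sub>\<gamma>) = complex_of_real (exp (- E / (k * T')) / (1 + exp (- E / (k * T')))))"
proof -
  \<comment> \<open>\<open>p\<close> is the ground state population at temperature \<open>T\<close>,
    and \<open>s\<close> is the excited population at \<open>T'\<close>, i.e. the required second
    error probability.\<close>
  define p where "p = 1 / (1 + exp (- E / (k * T)))"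
  define s where "s = exp (- E / (k * T')) / (1 + exp (- E / (k * T')))"
  define g where "g i = (if i = 0 then p else 1 - p)" for i :: nat
  have "0 < p" "p < 1" by (auto simp: p_def add_pos_pos field_simps)
  then have g: "0 < g 0" "0 < g 1" "g 0 + g 1 = 1" by (auto simp: g_def)
  have "1 + exp (- E / (k * T')) > 0" by (simp add: add_pos_pos)
  then have s: "1 / (1 + exp (- E / (k * T'))) = 1 - s" by (simp add: s_def field_simps)
  have thermal: "qubit_thermal k E T = mat_diag 2 (\<lambda>i. of_real (g i))"
    "qubit_thermal k E T' = mat_diag 2 (\<lambda>i. of_real (if i = 0 then 1 - s else s))"
    unfolding qubit_thermal_def Let_def s g_def p_def[symmetric] by (simp_all cong: if_cong)
  have \<gamma>: "full_rank_density_matrix d \<gamma>" "mat_trace \<gamma> = 1" "\<gamma> \<in> carrier_mat d d"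
    and \<rho>: "density_matrix d \<rho>" "\<rho> \<in> carrier_mat d d"
    using assms(6) by (auto simp: is_object_def full_rank_density_matrix_def density_matrix_def)
  \<comment> \<open>Since \<gamma> has trace 1 and the two operators sum to the identity,
    prescribing the first error probability amounts to prescribing the equilibrium expectation of
    the second operator.\<close>
  have trace: "mat_trace (\<gamma> * E0) = of_real p \<longleftrightarrow> mat_trace (\<gamma> * E1) = of_real (g 1)"
    if "decision_rule d E0 E1" for E0 E1
  proof -
    have c: "E0 \<in> carrier_mat d d" "E1 \<in> carrier_mat d d" and sum: "E0 + E1 = 1\<^sub>m d"
      using that by (auto simp: decision_rule_def)
    have "mat_trace (\<gamma> * E0) + mat_trace (\<gamma> * E1) = mat_trace (\<gamma> * (E0 + E1))"
      using \<gamma>(3) c by (simp add: mult_add_distrib_mat[of _ d d _ d] mat_trace_add[of _ d] mult_carrier_mat[of _ d d])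
    also have "\<dots> = 1" using \<gamma> by (simp add: sum)
    finally have "mat_trace (\<gamma> * E0) = 1 - mat_trace (\<gamma> * E1)" by (simp add: algebra_simps)
    then show ?thesis by (auto simp: g_def complex_eq_iff)
  qed
  show ?thesis
    unfolding can_cool_qubit_def thermal p_def[symmetric] s_def[symmetric]
  proof
    have h: "density_matrix 2 (mat_diag 2 (\<lambda>i. complex_of_real (g i)))"
    proof (rule density_matrix_diag)
      show "0 \<le> g i" if "i < 2" for i using g less_2_cases[OF that] by auto
      show "(\<Sum>i<2. g i) = 1" using g by (simp add: lessThan_nat_numeral numeral_eq_Suc)
    qed
    assume "converts d (\<rho>, \<gamma>) 2
      (mat_diag 2 (\<lambda>i. of_real (if i = 0 then 1 - s else s)), mat_diag 2 (\<lambda>i. of_real (g i)))"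
    from converts_imp_decision_rule[OF \<gamma>(3) \<rho>(2) h this]
    show "\<exists>E0 E1. decision_rule d E0 E1 \<and> E1 * \<gamma> = \<gamma> * E1 \<and> mat_trace (\<gamma> * E0) = of_real p \<and>
        mat_trace (\<rho> * E1) = of_real s"
      using trace \<gamma>(2) by (auto simp: mat_diag_def)
  next
    assume "\<exists>E0 E1. decision_rule d E0 E1 \<and> E1 * \<gamma> = \<gamma> * E1 \<and> mat_trace (\<gamma> * E0) = of_real p \<and>
        mat_trace (\<rho> * E1) = of_real s"
    then show "converts d (\<rho>, \<gamma>) 2
      (mat_diag 2 (\<lambda>i. of_real (if i = 0 then 1 - s else s)), mat_diag 2 (\<lambda>i. of_real (g i)))"
      using decision_rule_imp_converts[OF \<gamma>(1) \<rho>(1)] g trace by blast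
  qed
qed

end
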